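(* Let $n\ge 1$ and $k\in\{1,\dots,n\}$. Then the map \[ \varphi_1:\mathrm{O}(n)/\bigl(\mathrm{O}(k)\times \mathrm{O}(n-k)\bigr)\to\{Q\in \mathrm{O}(n): Q^{\mathsf T}=Q,\ \operatorname{tr}(Q)=2k-n\},\qquad \varphi_1([V])=V I_{k,n-k}V^{\mathsf T}, \] is a (well-defined) diffeomorphism, with inverse $\varphi_1^{-1}(Q)=[V_Q]$.
   Context: $I_{k,n-k}=\operatorname{diag}(I_k,-I_{n-k})$. $\mathrm{O}(k)\times\mathrm{O}(n-k)$ is embedded in $\mathrm{O}(n)$ as block-diagonal matrices and acts on the right; $[V]=\bigl\{V\begin{bmatrix}Q_1&0\\0&Q_2\end{bmatrix}:Q_1\in\mathrm{O}(k),\ Q_2\in\mathrm{O}(n-k)\bigr\}$ is the coset of $V\in\mathrm{O}(n)$. The quotient has its standard homogeneous space structure and the target set has the smooth structure of an embedded submanifold of $\mathrm{O}(n)$. For $Q$ in the target set, $V_Q=[Y_Q,Z_Q]\in\mathrm{O}(n)$ denotes any orthogonal matrix of eigenvectors of $Q$ whose first $k$ columns $Y_Q$ are eigenvectors for eigenvalue $1$ and last $n-k$ columns $Z_Q$ are eigenvectors for eigenvalue $-1$, i.e. $Q=V_QI_{k,n-k}V_Q^{\mathsf T}$. *)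

theory Defs
  imports "HOL-Analysis.Analysis"
begin

section \<open>Smooth maps between subsets of Euclidean spaces\<close>

primrec Ck_on :: "nat \<Rightarrow> ('a::euclidean_space \<Rightarrow> 'b::euclidean_space) \<Rightarrow> 'a set \<Rightarrow> bool" where
  "Ck_on 0 f U \<longleftrightarrow> continuous_on U f"
| "Ck_on (Suc m) f U \<longleftrightarrow>
     (\<forall>x\<in>U. f differentiable (at x)) \<and>
     (\<forall>v. Ck_on m (\<lambda>x. frechet_derivative f (at x) v) U)"

text \<open>Smoothness on a set that need not be open means that \<open>f\<close> extends smoothly near every
  point.  For a relatively open subset of a linear subspace this is ordinary \<open>C\<^sup>\<infinity>\<close> smoothness
  on that vector space.\<close>

definition smooth_on :: "'a::euclidean_space set \<Rightarrow> ('a \<Rightarrow> 'b::euclidean_space) \<Rightarrow> bool" where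
  "smooth_on W f \<longleftrightarrow>
     (\<forall>x\<in>W. \<exists>U g. open U \<and> x \<in> U \<and> (\<forall>m. Ck_on m g U) \<and> (\<forall>y\<in>U \<inter> W. g y = f y))"


section \<open>Smooth manifolds\<close>

text \<open>A manifold is modelled on a linear subspace \<open>model M\<close> of a Euclidean space rather than on
  a whole type, since every type of class \<open>euclidean_space\<close> has positive dimension and
  zero-dimensional manifolds are needed (the case \<open>k = n\<close>).  The dimension of \<open>M\<close> is
  \<open>dim (model M)\<close>.  The atlas need not be maximal.\<close>

type_synonym ('a, 'e) chart = "'a set \<times> ('a \<Rightarrow> 'e)"

record ('a, 'e) manifold =
  mtop :: "'a topology"
  model :: "'e set"
  atlas :: "('a, 'e) chart set"

abbreviation carrier_of :: "('a, 'e) manifold \<Rightarrow> 'a set" where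
  "carrier_of M \<equiv> topspace (mtop M)"

definition is_chart :: "'a topology \<Rightarrow> 'e::euclidean_space set \<Rightarrow> ('a, 'e) chart \<Rightarrow> bool" where
  "is_chart X E c \<longleftrightarrow>
     openin X (fst c) \<and> openin (top_of_set E) (snd c ` fst c) \<and>
     homeomorphic_map (subtopology X (fst c)) (top_of_set (snd c ` fst c)) (snd c)"

definition coord_dom :: "('a, 'e) chart \<Rightarrow> ('b, 'f) chart \<Rightarrow> ('a \<Rightarrow> 'b) \<Rightarrow> 'e set" where
  "coord_dom c d f = snd c ` {p \<in> fst c. f p \<in> fst d}"

definition coord_rep :: "('a, 'e) chart \<Rightarrow> ('b, 'f) chart \<Rightarrow> ('a \<Rightarrow> 'b) \<Rightarrow> 'e \<Rightarrow> 'f" where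
  "coord_rep c d f = snd d \<circ> f \<circ> inv_into (fst c) (snd c)"

definition smooth_manifold :: "('a, 'e::euclidean_space) manifold \<Rightarrow> bool" where
  "smooth_manifold M \<longleftrightarrow>
     Hausdorff_space (mtop M) \<and> second_countable (mtop M) \<and> subspace (model M) \<and>
     (\<forall>c\<in>atlas M. is_chart (mtop M) (model M) c) \<and>
     (\<Union>c\<in>atlas M. fst c) = carrier_of M \<and>
     (\<forall>c\<in>atlas M. \<forall>d\<in>atlas M. smooth_on (coord_dom c d (\<lambda>p. p)) (coord_rep c d (\<lambda>p. p)))"

definition smooth_map ::
    "('a, 'e::euclidean_space) manifold \<Rightarrow> ('b, 'f::euclidean_space) manifold \<Rightarrow> ('a \<Rightarrow> 'b) \<Rightarrow> bool"
  where
  "smooth_map M N f \<longleftrightarrow>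
     continuous_map (mtop M) (mtop N) f \<and>
     (\<forall>c\<in>atlas M. \<forall>d\<in>atlas N. smooth_on (coord_dom c d f) (coord_rep c d f))"

definition diffeomorphism ::
    "('a, 'e::euclidean_space) manifold \<Rightarrow> ('b, 'f::euclidean_space) manifold \<Rightarrow> ('a \<Rightarrow> 'b) \<Rightarrow> bool"
  where
  "diffeomorphism M N f \<longleftrightarrow>
     bij_betw f (carrier_of M) (carrier_of N) \<and>
     smooth_map M N f \<and> smooth_map N M (inv_into (carrier_of M) f)"

text \<open>The derivative \<open>D\<close> below is determined only on \<open>model M\<close>, which is the domain of the
  differential of \<open>f\<close> in the two charts.\<close>

definition smooth_immersion ::
    "('a, 'e::euclidean_space) manifold \<Rightarrow> ('b, 'f::euclidean_space) manifold \<Rightarrow> ('a \<Rightarrow> 'b) \<Rightarrow> bool"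
  where
  "smooth_immersion M N f \<longleftrightarrow>
     smooth_map M N f \<and>
     (\<forall>c\<in>atlas M. \<forall>d\<in>atlas N. \<forall>x\<in>coord_dom c d f.
        \<exists>D. (coord_rep c d f has_derivative D) (at x within coord_dom c d f) \<and>
            inj_on D (model M))"

definition smooth_submersion ::
    "('a, 'e::euclidean_space) manifold \<Rightarrow> ('b, 'f::euclidean_space) manifold \<Rightarrow> ('a \<Rightarrow> 'b) \<Rightarrow> bool"
  where
  "smooth_submersion M N f \<longleftrightarrow>
     smooth_map M N f \<and>
     (\<forall>c\<in>atlas M. \<forall>d\<in>atlas N. \<forall>x\<in>coord_dom c d f.
        \<exists>D. (coord_rep c d f has_derivative D) (at x within coord_dom c d f) \<and>
            D ` model M = model N)"

definition euclidean_manifold :: "('e::euclidean_space, 'e) manifold" where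
  "euclidean_manifold = \<lparr>mtop = euclidean, model = UNIV, atlas = {(UNIV, \<lambda>x. x)}\<rparr>"

text \<open>\<open>M\<close> is the set \<open>S\<close> with the structure of an embedded submanifold of \<open>N\<close>: the subspace
  topology, and a smooth structure for which the inclusion is an immersion.\<close>

definition embedded_submanifold ::
    "'a set \<Rightarrow> ('a, 'e::euclidean_space) manifold \<Rightarrow> ('a, 'f::euclidean_space) manifold \<Rightarrow> bool"
  where
  "embedded_submanifold S M N \<longleftrightarrow>
     S \<subseteq> carrier_of N \<and> smooth_manifold M \<and> smooth_manifold N \<and>
     mtop M = subtopology (mtop N) S \<and> smooth_immersion M N (\<lambda>p. p)"


section \<open>Quotient topology\<close>

definition quotient_topology :: "'a topology \<Rightarrow> ('a \<Rightarrow> 'b) \<Rightarrow> 'b topology" where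
  "quotient_topology X \<pi> =
     topology (\<lambda>U. U \<subseteq> \<pi> ` topspace X \<and> openin X {x \<in> topspace X. \<pi> x \<in> U})"

lemma openin_quotient_topology:
  "openin (quotient_topology X \<pi>) U \<longleftrightarrow>
     U \<subseteq> \<pi> ` topspace X \<and> openin X {x \<in> topspace X. \<pi> x \<in> U}"
proof -
  let ?P = "\<lambda>U. U \<subseteq> \<pi> ` topspace X \<and> openin X {x \<in> topspace X. \<pi> x \<in> U}"
  have "istopology ?P"
    unfolding istopology_def
  proof (intro conjI allI impI)
    fix S T assume S: "?P S" and T: "?P T"
    have "{x \<in> topspace X. \<pi> x \<in> S \<inter> T} = {x \<in> topspace X. \<pi> x \<in> S} \<inter> {x \<in> topspace X. \<pi> x \<in> T}"
      by auto
    then show "openin X {x \<in> topspace X. \<pi> x \<in> S \<inter> T}" using S T by auto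
    show "S \<inter> T \<subseteq> \<pi> ` topspace X" using S by auto
  next
    fix K assume K: "\<forall>U\<in>K. ?P U"
    have "{x \<in> topspace X. \<pi> x \<in> \<Union>K} = (\<Union>U\<in>K. {x \<in> topspace X. \<pi> x \<in> U})" by auto
    then show "openin X {x \<in> topspace X. \<pi> x \<in> \<Union>K}" using K by auto
    show "\<Union>K \<subseteq> \<pi> ` topspace X" using K by auto
  qed
  then show ?thesis unfolding quotient_topology_def by (simp add: topology_inverse')
qed

lemma topspace_quotient_topology: "topspace (quotient_topology X \<pi>) = \<pi> ` topspace X"
proof -
  have "{x \<in> topspace X. \<pi> x \<in> \<pi> ` topspace X} = topspace X" by auto
  then have "openin (quotient_topology X \<pi>) (\<pi> ` topspace X)"
    by (simp add: openin_quotient_topology)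
  then show ?thesis
    by (metis openin_quotient_topology openin_subset openin_topspace subset_antisym)
qed

lemma quotient_map_quotient_topology: "quotient_map X (quotient_topology X \<pi>) \<pi>"
  by (auto simp: quotient_map_def topspace_quotient_topology openin_quotient_topology)


section \<open>The orthogonal group and its quotient\<close>

text \<open>Real \<open>n \<times> n\<close> matrices are \<open>real ^ 'n ^ 'n\<close> with \<open>n = CARD('n)\<close>.  The linear order on
  \<open>'n\<close> says which rows and columns come first: \<open>pos i\<close> is the position of \<open>i\<close>, counted
  from \<open>0\<close> to \<open>n - 1\<close>.\<close>

type_synonym 'n rmat = "real ^ 'n ^ 'n"

definition pos :: "'n::{finite, linorder} \<Rightarrow> nat" where
  "pos i = card {j. j < i}"

definition sig_matrix :: "nat \<Rightarrow> 'n::{finite, linorder} rmat" where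
  "sig_matrix k = (\<chi> i j. if i = j then (if pos i < k then 1 else - 1) else 0)"

definition orth_group :: "'n::finite rmat set" where
  "orth_group = {V. orthogonal_matrix V}"

text \<open>The blocks have sizes \<open>k\<close> and \<open>n - k\<close>, the second of which can be \<open>0\<close>, so they are
  functions on \<open>nat\<close> of which only the entries with indices below the size are used.\<close>

definition orth_block :: "nat \<Rightarrow> (nat \<Rightarrow> nat \<Rightarrow> real) \<Rightarrow> bool" where
  "orth_block m Q \<longleftrightarrow> (\<forall>i<m. \<forall>j<m. (\<Sum>l<m. Q l i * Q l j) = (if i = j then 1 else 0))"

definition block_diag ::
    "nat \<Rightarrow> (nat \<Rightarrow> nat \<Rightarrow> real) \<Rightarrow> (nat \<Rightarrow> nat \<Rightarrow> real) \<Rightarrow> 'n::{finite, linorder} rmat" where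
  "block_diag k Q1 Q2 = (\<chi> i j.
     if pos i < k \<and> pos j < k then Q1 (pos i) (pos j)
     else if k \<le> pos i \<and> k \<le> pos j then Q2 (pos i - k) (pos j - k)
     else 0)"

definition coset :: "nat \<Rightarrow> 'n::{finite, linorder} rmat \<Rightarrow> 'n rmat set" where
  "coset k V = {V ** block_diag k Q1 Q2 | Q1 Q2. orth_block k Q1 \<and> orth_block (CARD('n) - k) Q2}"

text \<open>The standard structure on the homogeneous space: the quotient topology and a smooth
  structure for which the projection is a submersion.\<close>

definition homogeneous_space_structure ::
    "nat \<Rightarrow> ('n::{finite, linorder} rmat, 'e::euclidean_space) manifold \<Rightarrow>
     ('n rmat set, 'f::euclidean_space) manifold \<Rightarrow> bool" where
  "homogeneous_space_structure k G M \<longleftrightarrow>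
     smooth_manifold M \<and> mtop M = quotient_topology (mtop G) (coset k) \<and>
     smooth_submersion G M (coset k)"

definition target_set :: "nat \<Rightarrow> 'n::finite rmat set" where
  "target_set k =
     {Q \<in> orth_group. transpose Q = Q \<and> trace Q = 2 * real k - real CARD('n)}"

text \<open>The single value taken by \<open>V I V\<^sup>T\<close> as \<open>V\<close> ranges over the coset; meaningful only
  when this expression is constant on cosets.\<close>

definition phi1 :: "nat \<Rightarrow> 'n::{finite, linorder} rmat set \<Rightarrow> 'n rmat" where
  "phi1 k C = the_elem ((\<lambda>V. V ** sig_matrix k ** transpose V) ` C)"

definition eigenvector_matrix ::
    "nat \<Rightarrow> 'n::{finite, linorder} rmat \<Rightarrow> 'n rmat \<Rightarrow> bool" where
  "eigenvector_matrix k Q V \<longleftrightarrow>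
     V \<in> orth_group \<and>
     (\<forall>j. Q *v column j V = (if pos j < k then 1 else - 1) *\<^sub>R column j V)"

end

theory Submission
  imports Defs
begin

text \<open>Write \<open>J\<close> for the signature matrix and \<open>F V = V J V\<^sup>T\<close>.  The coset of \<open>V\<close> is exactly the fibre
  of \<open>F\<close> through \<open>V\<close>, because an orthogonal matrix commutes with \<open>J\<close> iff it is block diagonal; and the
  spectral decomposition of a symmetric orthogonal matrix, with the trace counting the
  eigenvalue \<open>1\<close>, shows that \<open>F\<close> maps \<open>O(n)\<close> onto the target set.  As \<open>O(n)\<close> is compact, the induced
  bijection is a homeomorphism.

  An immersion has smooth local left inverses, so every embedded submanifold of a
  Euclidean space has charts that are locally restrictions of smooth maps on the ambient space,
  and smoothness between such submanifolds is smoothness in the ambient sense.  A submersion has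
  smooth local sections, hence the induced map on the quotient is smooth because \<open>F\<close> is.
  Conversely \<open>F\<close> has a smooth local section through every point (by polar
  decomposition), and composing it with the projection gives the inverse map.

  The structures themselves exist: Cayley transforms are charts of \<open>O(n)\<close> and of the target set,
  and the quotient receives the structure of the target set.\<close>

section \<open>Calculus of \<open>C\<^sup>k\<close> maps\<close>

text \<open>The third conjunct ranges over all structures with the stated properties, modelled on
  subspaces of unrelated Euclidean types. No particular chart is available there: smoothness has to
  be drawn from the inclusions being immersions and the projection being a submersion. Coordinate
  domains are open only relative to the model, so derivatives are determined only along it, while
  the inverse function theorem is used on whole Euclidean spaces, at points where the derivative is
  the identity. A conditional claim of this kind would be empty without such structures, hence the
  first conjunct. One tool serves both: local sections of \<open>conj_sig k\<close> with a
  prescribed value at the base point. They give the smooth inverse of \<open>phi1 k\<close>, and as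
  one passes through every orthogonal matrix, they also show that the projection is a submersion for
  the constructed structure.\<close>

lemma Ck_on_cong:
  assumes "open U" "\<And>x. x \<in> U \<Longrightarrow> f x = g x" "Ck_on m f U"
  shows "Ck_on m g U"
  using assms(2,3)
proof (induction m arbitrary: f g)
  case 0
  then show ?case by (simp cong: continuous_on_cong)
next
  case (Suc m)
  have diff: "g differentiable (at x)" "frechet_derivative f (at x) = frechet_derivative g (at x)"
    if "x \<in> U" for x
  proof -
    have f: "f differentiable (at x)" using Suc.prems(2) that by simp
    show "frechet_derivative f (at x) = frechet_derivative g (at x)"
      using frechet_derivative_transform_within_open[OF f assms(1) that] Suc.prems(1) by blast
    show "g differentiable (at x)"
      using f has_derivative_transform_within_open[OF _ assms(1) that] Suc.prems(1)
      unfolding differentiable_def by blast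
  qed
  have "Ck_on m (\<lambda>x. frechet_derivative g (at x) v) U" for v
    by (rule Suc.IH[of "\<lambda>x. frechet_derivative f (at x) v"]) (use Suc.prems(2) diff in auto)
  with diff show ?case by simp
qed

lemma Ck_on_subset: "Ck_on m f U \<Longrightarrow> V \<subseteq> U \<Longrightarrow> Ck_on m f V"
  by (induction m arbitrary: f) (auto intro: continuous_on_subset)

lemma Ck_on_Suc_imp: "Ck_on (Suc m) f U \<Longrightarrow> Ck_on m f U"
proof (induction m arbitrary: f)
  case 0
  then show ?case
    by (auto intro!: continuous_at_imp_continuous_on differentiable_imp_continuous_within)
next
  case (Suc m)
  then show ?case by (metis Ck_on.simps(2))
qed

lemma Ck_on_imp_continuous_on: "Ck_on m f U \<Longrightarrow> continuous_on U f"
  by (induction m) (use Ck_on_Suc_imp in auto)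

text \<open>\<open>frechet_derivative\<close> is a choice and awkward to compute with. This form
  accepts any explicit family of derivatives; the product, chain and inverse rules go through
  it.\<close>

lemma Ck_on_SucI:
  assumes "open U" "\<And>x. x \<in> U \<Longrightarrow> (f has_derivative f' x) (at x)"
    "\<And>v. Ck_on m (\<lambda>x. f' x v) U"
  shows "Ck_on (Suc m) f U"
proof -
  have "Ck_on m (\<lambda>x. frechet_derivative f (at x) v) U" for v
    by (rule Ck_on_cong[OF assms(1) _ assms(3)]) (simp add: frechet_derivative_at[OF assms(2)])
  then show ?thesis
    using assms(2) by (auto simp: differentiable_def)
qed

lemma Ck_on_SucD:
  assumes "Ck_on (Suc m) f U"
  obtains f' where "\<And>x. x \<in> U \<Longrightarrow> (f has_derivative f' x) (at x)"
    "\<And>v. Ck_on m (\<lambda>x. f' x v) U"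
  using assms that[of "\<lambda>x. frechet_derivative f (at x)"]
  by (auto simp: frechet_derivative_works)

lemma Ck_on_const: "open U \<Longrightarrow> Ck_on m (\<lambda>x. c) U"
  by (induction m arbitrary: c) auto

lemma Ck_on_linear:
  assumes "open U" "bounded_linear L"
  shows "Ck_on m L U"
proof (cases m)
  case 0
  then show ?thesis using assms by (simp add: linear_continuous_on)
next
  case (Suc l)
  show ?thesis unfolding Suc
    by (rule Ck_on_SucI[where f'="\<lambda>x. L"])
      (auto simp: assms bounded_linear_imp_has_derivative Ck_on_const)
qed

lemma Ck_on_add:
  assumes "open U" "Ck_on m f U" "Ck_on m g U"
  shows "Ck_on m (\<lambda>x. f x + g x) U"
  using assms(2,3)
proof (induction m arbitrary: f g)
  case 0
  then show ?case by (auto intro: continuous_on_add)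
next
  case (Suc m)
  obtain f' where f': "\<And>x. x \<in> U \<Longrightarrow> (f has_derivative f' x) (at x)" "\<And>v. Ck_on m (\<lambda>x. f' x v) U"
    using Ck_on_SucD[OF Suc.prems(1)] by metis
  obtain g' where g': "\<And>x. x \<in> U \<Longrightarrow> (g has_derivative g' x) (at x)" "\<And>v. Ck_on m (\<lambda>x. g' x v) U"
    using Ck_on_SucD[OF Suc.prems(2)] by metis
  show ?case
    by (rule Ck_on_SucI[OF assms(1), where f'="\<lambda>x v. f' x v + g' x v"])
      (auto intro!: derivative_eq_intros f' g' Suc.IH)
qed

lemma Ck_on_sum:
  assumes "open U" "finite I" "\<And>i. i \<in> I \<Longrightarrow> Ck_on m (f i) U"
  shows "Ck_on m (\<lambda>x. \<Sum>i\<in>I. f i x) U"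
  using assms(2,3) by (induction I rule: finite_induct) (auto intro!: Ck_on_add Ck_on_const assms(1))

text \<open>Product rule at once for scalar multiples, inner products and matrix products: both
  terms of the derivative are again values of \<open>p\<close>, so the induction hypothesis covers
  them.\<close>

lemma Ck_on_bilinear:
  assumes "bounded_bilinear p" "open U" "Ck_on m f U" "Ck_on m g U"
  shows "Ck_on m (\<lambda>x. p (f x) (g x)) U"
  using assms(3,4)
proof (induction m arbitrary: f g)
  case 0
  then show ?case using bounded_bilinear.continuous_on[OF assms(1)] by auto
next
  case (Suc m)
  obtain f' where f': "\<And>x. x \<in> U \<Longrightarrow> (f has_derivative f' x) (at x)" "\<And>v. Ck_on m (\<lambda>x. f' x v) U"
    using Ck_on_SucD[OF Suc.prems(1)] by metis
  obtain g' where g': "\<And>x. x \<in> U \<Longrightarrow> (g has_derivative g' x) (at x)" "\<And>v. Ck_on m (\<lambda>x. g' x v) U"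
    using Ck_on_SucD[OF Suc.prems(2)] by metis
  show ?case
    by (rule Ck_on_SucI[OF assms(2), where f'="\<lambda>x v. p (f x) (g' x v) + p (f' x v) (g x)"])
      (auto intro!: bounded_bilinear.FDERIV[OF assms(1)] f' g' Suc.IH Ck_on_add assms(2)
         Ck_on_Suc_imp[OF Suc.prems(1)] Ck_on_Suc_imp[OF Suc.prems(2)])
qed

text \<open>Reduces an operator that varies with a parameter to its values at finitely many fixed
  basis vectors. This suits \<open>Ck_on\<close>, which only speaks of derivatives in fixed
  directions.\<close>

lemma linear_sum_Basis:
  fixes f :: "'a::euclidean_space \<Rightarrow> 'b::real_vector"
  assumes "linear f"
  shows "f w = (\<Sum>b\<in>Basis. (w \<bullet> b) *\<^sub>R f b)"
proof -
  have "f w = f (\<Sum>b\<in>Basis. (w \<bullet> b) *\<^sub>R b)" by (simp add: euclidean_representation)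
  then show ?thesis by (simp add: linear_sum[OF assms] linear_cmul[OF assms])
qed

lemma Ck_on_compose:
  assumes "open U" "open V" "f ` U \<subseteq> V" "Ck_on m g V" "Ck_on m f U"
  shows "Ck_on m (\<lambda>x. g (f x)) U"
  using assms(4,5)
proof (induction m arbitrary: g)
  case 0
  then show ?case using assms(3) continuous_on_compose2[of V g U f] by auto
next
  case (Suc m)
  obtain f' where f': "\<And>x. x \<in> U \<Longrightarrow> (f has_derivative f' x) (at x)" "\<And>v. Ck_on m (\<lambda>x. f' x v) U"
    using Ck_on_SucD[OF Suc.prems(2)] by metis
  obtain g' where g': "\<And>x. x \<in> V \<Longrightarrow> (g has_derivative g' x) (at x)" "\<And>v. Ck_on m (\<lambda>x. g' x v) V"
    using Ck_on_SucD[OF Suc.prems(1)] by metis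
  \<comment> \<open>In the chain rule both the operator \<open>g' (f x)\<close> and its argument
    \<open>f' x v\<close> move with \<open>x\<close>. The expansion over the basis separates them
    into products.\<close>
  have lin: "g' x w = (\<Sum>b\<in>Basis. (w \<bullet> b) *\<^sub>R g' x b)" if "x \<in> V" for x w
    by (rule linear_sum_Basis) (rule has_derivative_linear[OF g'(1)[OF that]])
  show ?case
  proof (rule Ck_on_SucI[OF assms(1), where f'="\<lambda>x v. \<Sum>b\<in>Basis. (f' x v \<bullet> b) *\<^sub>R g' (f x) b"])
    fix x assume x: "x \<in> U"
    then have fx: "f x \<in> V" using assms(3) by auto
    show "((\<lambda>x. g (f x)) has_derivative (\<lambda>v. \<Sum>b\<in>Basis. (f' x v \<bullet> b) *\<^sub>R g' (f x) b)) (at x)"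
      using has_derivative_compose[OF f'(1)[OF x] g'(1)[OF fx]] by (simp only: lin[OF fx, symmetric])
  next
    fix v
    show "Ck_on m (\<lambda>x. \<Sum>b\<in>Basis. (f' x v \<bullet> b) *\<^sub>R g' (f x) b) U"
    proof (intro Ck_on_sum Ck_on_bilinear[OF bounded_bilinear_scaleR] assms(1))
      fix b :: 'b
      show "Ck_on m (\<lambda>x. f' x v \<bullet> b) U"
        using Ck_on_bilinear[OF bounded_bilinear_inner assms(1) f'(2) Ck_on_const[OF assms(1)]] .
      show "Ck_on m (\<lambda>x. g' (f x) b) U"
        by (rule Suc.IH[OF g'(2)]) (rule Ck_on_Suc_imp[OF Suc.prems(2)])
    qed simp
  qed
qed

section \<open>Linear equations with smoothly varying coefficients\<close>

lemma locally_bounded_below: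
  fixes A :: "'x::euclidean_space \<Rightarrow> 'a::euclidean_space \<Rightarrow> 'b::euclidean_space"
  assumes "open V" "y0 \<in> V" "\<And>y. y \<in> V \<Longrightarrow> linear (A y)" "inj (A y0)"
    "\<And>w. continuous_on V (\<lambda>y. A y w)"
  obtains W c where "open W" "y0 \<in> W" "W \<subseteq> V" "c > 0"
    "\<And>y w. y \<in> W \<Longrightarrow> c * norm w \<le> norm (A y w)"
proof -
  obtain B where B: "B > 0" "\<And>w. B * norm w \<le> norm (A y0 w)"
    using linear_inj_bounded_below_pos[OF assms(3)[OF assms(2)] assms(4)] by blast
  \<comment> \<open>\<open>e y\<close> dominates the operator norm of \<open>A y - A y0\<close>;
    keeping it below \<open>B/2\<close> leaves half of the lower bound \<open>B\<close> of
    \<open>A y0\<close>.\<close>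
  define e where "e = (\<lambda>y. \<Sum>b\<in>Basis. norm (A y b - A y0 b))"
  have cont: "continuous_on V e" unfolding e_def by (intro continuous_intros assms(5))
  define W where "W = V \<inter> e -` {..< B/2}"
  have W: "open W" unfolding W_def
    using continuous_open_preimage[OF cont assms(1)] open_lessThan by blast
  have le: "norm (A y w - A y0 w) \<le> e y * norm w" if "y \<in> V" for y w
  proof -
    have "A y w = (\<Sum>b\<in>Basis. (w \<bullet> b) *\<^sub>R A y b)" if "y \<in> V" for y
      using linear_sum_Basis[OF assms(3)[OF that]] by metis
    then have "A y w - A y0 w = (\<Sum>b\<in>Basis. (w \<bullet> b) *\<^sub>R (A y b - A y0 b))"
      using that assms(2) by (simp add: scaleR_diff_right sum_subtractf)
    also have "norm \<dots> \<le> (\<Sum>b\<in>Basis. norm w * norm (A y b - A y0 b))"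
      by (rule sum_norm_le) (auto intro!: mult_right_mono Basis_le_norm)
    finally show ?thesis by (simp add: e_def sum_distrib_left mult.commute)
  qed
  show ?thesis
  proof (rule that[OF W _ _ half_gt_zero[OF B(1)]])
    show "y0 \<in> W" using B(1) assms(2) by (simp add: W_def e_def)
    show "W \<subseteq> V" by (auto simp: W_def)
    fix y w assume "y \<in> W"
    then have y: "y \<in> V" "e y < B/2" by (auto simp: W_def)
    have "norm (A y w - A y0 w) \<le> B/2 * norm w"
      using le[OF y(1), of w] y(2) by (meson mult_right_mono norm_ge_zero order.strict_implies_order order_trans)
    then show "B/2 * norm w \<le> norm (A y w)"
      using B(2)[of w] norm_triangle_ineq2[of "A y0 w" "A y w"] by (simp add: norm_minus_commute)
  qed
qed

text \<open>The bound \<open>c * norm (G y - G y0) \<le> norm (u y - A y (G y0))\<close> controls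
  the unknown \<open>G y\<close> by an expression in which \<open>G\<close> occurs only at the fixed
  point \<open>y0\<close>.\<close>

lemma continuous_on_linear_solve:
  fixes A :: "'x::euclidean_space \<Rightarrow> 'a::euclidean_space \<Rightarrow> 'b::euclidean_space"
  assumes "open V" "\<And>y. y \<in> V \<Longrightarrow> linear (A y)" "\<And>y. y \<in> V \<Longrightarrow> inj (A y)"
    "\<And>w. continuous_on V (\<lambda>y. A y w)" "continuous_on V u"
    "\<And>y. y \<in> V \<Longrightarrow> A y (G y) = u y"
  shows "continuous_on V G"
proof (rule continuous_at_imp_continuous_on, rule ballI)
  fix y0 assume y0: "y0 \<in> V"
  obtain W c where W: "open W" "y0 \<in> W" "W \<subseteq> V" "c > 0"
    and bd: "\<And>y w. y \<in> W \<Longrightarrow> c * norm w \<le> norm (A y w)"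
    using locally_bounded_below[OF assms(1) y0 assms(2) assms(3)[OF y0] assms(4)] by blast
  let ?r = "\<lambda>y. u y - A y (G y0)"
  have "((\<lambda>y. norm (?r y) / c) \<longlongrightarrow> norm (?r y0) / c) (at y0)"
  proof (intro tendsto_divide tendsto_norm tendsto_diff tendsto_const)
    show "(u \<longlongrightarrow> u y0) (at y0)" "((\<lambda>y. A y (G y0)) \<longlongrightarrow> A y0 (G y0)) (at y0)"
      using assms(4,5) y0 by (simp_all add: continuous_on_def at_within_open[OF y0 assms(1)] flip: at_within_open[OF y0 assms(1)])
  qed (use W(4) in auto)
  then have lim: "((\<lambda>y. norm (?r y) / c) \<longlongrightarrow> 0) (at y0)" using assms(6)[OF y0] by simp
  have "\<forall>\<^sub>F y in at y0. dist (G y) (G y0) \<le> norm (?r y) / c"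
    unfolding eventually_at_topological
  proof (intro exI conjI ballI impI)
    fix y assume y: "y \<in> W"
    then have yV: "y \<in> V" using W by auto
    have "c * norm (G y - G y0) \<le> norm (?r y)"
      using bd[OF y, of "G y - G y0"] assms(6)[OF yV] by (simp add: linear_diff[OF assms(2)[OF yV]])
    then show "dist (G y) (G y0) \<le> norm (?r y) / c" using W(4) by (simp add: dist_norm field_simps)
  qed (use W in auto)
  then have "((\<lambda>y. dist (G y) (G y0)) \<longlongrightarrow> 0) (at y0)"
    by (rule tendsto_sandwich[OF _ _ tendsto_const lim, rotated]) simp
  then show "continuous (at y0) G"
    unfolding continuous_at by (subst tendsto_dist_iff)
qed

text \<open>The last assumption is what formal differentiation of \<open>A y (G y) = u y\<close> at
  \<open>y0\<close> predicts for \<open>G'\<close>. Differentiability of \<open>G\<close> is then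
  proved by bounding the error of this candidate.\<close>

lemma has_derivative_linear_solve:
  fixes A :: "'x::euclidean_space \<Rightarrow> 'a::euclidean_space \<Rightarrow> 'b::euclidean_space"
  assumes "open V" "y0 \<in> V" "\<And>y. y \<in> V \<Longrightarrow> linear (A y)" "\<And>y. y \<in> V \<Longrightarrow> inj (A y)"
    "\<And>w y. y \<in> V \<Longrightarrow> ((\<lambda>y. A y w) has_derivative A' w) (at y0)"
    "\<And>w. continuous_on V (\<lambda>y. A y w)"
    "(u has_derivative u') (at y0)"
    "\<And>y. y \<in> V \<Longrightarrow> A y (G y) = u y"
    "bounded_linear G'" "\<And>h. A y0 (G' h) = u' h - A' (G y0) h"
  shows "(G has_derivative G') (at y0)"
proof -
  obtain W c where W: "open W" "y0 \<in> W" "W \<subseteq> V" "c > 0"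
    and bd: "\<And>y w. y \<in> W \<Longrightarrow> c * norm w \<le> norm (A y w)"
    using locally_bounded_below[OF assms(1,2,3) assms(4)[OF assms(2)] assms(6)] by blast
  \<comment> \<open>On \<open>V\<close>, \<open>?r y\<close> equals \<open>A y\<close> applied to
    the error \<open>G y - G y0 - G' (y - y0)\<close>, but it is written through known functions
    only, so it can be differentiated. The lower bound for \<open>A y\<close> carries the estimate
    over to the error.\<close>
  let ?r = "\<lambda>y. u y - A y (G y0) - A y (G' (y - y0))"
  have "((\<lambda>y. u y - A y (G y0) - (\<Sum>b\<in>Basis. (G' (y - y0) \<bullet> b) *\<^sub>R A y b)) has_derivative
       (\<lambda>h. u' h - A' (G y0) h - (\<Sum>b\<in>Basis. (G' (y0 - y0) \<bullet> b) *\<^sub>R A' b h + (G' (h - 0) \<bullet> b) *\<^sub>R A y0 b))) (at y0)"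
    by (rule derivative_intros assms(5)[OF assms(2)] assms(7) bounded_linear.has_derivative[OF assms(9)])+
  moreover have exp: "(\<Sum>b\<in>Basis. (w \<bullet> b) *\<^sub>R A y b) = A y w" if "y \<in> V" for y w
    using linear_sum_Basis[OF assms(3)[OF that]] by metis
  ultimately have "((\<lambda>y. u y - A y (G y0) - (\<Sum>b\<in>Basis. (G' (y - y0) \<bullet> b) *\<^sub>R A y b)) has_derivative (\<lambda>h. 0)) (at y0)"
    using assms(10) exp[OF assms(2)] by (simp add: linear_0[OF bounded_linear.linear[OF assms(9)]])
  then have rder: "(?r has_derivative (\<lambda>h. 0)) (at y0)"
    by (rule has_derivative_transform_within_open[OF _ assms(1,2)]) (simp add: exp)
  have G'0: "G' 0 = 0" using assms(9) by (simp add: linear_simps)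
  have r0: "?r y0 = 0" using assms(8)[OF assms(2)] linear_0[OF assms(3)[OF assms(2)]] by (simp add: G'0)
  have lim: "((\<lambda>y. norm (?r y) / norm (y - y0) / c) \<longlongrightarrow> 0) (at y0)"
  proof -
    have "((\<lambda>y. (?r y - ?r y0 - 0) /\<^sub>R norm (y - y0)) \<longlongrightarrow> 0) (at y0)"
      using rder unfolding has_derivative_def by simp
    then have "((\<lambda>y. ?r y /\<^sub>R norm (y - y0)) \<longlongrightarrow> 0) (at y0)" unfolding r0 by simp
    then have "((\<lambda>y. norm (?r y /\<^sub>R norm (y - y0)) / c) \<longlongrightarrow> norm (0::'b) / c) (at y0)"
      using W(4) by (intro tendsto_intros) auto
    then show ?thesis by (simp add: divide_inverse mult.commute mult.left_commute)
  qed
  have "\<forall>\<^sub>F y in at y0. norm (G y - G y0 - G' (y - y0)) / norm (y - y0) \<le> norm (?r y) / norm (y - y0) / c"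
    unfolding eventually_at_topological
  proof (intro exI conjI ballI impI)
    fix y assume y: "y \<in> W"
    then have yV: "y \<in> V" using W by auto
    have "c * norm (G y - G y0 - G' (y - y0)) \<le> norm (?r y)"
      using bd[OF y, of "G y - G y0 - G' (y - y0)"] assms(8)[OF yV] by (simp add: linear_diff[OF assms(3)[OF yV]])
    then have "norm (G y - G y0 - G' (y - y0)) \<le> norm (?r y) / c" using W(4) by (simp add: field_simps)
    then show "norm (G y - G y0 - G' (y - y0)) / norm (y - y0) \<le> norm (?r y) / norm (y - y0) / c"
      by (metis divide_divide_eq_left' divide_right_mono mult.commute norm_ge_zero)
  qed (use W in auto)
  then have "((\<lambda>y. norm (G y - G y0 - G' (y - y0)) / norm (y - y0)) \<longlongrightarrow> 0) (at y0)"
    by (rule tendsto_sandwich[OF _ _ tendsto_const lim, rotated]) simp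
  then have "((\<lambda>y. norm ((G y - G y0 - G' (y - y0)) /\<^sub>R norm (y - y0))) \<longlongrightarrow> 0) (at y0)"
    by (simp add: divide_inverse mult.commute)
  then have "((\<lambda>y. (G y - G y0 - G' (y - y0)) /\<^sub>R norm (y - y0)) \<longlongrightarrow> 0) (at y0)"
    by (rule tendsto_norm_zero_cancel)
  then show ?thesis
    unfolding has_derivative_def using assms(9) by simp
qed

text \<open>The derivative of a solution solves an equation with the same operators
  \<open>A y\<close> and a right-hand side built from \<open>u'\<close>, \<open>A'\<close> and
  \<open>G\<close>, so each order of smoothness yields the next. This is behind the smoothness of
  both inverse functions and matrix inversion.\<close>

lemma Ck_on_linear_solve:
  fixes A :: "'x::euclidean_space \<Rightarrow> 'a::euclidean_space \<Rightarrow> 'a"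
  assumes "open V" "\<And>y. y \<in> V \<Longrightarrow> linear (A y)" "\<And>y. y \<in> V \<Longrightarrow> inj (A y)"
    "\<And>w. Ck_on m (\<lambda>y. A y w) V" "Ck_on m u V"
    "\<And>y. y \<in> V \<Longrightarrow> A y (G y) = u y"
  shows "Ck_on m G V"
  using assms(4-6)
proof (induction m arbitrary: G u)
  case 0
  then show ?case using continuous_on_linear_solve[OF assms(1,2,3), where G=G and u=u] by simp
next
  case (Suc m)
  have "\<forall>w. \<exists>A'. (\<forall>y\<in>V. ((\<lambda>y. A y w) has_derivative A' y) (at y)) \<and> (\<forall>v. Ck_on m (\<lambda>y. A' y v) V)"
    using Ck_on_SucD[OF Suc.prems(1)] by metis
  then obtain A' where A': "\<And>w y. y \<in> V \<Longrightarrow> ((\<lambda>y. A y w) has_derivative A' w y) (at y)"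
    "\<And>w v. Ck_on m (\<lambda>y. A' w y v) V" by metis
  obtain u' where u': "\<And>x. x \<in> V \<Longrightarrow> (u has_derivative u' x) (at x)" "\<And>v. Ck_on m (\<lambda>x. u' x v) V"
    using Ck_on_SucD[OF Suc.prems(2)] by metis
  have G: "Ck_on m G V"
    using Suc.IH Ck_on_Suc_imp[OF Suc.prems(1)] Ck_on_Suc_imp[OF Suc.prems(2)] Suc.prems(3) by blast
  define G' where "G' = (\<lambda>y v. inv (A y) (u' y v - A' (G y) y v))"
  have bij: "bij (A y)" if "y \<in> V" for y
    using assms(2,3)[OF that] by (simp add: bij_def linear_injective_imp_surjective)
  have AG': "A y (G' y v) = u' y v - A' (G y) y v" if "y \<in> V" for y v
    using bij[OF that] by (simp add: G'_def bij_inv_eq_iff[symmetric] bij_is_surj surj_f_inv_f)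
  \<comment> \<open>\<open>A' w y v\<close> inherits linearity in \<open>w\<close> from
    \<open>A y w\<close> by uniqueness of derivatives. This is used where \<open>w\<close> is the
    moving vector \<open>G y\<close>.\<close>
  have A'exp: "A' w y v = (\<Sum>b\<in>Basis. (w \<bullet> b) *\<^sub>R A' b y v)" if "y \<in> V" for w y v
  proof -
    have "((\<lambda>y. \<Sum>b\<in>Basis. (w \<bullet> b) *\<^sub>R A y b) has_derivative (\<lambda>v. \<Sum>b\<in>Basis. (w \<bullet> b) *\<^sub>R A' b y v)) (at y)"
      by (intro derivative_intros A' that)
    then have "((\<lambda>y. A y w) has_derivative (\<lambda>v. \<Sum>b\<in>Basis. (w \<bullet> b) *\<^sub>R A' b y v)) (at y)"
      by (rule has_derivative_transform_within_open[OF _ assms(1) that])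
        (rule linear_sum_Basis[OF assms(2), symmetric])
    then show ?thesis by (rule fun_cong[OF has_derivative_unique[OF A'(1)[OF that]]])
  qed
  show ?case
  proof (rule Ck_on_SucI[OF assms(1), where f'=G'])
    fix y assume y: "y \<in> V"
    have lin: "bounded_linear (G' y)"
    proof -
      have "linear (inv (A y))"
        using assms(2,3)[OF y] bij[OF y] by (simp add: bij_def inj_linear_imp_inv_linear)
      moreover have "linear (\<lambda>v. u' y v - A' (G y) y v)"
        using u'(1)[OF y] A'(1)[OF y] by (intro linear_compose_sub has_derivative_linear)
      ultimately have "linear (inv (A y) \<circ> (\<lambda>v. u' y v - A' (G y) y v))"
        by (rule linear_compose[rotated])
      then show ?thesis unfolding G'_def o_def by (simp add: linear_conv_bounded_linear)
    qed
    show "(G has_derivative G' y) (at y)"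
      by (rule has_derivative_linear_solve[OF assms(1) y assms(2,3) A'(1)[OF y]
            Ck_on_imp_continuous_on[OF Suc.prems(1)] u'(1)[OF y] Suc.prems(3) lin AG'[OF y]])
  next
    fix v
    show "Ck_on m (\<lambda>y. G' y v) V"
    proof (rule Suc.IH[where u="\<lambda>y. u' y v + (\<Sum>b\<in>Basis. ((- 1) * (G y \<bullet> b)) *\<^sub>R A' b y v)"])
      show "Ck_on m (\<lambda>y. A y w) V" for w by (rule Ck_on_Suc_imp[OF Suc.prems(1)])
      show "Ck_on m (\<lambda>y. u' y v + (\<Sum>b\<in>Basis. ((- 1) * (G y \<bullet> b)) *\<^sub>R A' b y v)) V"
        by (intro Ck_on_add Ck_on_sum u' A' assms(1) Ck_on_bilinear[OF bounded_bilinear_scaleR]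
            Ck_on_bilinear[OF bounded_bilinear_mult] Ck_on_bilinear[OF bounded_bilinear_inner]
            Ck_on_const G finite_Basis)
      show "A y (G' y v) = u' y v + (\<Sum>b\<in>Basis. ((- 1) * (G y \<bullet> b)) *\<^sub>R A' b y v)" if "y \<in> V" for y
        using AG'[OF that] A'exp[OF that, of "G y" v] by (simp add: sum_negf)
    qed
  qed
qed

section \<open>Smooth maps and the inverse function theorem\<close>

text \<open>Openness is part of the predicate: derivatives are meaningful there, and every closure
  rule also delivers an open domain.\<close>

definition Cinf_on :: "('a::euclidean_space \<Rightarrow> 'b::euclidean_space) \<Rightarrow> 'a set \<Rightarrow> bool" where
  "Cinf_on f U \<longleftrightarrow> open U \<and> (\<forall>m. Ck_on m f U)"

lemma Cinf_onD: "Cinf_on f U \<Longrightarrow> open U" "Cinf_on f U \<Longrightarrow> Ck_on m f U"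
  by (auto simp: Cinf_on_def)

lemma Cinf_on_continuous: "Cinf_on f U \<Longrightarrow> continuous_on U f"
  using Cinf_onD(2)[of f U 0] by simp

lemma Cinf_on_derivative:
  assumes "Cinf_on f U" "x \<in> U"
  shows "(f has_derivative frechet_derivative f (at x)) (at x)"
  using Cinf_onD(2)[OF assms(1), of 1] assms(2) by (auto simp: frechet_derivative_works)

lemma Cinf_on_subset: "Cinf_on f U \<Longrightarrow> V \<subseteq> U \<Longrightarrow> open V \<Longrightarrow> Cinf_on f V"
  by (auto simp: Cinf_on_def intro: Ck_on_subset)

lemma Cinf_on_const: "open U \<Longrightarrow> Cinf_on (\<lambda>x. c) U"
  by (simp add: Cinf_on_def Ck_on_const)

lemma Cinf_on_linear: "open U \<Longrightarrow> linear L \<Longrightarrow> Cinf_on L U"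
  by (simp add: Cinf_on_def Ck_on_linear linear_conv_bounded_linear)

lemma Cinf_on_ident: "open U \<Longrightarrow> Cinf_on (\<lambda>x. x) U"
  by (intro Cinf_on_linear linear_ident)

lemma Cinf_on_add: "Cinf_on f U \<Longrightarrow> Cinf_on g U \<Longrightarrow> Cinf_on (\<lambda>x. f x + g x) U"
  by (simp add: Cinf_on_def Ck_on_add)

lemma Cinf_on_bilinear:
  "bounded_bilinear p \<Longrightarrow> Cinf_on f U \<Longrightarrow> Cinf_on g U \<Longrightarrow> Cinf_on (\<lambda>x. p (f x) (g x)) U"
  by (simp add: Cinf_on_def Ck_on_bilinear)

lemma Cinf_on_compose:
  assumes "Cinf_on g V" "Cinf_on f U"
  shows "Cinf_on (\<lambda>x. g (f x)) (U \<inter> f -` V)"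
proof -
  have op: "open (U \<inter> f -` V)"
    by (rule continuous_open_preimage[OF Cinf_on_continuous[OF assms(2)] Cinf_onD(1)[OF assms(2)] Cinf_onD(1)[OF assms(1)]])
  have "Ck_on m (\<lambda>x. g (f x)) (U \<inter> f -` V)" for m
    by (rule Ck_on_compose[OF op Cinf_onD(1)[OF assms(1)] _ Cinf_onD(2)[OF assms(1)]
          Ck_on_subset[OF Cinf_onD(2)[OF assms(2)]]]) auto
  then show ?thesis using op by (simp add: Cinf_on_def)
qed

lemma Cinf_on_compose_linear:
  assumes "linear L" "Cinf_on f U"
  shows "Cinf_on (\<lambda>x. L (f x)) U"
  using Cinf_on_compose[OF Cinf_on_linear[OF open_UNIV assms(1)] assms(2)] by simp

lemma Cinf_on_diff: "Cinf_on f U \<Longrightarrow> Cinf_on g U \<Longrightarrow> Cinf_on (\<lambda>x. f x - g x) U"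
  using Cinf_on_add[of f U "\<lambda>x. - g x"] Cinf_on_compose_linear[of uminus g U]
  by (simp add: module_hom_uminus linear_uminus)

text \<open>The classical theorem gives a differentiable inverse \<open>g\<close> with
  \<open>D (g y) (g' y v) = v\<close>. If \<open>g\<close> is \<open>C^m\<close>, this is a linear
  equation with \<open>C^m\<close> coefficients, so \<open>g'\<close> is \<open>C^m\<close> and
  \<open>g\<close> gains one order. Callers arrange by a linear correction that the derivative is
  the identity.\<close>

theorem smooth_inverse_function:
  fixes f :: "'a::euclidean_space \<Rightarrow> 'a"
  assumes f: "Cinf_on f U" and x: "x \<in> U" and deriv: "(f has_derivative (\<lambda>h. h)) (at x)"
  obtains U' V g where "open U'" "U' \<subseteq> U" "x \<in> U'" "f x \<in> V" "homeomorphism U' V f g" "Cinf_on g V"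
proof -
  define D where "D = (\<lambda>y. frechet_derivative f (at y))"
  have D: "(f has_derivative D y) (at y)" if "y \<in> U" for y
    using Cinf_on_derivative[OF f that] by (simp add: D_def)
  have DCk: "Ck_on m (\<lambda>y. D y v) U" for m v
    using Cinf_onD(2)[OF f, of "Suc m"] by (simp add: D_def)
  have bl: "bounded_linear (D y)" if "y \<in> U" for y using D[OF that] by (rule has_derivative_bounded_linear)
  have app: "blinfun_apply (Blinfun (D y)) = D y" if "y \<in> U" for y
    by (rule bounded_linear_Blinfun_apply[OF bl[OF that]])
  have 1: "continuous_on U (\<lambda>y. Blinfun (D y))"
  proof (rule continuous_on_blinfun_componentwise)
    fix i :: 'a assume "i \<in> Basis"
    show "continuous_on U (\<lambda>y. blinfun_apply (Blinfun (D y)) i)"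
      using Ck_on_imp_continuous_on[OF DCk[of 0 i]] by (simp add: app cong: continuous_on_cong)
  qed
  have "D x = (\<lambda>h. h)" using has_derivative_unique[OF D[OF x] deriv] .
  then have "Blinfun (D x) = id_blinfun" by (simp add: id_blinfun.abs_eq)
  then have 2: "id_blinfun o\<^sub>L Blinfun (D x) = id_blinfun"
    by (auto intro: blinfun_eqI)
  obtain U' V g g' where g: "open U'" "U' \<subseteq> U" "x \<in> U'" "open V" "f x \<in> V" "homeomorphism U' V f g"
    "\<And>y. y \<in> V \<Longrightarrow> (g has_derivative (g' y)) (at y)"
    "\<And>y. y \<in> V \<Longrightarrow> g' y = inv (blinfun_apply (Blinfun (D (g y))))"
    "\<And>y. y \<in> V \<Longrightarrow> bij (blinfun_apply (Blinfun (D (g y))))"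
    using inverse_function_theorem[OF Cinf_onD(1)[OF f] _ 1 x 2] D app by metis
  have gU: "g y \<in> U" if "y \<in> V" for y using g(2,6) that by (auto simp: homeomorphism_def)
  have "Ck_on m g V" for m
  proof (induction m)
    case 0
    then show ?case using g(6) by (simp add: homeomorphism_def)
  next
    case (Suc m)
    show ?case
    proof (rule Ck_on_SucI[OF g(4) g(7)])
      fix v
      show "Ck_on m (\<lambda>y. g' y v) V"
      proof (rule Ck_on_linear_solve[where A="\<lambda>y. D (g y)" and u="\<lambda>y. v"])
        show "Ck_on m (\<lambda>y. D (g y) w) V" for w
          by (rule Ck_on_compose[OF g(4) Cinf_onD(1)[OF f] _ DCk Suc]) (use gU in auto)
        show "linear (D (g y))" if "y \<in> V" for y
          using bl[OF gU[OF that]] by (rule bounded_linear.linear)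
        show "inj (D (g y))" "D (g y) (g' y v) = v" if "y \<in> V" for y
          using g(8,9)[OF that] app[OF gU[OF that]] by (auto simp: bij_def surj_f_inv_f)
      qed (use g(4) Ck_on_const in auto)
    qed
  qed
  then show ?thesis using that g by (simp add: Cinf_on_def)
qed

text \<open>If \<open>L\<close> is a linear left inverse of \<open>D\<close> on \<open>E\<close>, then \<open>y + (L (g y) - L (D y))\<close> has derivative
  \<open>1\<close> at \<open>x\<close> and agrees with \<open>L (g y)\<close> on \<open>E\<close>.  This avoids restricting the inverse
  function theorem to the subspace \<open>E\<close>.\<close>

theorem immersion_local_left_inverse:
  fixes g :: "'a::euclidean_space \<Rightarrow> 'b::euclidean_space"
  assumes E: "subspace E" and g: "Cinf_on g U" and x: "x \<in> U" "x \<in> E"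
    and D: "(g has_derivative D) (at x)" and inj: "inj_on D E"
  obtains N W h where "open N" "x \<in> N" "Cinf_on h W" "g x \<in> W"
    "\<And>y. y \<in> N \<inter> E \<Longrightarrow> h (g y) = y"
proof -
  have linD: "linear D" using D by (rule has_derivative_linear)
  obtain L where L: "linear L" "\<And>v. v \<in> E \<Longrightarrow> L (D v) = v"
    using linear_exists_left_inverse_on[OF linD E inj] by blast
  define f where "f = (\<lambda>y. y + (L (g y) - L (D y)))"
  have f: "Cinf_on f U"
    unfolding f_def using Cinf_onD(1)[OF g]
    by (intro Cinf_on_add Cinf_on_diff Cinf_on_ident Cinf_on_compose_linear[OF L(1)] g
        Cinf_on_linear[OF _ linD])
  have bl: "bounded_linear L" "bounded_linear D" using L(1) linD linear_conv_bounded_linear by auto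
  have "(f has_derivative (\<lambda>h. h + (L (D h) - L (D h)))) (at x)"
    unfolding f_def
    by (intro derivative_intros bounded_linear.has_derivative[OF bl(1)] D
        bounded_linear.has_derivative[OF bl(2)])
  then have f': "(f has_derivative (\<lambda>h. h)) (at x)" by simp
  have fE: "f y = L (g y)" if "y \<in> E" for y using L(2)[OF that] by (simp add: f_def)
  obtain U' V r where r: "open U'" "U' \<subseteq> U" "x \<in> U'" "f x \<in> V" "homeomorphism U' V f r" "Cinf_on r V"
    using smooth_inverse_function[OF f x(1) f'] by blast
  have h: "Cinf_on (\<lambda>z. r (L z)) (L -` V)"
    using Cinf_on_compose[OF r(6) Cinf_on_linear[OF open_UNIV L(1)]] by simp
  show ?thesis
  proof (rule that[OF r(1,3) h])
    show "g x \<in> L -` V" using r(4) fE[OF x(2)] by simp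
    show "r (L (g y)) = y" if "y \<in> U' \<inter> E" for y
      using that fE[of y] homeomorphism_apply1[OF r(5), of y] by simp
  qed
qed

text \<open>With \<open>R\<close> a linear right inverse of \<open>D\<close> and \<open>P\<close> a projection onto \<open>E'\<close>, the map
  \<open>w - P w + g (x + R (P w))\<close> has derivative \<open>1\<close> at \<open>0\<close>; if its value lies in \<open>E'\<close>,
  then so does \<open>w\<close>.\<close>

theorem submersion_local_section:
  fixes g :: "'a::euclidean_space \<Rightarrow> 'b::euclidean_space"
  assumes E: "subspace E" and E': "subspace E'" and g: "Cinf_on g U" and x: "x \<in> U" "x \<in> E"
    and D: "(g has_derivative D) (at x)" and surj: "E' \<subseteq> D ` E"
    and gE': "\<And>y. y \<in> U \<inter> E \<Longrightarrow> g y \<in> E'"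
  obtains W s where "Cinf_on s W" "g x \<in> W" "s (g x) = x"
    "\<And>w. w \<in> W \<inter> E' \<Longrightarrow> s w \<in> U \<inter> E \<and> g (s w) = w"
proof -
  have linD: "linear D" using D by (rule has_derivative_linear)
  obtain R where R: "linear R" "range R \<subseteq> E" "\<And>v. v \<in> D ` E \<Longrightarrow> D (R v) = v"
    using linear_exists_right_inverse_on[OF linD E] by blast
  obtain P where P: "linear P" "range P \<subseteq> E'" "\<And>v. v \<in> E' \<Longrightarrow> P v = v"
    using linear_exists_left_inverse_on[OF linear_ident E'] by auto
  define q where "q = (\<lambda>w. x + R (P w))"
  define f where "f = (\<lambda>w. (w - P w) + g (q w))"
  have q: "Cinf_on q V" if "open V" for V
    unfolding q_def using that
    by (intro Cinf_on_add Cinf_on_const Cinf_on_compose_linear[OF R(1)] Cinf_on_linear[OF _ P(1)])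
  have P0: "P 0 = 0" "R 0 = 0" using P(1) R(1) by (simp_all add: linear_0)
  have q0: "q 0 = x" by (simp add: q_def P0)
  have qE: "q w \<in> E" for w unfolding q_def using x(2) R(2) E by (auto intro: subspace_add)
  have op: "open (q -` U)"
    using Cinf_onD(1)[OF Cinf_on_compose[OF g q[OF open_UNIV]]] by simp
  have f: "Cinf_on f (q -` U)"
    unfolding f_def using Cinf_on_compose[OF g q[OF open_UNIV]] op
    by (intro Cinf_on_add Cinf_on_diff Cinf_on_ident Cinf_on_linear[OF _ P(1)]) auto
  have bl: "bounded_linear P" "bounded_linear R" using P(1) R(1) linear_conv_bounded_linear by auto
  have q': "(q has_derivative (\<lambda>h. R (P h))) (at 0)"
    unfolding q_def by (auto intro!: derivative_eq_intros bounded_linear.has_derivative[OF bl(1)]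
        bounded_linear.has_derivative[OF bl(2)])
  have "((\<lambda>w. g (q w)) has_derivative (\<lambda>h. D (R (P h)))) (at 0)"
    by (rule has_derivative_compose[OF q']) (simp add: q0 D)
  then have "(f has_derivative (\<lambda>h. (h - P h) + D (R (P h)))) (at 0)"
    unfolding f_def by (intro derivative_intros bounded_linear.has_derivative[OF bl(1)])
  moreover have "D (R (P h)) = P h" for h using R(3) surj P(2) by blast
  ultimately have f': "(f has_derivative (\<lambda>h. h)) (at 0)" by simp
  obtain U' V r where r: "open U'" "U' \<subseteq> q -` U" "0 \<in> U'" "f 0 \<in> V" "homeomorphism U' V f r" "Cinf_on r V"
    using smooth_inverse_function[OF f _ f'] x(1) q0 by auto
  have f0: "f 0 = g x" by (simp add: f_def q0 P0)
  have s: "Cinf_on (\<lambda>w. q (r w)) V" using Cinf_on_compose[OF q[OF open_UNIV] r(6)] by simp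
  show ?thesis
  proof (rule that[OF s])
    show "g x \<in> V" using r(4) f0 by simp
    show "q (r (g x)) = x" using homeomorphism_apply1[OF r(5,3)] by (simp add: f0 q0)
    fix w assume w: "w \<in> V \<inter> E'"
    define u where "u = r w"
    have u: "u \<in> U'" "f u = w" using w homeomorphism_apply2[OF r(5)] homeomorphism_image2[OF r(5)]
      by (auto simp: u_def)
    then have qu: "q u \<in> U \<inter> E" using r(2) qE by auto
    have "u = P u + (w - g (q u))" using u(2) by (auto simp: f_def algebra_simps)
    moreover have "P u + (w - g (q u)) \<in> E'"
      using gE'[OF qu] w P(2) by (intro subspace_add[OF E'] subspace_diff[OF E']) auto
    ultimately have "u \<in> E'" by simp
    then have "g (q u) = w" using u(2) P(3)[of u] by (simp add: f_def)
    then show "q (r w) \<in> U \<inter> E \<and> g (q (r w)) = w" using qu by (simp add: u_def)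
  qed
qed

section \<open>Smoothness and derivatives on subsets\<close>

lemma smooth_on_iff_Cinf:
  "smooth_on W f \<longleftrightarrow> (\<forall>x\<in>W. \<exists>U g. Cinf_on g U \<and> x \<in> U \<and> (\<forall>y\<in>U \<inter> W. g y = f y))"
  unfolding smooth_on_def Cinf_on_def by (metis (no_types, lifting))

lemma smooth_onE:
  assumes "smooth_on W f" "x \<in> W"
  obtains U g where "Cinf_on g U" "x \<in> U" "\<And>y. y \<in> U \<inter> W \<Longrightarrow> g y = f y"
  using assms unfolding smooth_on_iff_Cinf by metis

lemma smooth_onI_local:
  assumes "\<And>x. x \<in> W \<Longrightarrow> \<exists>U. open U \<and> x \<in> U \<and> smooth_on (U \<inter> W) f"
  shows "smooth_on W f"
  unfolding smooth_on_iff_Cinf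
proof
  fix x assume x: "x \<in> W"
  obtain U where U: "open U" "x \<in> U" "smooth_on (U \<inter> W) f" using assms[OF x] by auto
  obtain V g where "Cinf_on g V" "x \<in> V" "\<And>y. y \<in> V \<inter> (U \<inter> W) \<Longrightarrow> g y = f y"
    using smooth_onE[OF U(3), of x] U(2) x by (metis IntI)
  then show "\<exists>U g. Cinf_on g U \<and> x \<in> U \<and> (\<forall>y\<in>U \<inter> W. g y = f y)"
    using U(1,2) by (intro exI[of _ "V \<inter> U"] exI[of _ g]) (auto intro: Cinf_on_subset Cinf_onD(1))
qed

lemma smooth_on_subset: "smooth_on W f \<Longrightarrow> V \<subseteq> W \<Longrightarrow> smooth_on V f"
  unfolding smooth_on_iff_Cinf by blast

lemma smooth_on_cong: "smooth_on W f \<Longrightarrow> (\<And>x. x \<in> W \<Longrightarrow> f x = g x) \<Longrightarrow> smooth_on W g"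
  unfolding smooth_on_iff_Cinf by (auto; fastforce)

lemma Cinf_imp_smooth_on: "Cinf_on f U \<Longrightarrow> W \<subseteq> U \<Longrightarrow> smooth_on W f"
  unfolding smooth_on_iff_Cinf by blast

lemma smooth_on_compose:
  assumes "smooth_on W' g" "smooth_on W f" "f ` W \<subseteq> W'"
  shows "smooth_on W (g \<circ> f)"
  unfolding smooth_on_iff_Cinf
proof
  fix x assume x: "x \<in> W"
  obtain U F where F: "Cinf_on F U" "x \<in> U" "\<And>y. y \<in> U \<inter> W \<Longrightarrow> F y = f y"
    using smooth_onE[OF assms(2) x] by metis
  obtain V G where G: "Cinf_on G V" "f x \<in> V" "\<And>y. y \<in> V \<inter> W' \<Longrightarrow> G y = g y"
    using smooth_onE[OF assms(1), of "f x"] assms(3) x by (metis image_subset_iff)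
  show "\<exists>U h. Cinf_on h U \<and> x \<in> U \<and> (\<forall>y\<in>U \<inter> W. h y = (g \<circ> f) y)"
    using Cinf_on_compose[OF G(1) F(1)] F G x assms(3)
    by (intro exI[of _ "U \<inter> F -` V"] exI[of _ "\<lambda>y. G (F y)"]) auto
qed

lemma smooth_on_continuous:
  assumes "smooth_on W f"
  shows "continuous_on W f"
  unfolding continuous_on_eq_continuous_within
proof
  fix x assume x: "x \<in> W"
  obtain U F where F: "Cinf_on F U" "x \<in> U" "\<And>y. y \<in> U \<inter> W \<Longrightarrow> F y = f y"
    using smooth_onE[OF assms x] by metis
  have "continuous (at x) F"
    using Cinf_on_continuous[OF F(1)] F(2) Cinf_onD(1)[OF F(1)] by (simp add: continuous_on_eq_continuous_at)
  then have "(F \<longlongrightarrow> F x) (at x within W)"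
    by (simp add: continuous_at tendsto_within_subset[of _ _ x UNIV])
  moreover have "\<forall>\<^sub>F y in at x within W. F y = f y"
    unfolding eventually_at_topological using F(2,3) Cinf_onD(1)[OF F(1)] by (intro exI[of _ U]) auto
  ultimately show "continuous (at x within W) f"
    unfolding continuous_within using F(2,3) x tendsto_cong by (metis IntI)
qed

lemma smooth_on_derivative:
  assumes "smooth_on W f" "x \<in> W"
  obtains U g D where "Cinf_on g U" "x \<in> U" "\<And>y. y \<in> U \<inter> W \<Longrightarrow> g y = f y"
    "(g has_derivative D) (at x)" "(f has_derivative D) (at x within W)"
proof -
  obtain U F where F: "Cinf_on F U" "x \<in> U" "\<And>y. y \<in> U \<inter> W \<Longrightarrow> F y = f y"
    using smooth_onE[OF assms] by metis
  have d: "(F has_derivative frechet_derivative F (at x)) (at x)"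
    by (rule Cinf_on_derivative[OF F(1,2)])
  obtain e where e: "e > 0" "ball x e \<subseteq> U" using Cinf_onD(1)[OF F(1)] F(2) openE by blast
  have "(f has_derivative frechet_derivative F (at x)) (at x within W)"
    by (rule has_derivative_transform_within[OF has_derivative_at_withinI[OF d] e(1) assms(2)])
      (use F(3) e(2) in \<open>auto simp: dist_commute subset_iff\<close>)
  then show ?thesis using that F d by blast
qed

text \<open>For \<open>v \<in> E\<close> the point \<open>x + t *\<^sub>R v\<close> stays in
  \<open>W\<close> for all small \<open>t\<close> of either sign, because \<open>W\<close> is
  relatively open. So \<open>D v\<close> is a genuine directional limit, although \<open>D\<close>
  may be arbitrary off \<open>E\<close>.\<close>

lemma has_derivative_within_subspace_limit:
  fixes f :: "'a::euclidean_space \<Rightarrow> 'b::euclidean_space"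
  assumes "(f has_derivative D) (at x within W)" "openin (top_of_set E) W" "subspace E" "x \<in> W" "v \<in> E"
  shows "((\<lambda>t. (f (x + t *\<^sub>R v) - f x) /\<^sub>R t) \<longlongrightarrow> D v) (at 0)"
    and "\<forall>\<^sub>F t in at 0. x + t *\<^sub>R v \<in> W"
proof -
  obtain Z where Z: "open Z" "W = E \<inter> Z" using assms(2) by (auto simp: openin_open)
  define c where "c = (\<lambda>t::real. x + t *\<^sub>R v)"
  have c: "(c has_derivative (\<lambda>t. t *\<^sub>R v)) (at t)" for t
    unfolding c_def by (auto intro!: derivative_eq_intros)
  have "continuous_on UNIV c" unfolding c_def by (intro continuous_intros)
  then have S: "open (c -` Z)" using Z(1) by (simp add: open_vimage)
  have cE: "c t \<in> E" for t unfolding c_def using assms(3-5) Z(2) by (auto intro: subspace_add subspace_scale)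
  have S0: "0 \<in> c -` Z" using assms(4) Z(2) by (simp add: c_def)
  have c0: "c 0 = x" by (simp add: c_def)
  show "\<forall>\<^sub>F t in at 0. x + t *\<^sub>R v \<in> W"
    unfolding eventually_at_topological using S S0 cE Z(2) by (intro exI[of _ "c -` Z"]) (auto simp: c_def)
  have "((\<lambda>t. f (c t)) has_derivative (\<lambda>t. D (t *\<^sub>R v))) (at 0 within c -` Z)"
    by (rule has_derivative_in_compose[OF has_derivative_at_withinI[OF c]])
      (use c0 cE Z(2) in \<open>auto intro: has_derivative_subset[OF assms(1), folded c0]\<close>)
  then have "((\<lambda>t. f (c t)) has_derivative (\<lambda>t. D (t *\<^sub>R v))) (at 0)"
    by (simp only: at_within_open[OF S0 S])
  then have "((\<lambda>t. norm (f (c t) - f (c 0) - D ((t - 0) *\<^sub>R v)) / norm (t - 0)) \<longlongrightarrow> 0) (at 0)"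
    unfolding has_derivative_iff_norm by blast
  then have lim: "((\<lambda>t. norm (f (c t) - f x - t *\<^sub>R D v) / \<bar>t\<bar>) \<longlongrightarrow> 0) (at 0)"
    by (simp add: c0 linear_cmul[OF has_derivative_linear[OF assms(1)]])
  have "norm (f (c t) - f x - t *\<^sub>R D v) / \<bar>t\<bar> = norm ((f (c t) - f x) /\<^sub>R t - D v)" if "t \<noteq> 0" for t
  proof -
    have "(f (c t) - f x) /\<^sub>R t - D v = (f (c t) - f x - t *\<^sub>R D v) /\<^sub>R t"
      using that by (simp add: scaleR_diff_right)
    then show ?thesis by (simp add: divide_inverse mult.commute)
  qed
  then have "((\<lambda>t. norm ((f (c t) - f x) /\<^sub>R t - D v)) \<longlongrightarrow> 0) (at 0)"
    by (intro Lim_transform_eventually[OF lim]) (auto simp: eventually_at_filter)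
  then have "((\<lambda>t. (f (c t) - f x) /\<^sub>R t - D v) \<longlongrightarrow> 0) (at 0)" by (rule tendsto_norm_zero_cancel)
  then show "((\<lambda>t. (f (x + t *\<^sub>R v) - f x) /\<^sub>R t) \<longlongrightarrow> D v) (at 0)"
    unfolding c_def by (rule LIM_zero_cancel)
qed

lemma has_derivative_within_subspace_unique:
  fixes f :: "'a::euclidean_space \<Rightarrow> 'b::euclidean_space"
  assumes "(f has_derivative D) (at x within W)" "(f has_derivative D') (at x within W)"
    "openin (top_of_set E) W" "subspace E" "x \<in> W" "v \<in> E"
  shows "D v = D' v"
  using tendsto_unique[OF _ has_derivative_within_subspace_limit(1)[OF assms(1,3-6)]
      has_derivative_within_subspace_limit(1)[OF assms(2-6)]] by simp

text \<open>All difference quotients along \<open>v\<close> lie in \<open>E'\<close>, and a subspace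
  of a Euclidean space is closed.\<close>

lemma has_derivative_within_subspace_range:
  fixes f :: "'a::euclidean_space \<Rightarrow> 'b::euclidean_space"
  assumes "(f has_derivative D) (at x within W)" "openin (top_of_set E) W" "subspace E" "x \<in> W" "v \<in> E"
    "subspace E'" "f ` W \<subseteq> E'"
  shows "D v \<in> E'"
proof (rule Lim_in_closed_set[OF closed_subspace[OF assms(6)] _ _ has_derivative_within_subspace_limit(1)[OF assms(1-5)]])
  show "\<forall>\<^sub>F t in at 0. (f (x + t *\<^sub>R v) - f x) /\<^sub>R t \<in> E'"
    using has_derivative_within_subspace_limit(2)[OF assms(1-5)]
    by eventually_elim (use assms in \<open>auto intro!: subspace_scale subspace_diff\<close>)
qed simp

text \<open>Chain rule plus uniqueness along \<open>E\<close>. A smooth left inverse thus makes a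
  differential injective, and with the roles exchanged it makes a differential onto.\<close>

lemma has_derivative_left_inverse:
  fixes f :: "'a::euclidean_space \<Rightarrow> 'b::euclidean_space"
  assumes "(f has_derivative D) (at x within W)" "(h has_derivative K) (at (f x) within W')"
    "f ` W \<subseteq> W'" "\<And>y. y \<in> W \<Longrightarrow> h (f y) = y"
    "openin (top_of_set E) W" "subspace E" "x \<in> W" "v \<in> E"
  shows "K (D v) = v"
proof -
  have 1: "((\<lambda>y. h (f y)) has_derivative (\<lambda>v. K (D v))) (at x within W)"
    using has_derivative_in_compose[OF assms(1) has_derivative_subset[OF assms(2,3)]] .
  have "((\<lambda>y. y) has_derivative (\<lambda>v. K (D v))) (at x within W)"
    by (rule has_derivative_transform[OF assms(7) _ 1]) (simp add: assms(4))
  then show ?thesis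
    using has_derivative_within_subspace_unique[OF _ has_derivative_ident assms(5-8)] by blast
qed

section \<open>Submanifolds of Euclidean space\<close>

text \<open>Charts and their inverses are smooth here as maps on subsets of the ambient space, so
  \<open>smooth_on\<close> suffices for smoothness between two such manifolds. Every embedded
  submanifold structure turns out to be of this kind, which is how the arbitrary \<open>G\<close>
  and \<open>T\<close> become accessible.\<close>

definition submanifold_of_euclidean ::
    "'a::euclidean_space set \<Rightarrow> ('a, 'e::euclidean_space) manifold \<Rightarrow> bool" where
  "submanifold_of_euclidean S M \<longleftrightarrow>
     mtop M = top_of_set S \<and> subspace (model M) \<and> (\<Union>c\<in>atlas M. fst c) = S \<and>
     (\<forall>c\<in>atlas M. openin (top_of_set S) (fst c) \<and> openin (top_of_set (model M)) (snd c ` fst c) \<and>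
        inj_on (snd c) (fst c) \<and> smooth_on (fst c) (snd c) \<and>
        smooth_on (snd c ` fst c) (inv_into (fst c) (snd c)))"

lemma submanifold_of_euclideanD:
  assumes "submanifold_of_euclidean S M"
  shows "mtop M = top_of_set S" "subspace (model M)" "(\<Union>c\<in>atlas M. fst c) = S"
    "\<And>c. c \<in> atlas M \<Longrightarrow> openin (top_of_set S) (fst c)"
    "\<And>c. c \<in> atlas M \<Longrightarrow> openin (top_of_set (model M)) (snd c ` fst c)"
    "\<And>c. c \<in> atlas M \<Longrightarrow> inj_on (snd c) (fst c)"
    "\<And>c. c \<in> atlas M \<Longrightarrow> smooth_on (fst c) (snd c)"
    "\<And>c. c \<in> atlas M \<Longrightarrow> smooth_on (snd c ` fst c) (inv_into (fst c) (snd c))"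
    "\<And>c. c \<in> atlas M \<Longrightarrow> fst c \<subseteq> S"
  using assms unfolding submanifold_of_euclidean_def by blast+

lemma chart_inj_on: "is_chart X E c \<Longrightarrow> inj_on (snd c) (fst c)"
  using homeomorphic_imp_injective_map openin_subset[of X "fst c"]
  unfolding is_chart_def by (fastforce simp: inf_absorb2)

lemma openin_coord_dom:
  assumes c: "is_chart X E c" and d: "openin Y (fst d)" and f: "continuous_map X Y f"
  shows "openin (top_of_set E) (coord_dom c d f)"
proof -
  have sub: "fst c \<subseteq> topspace X" using c by (auto simp: is_chart_def openin_subset)
  have "openin X {p \<in> topspace X. f p \<in> fst d}"
    by (rule openin_continuous_map_preimage[OF f d])
  then have "openin (subtopology X (fst c)) ({p \<in> topspace X. f p \<in> fst d} \<inter> fst c)"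
    by (rule openin_subtopology_Int)
  moreover have "open_map (subtopology X (fst c)) (top_of_set (snd c ` fst c)) (snd c)"
    using c by (auto simp: is_chart_def homeomorphic_imp_open_map)
  ultimately have "openin (top_of_set (snd c ` fst c)) (snd c ` ({p \<in> topspace X. f p \<in> fst d} \<inter> fst c))"
    by (auto simp: open_map_def)
  moreover have "{p \<in> topspace X. f p \<in> fst d} \<inter> fst c = {p \<in> fst c. f p \<in> fst d}" using sub by auto
  ultimately have "openin (top_of_set (snd c ` fst c)) (coord_dom c d f)" by (simp add: coord_dom_def)
  then show ?thesis using c openin_trans by (auto simp: is_chart_def)
qed

lemma is_chart_submanifold:
  assumes M: "submanifold_of_euclidean S M" and c: "c \<in> atlas M"
  shows "is_chart (mtop M) (model M) c"
proof -
  note D = submanifold_of_euclideanD[OF M]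
  have "homeomorphic_maps (top_of_set (fst c)) (top_of_set (snd c ` fst c)) (snd c) (inv_into (fst c) (snd c))"
    unfolding homeomorphic_maps_def
    using smooth_on_continuous[OF D(7)[OF c]] smooth_on_continuous[OF D(8)[OF c]] D(6)[OF c]
    by (auto simp: f_inv_into_f inv_into_into)
  then show ?thesis
    unfolding is_chart_def using D(1) D(4,5,9)[OF c]
    by (auto simp: subtopology_subtopology inf_absorb2 homeomorphic_maps_imp_map)
qed

lemma smooth_map_submanifold:
  assumes M: "submanifold_of_euclidean S M" and N: "submanifold_of_euclidean S' N"
    and f: "smooth_on S f" "f ` S \<subseteq> S'"
  shows "smooth_map M N f"
  unfolding smooth_map_def
proof (intro conjI ballI)
  note D = submanifold_of_euclideanD[OF M] and D' = submanifold_of_euclideanD[OF N]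
  show "continuous_map (mtop M) (mtop N) f"
    using smooth_on_continuous[OF f(1)] f(2) by (simp add: D(1) D'(1) image_subset_iff_funcset)
  fix c d assume c: "c \<in> atlas M" and d: "d \<in> atlas N"
  have inv: "smooth_on (coord_dom c d f) (inv_into (fst c) (snd c))"
    by (rule smooth_on_subset[OF D(8)[OF c]]) (auto simp: coord_dom_def)
  have *: "inv_into (fst c) (snd c) ` coord_dom c d f \<subseteq> {p \<in> fst c. f p \<in> fst d}"
    using D(6)[OF c] by (auto simp: coord_dom_def)
  have "smooth_on {p \<in> fst c. f p \<in> fst d} f" by (rule smooth_on_subset[OF f(1)]) (use D(9)[OF c] in auto)
  then have "smooth_on {p \<in> fst c. f p \<in> fst d} (snd d \<circ> f)"
    by (rule smooth_on_compose[OF D'(7)[OF d]]) auto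
  then have "smooth_on (coord_dom c d f) ((snd d \<circ> f) \<circ> inv_into (fst c) (snd c))"
    by (rule smooth_on_compose[OF _ inv *])
  then show "smooth_on (coord_dom c d f) (coord_rep c d f)" by (simp add: coord_rep_def)
qed

lemma smooth_manifold_submanifold:
  assumes M: "submanifold_of_euclidean S M"
  shows "smooth_manifold M"
proof -
  note D = submanifold_of_euclideanD[OF M]
  have "smooth_map M M (\<lambda>p. p)"
    by (rule smooth_map_submanifold[OF M M])
      (auto intro: Cinf_imp_smooth_on[OF Cinf_on_ident[OF open_UNIV]])
  moreover have "second_countable (top_of_set S)"
  proof (rule second_countable_subtopology)
    obtain B :: "'a set set" where B: "countable B" "\<And>C. C \<in> B \<Longrightarrow> open C"
      "\<And>U. open U \<Longrightarrow> \<exists>V. V \<subseteq> B \<and> U = \<Union>V"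
      using univ_second_countable by metis
    then show "second_countable (euclidean :: 'a topology)"
      unfolding second_countable_def
    proof (intro exI conjI allI impI)
      fix U :: "'a set" and x assume U: "openin euclidean U \<and> x \<in> U"
      then obtain V where "V \<subseteq> B" "U = \<Union>V" using B(3)[of U] open_openin by blast
      then show "\<exists>C\<in>B. x \<in> C \<and> C \<subseteq> U" using U by blast
    qed (use B(1,2) in simp_all)
  qed
  ultimately show ?thesis
    unfolding smooth_manifold_def smooth_map_def using D is_chart_submanifold[OF M]
    by (auto simp: Hausdorff_space_subtopology)
qed

lemma euclidean_submanifold_of_euclidean: "submanifold_of_euclidean UNIV euclidean_manifold"
proof -
  have "smooth_on UNIV (\<lambda>x::'a. x)" by (rule Cinf_imp_smooth_on[OF Cinf_on_ident[OF open_UNIV]]) simp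
  moreover have "inv_into UNIV (\<lambda>x::'a. x) = (\<lambda>x. x)" by (rule inv_equality) auto
  ultimately show ?thesis by (simp add: submanifold_of_euclidean_def euclidean_manifold_def)
qed

lemma embedded_submanifoldI:
  assumes M: "submanifold_of_euclidean S M" and N: "submanifold_of_euclidean S' N" and sub: "S \<subseteq> S'"
  shows "embedded_submanifold S M N"
proof -
  note D = submanifold_of_euclideanD[OF M] and D' = submanifold_of_euclideanD[OF N]
  have sm: "smooth_map M N (\<lambda>p. p)"
    by (rule smooth_map_submanifold[OF M N])
      (use sub in \<open>auto intro: Cinf_imp_smooth_on[OF Cinf_on_ident[OF open_UNIV]]\<close>)
  have "smooth_immersion M N (\<lambda>p. p)"
    unfolding smooth_immersion_def
  proof (intro conjI ballI sm)
    fix c d x assume c: "c \<in> atlas M" and d: "d \<in> atlas N" and x: "x \<in> coord_dom c d (\<lambda>p. p)"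
    let ?f = "coord_rep c d (\<lambda>p. p)" and ?W = "coord_dom c d (\<lambda>p. p)"
    \<comment> \<open>Going back from the chart \<open>d\<close> to \<open>c\<close> is a smooth
      left inverse of the coordinate representation of the inclusion; its differential
      \<open>K\<close> undoes \<open>L\<close>, so \<open>L\<close> is injective on the
      model.\<close>
    let ?h = "snd c \<circ> inv_into (fst d) (snd d)"
    have opW: "openin (top_of_set (model M)) ?W"
    proof (rule openin_coord_dom[OF is_chart_submanifold[OF M c]])
      show "openin (mtop N) (fst d)" using is_chart_submanifold[OF N d] by (simp add: is_chart_def)
      show "continuous_map (mtop M) (mtop N) (\<lambda>p. p)" using sm by (simp add: smooth_map_def)
    qed
    have "smooth_on ?W ?f" using sm c d by (simp add: smooth_map_def)
    then obtain L where L: "(?f has_derivative L) (at x within ?W)" using smooth_on_derivative[OF _ x] by metis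
    have fW: "?f ` ?W \<subseteq> snd d ` (fst c \<inter> fst d)"
      using D(6)[OF c] by (auto simp: coord_dom_def coord_rep_def)
    have "smooth_on (snd d ` (fst c \<inter> fst d)) ?h"
      by (rule smooth_on_compose[OF D(7)[OF c] smooth_on_subset[OF D'(8)[OF d]]]) (use D'(6)[OF d] in auto)
    moreover have "?f x \<in> snd d ` (fst c \<inter> fst d)" using fW x by blast
    ultimately obtain K where K: "(?h has_derivative K) (at (?f x) within snd d ` (fst c \<inter> fst d))"
      by (rule smooth_on_derivative)
    have "K (L v) = v" if "v \<in> model M" for v
    proof (rule has_derivative_left_inverse[OF L K fW _ opW D(2) x that])
      fix y assume "y \<in> ?W"
      then show "?h (?f y) = y"
        using D(6)[OF c] D'(6)[OF d] by (auto simp: coord_dom_def coord_rep_def)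
    qed
    then have "inj_on L (model M)" by (rule inj_on_inverseI)
    then show "\<exists>L. (?f has_derivative L) (at x within ?W) \<and> inj_on L (model M)" using L by blast
  qed
  then show ?thesis
    unfolding embedded_submanifold_def
    using smooth_manifold_submanifold[OF M] smooth_manifold_submanifold[OF N] sub D(1) D'(1)
    by (simp add: subtopology_subtopology inf_absorb2)
qed

text \<open>The inverse of a chart is smooth into the ambient space because the inclusion is. The
  chart itself is harder, as it must extend to an open set of the ambient space: the extension is a
  local left inverse of the inverse chart, which exists because the inclusion is an
  immersion.\<close>

lemma embedded_submanifold_imp_submanifold_of_euclidean:
  assumes emb: "embedded_submanifold S M N" and N: "submanifold_of_euclidean S' N"
  shows "submanifold_of_euclidean S M"
proof -
  note D' = submanifold_of_euclideanD[OF N]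
  have sub: "S \<subseteq> S'" using emb D'(1) by (simp add: embedded_submanifold_def)
  have top: "mtop M = top_of_set S"
    using emb sub D'(1) by (simp add: embedded_submanifold_def subtopology_subtopology inf_absorb2)
  have sm: "smooth_manifold M" and imm: "smooth_immersion M N (\<lambda>p. p)"
    using emb by (auto simp: embedded_submanifold_def)
  have E: "subspace (model M)" and cov: "(\<Union>c\<in>atlas M. fst c) = S"
    and ch: "\<And>c. c \<in> atlas M \<Longrightarrow> is_chart (mtop M) (model M) c"
    using sm top by (auto simp: smooth_manifold_def)
  have cm: "continuous_map (mtop M) (mtop N) (\<lambda>p. p)"
    and sr: "\<And>c d. c \<in> atlas M \<Longrightarrow> d \<in> atlas N \<Longrightarrow> smooth_on (coord_dom c d (\<lambda>p. p)) (coord_rep c d (\<lambda>p. p))"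
    using imm by (auto simp: smooth_immersion_def smooth_map_def)
  have main: "openin (top_of_set S) (fst c) \<and> openin (top_of_set (model M)) (snd c ` fst c) \<and>
        inj_on (snd c) (fst c) \<and> smooth_on (fst c) (snd c) \<and>
        smooth_on (snd c ` fst c) (inv_into (fst c) (snd c))" if c: "c \<in> atlas M" for c
  proof -
    let ?p = "inv_into (fst c) (snd c)" and ?W = "snd c ` fst c"
    have cS: "openin (top_of_set S) (fst c)" "openin (top_of_set (model M)) ?W"
      using ch[OF c] top by (auto simp: is_chart_def)
    have fcS: "fst c \<subseteq> S" using openin_imp_subset[OF cS(1)] .
    have inj: "inj_on (snd c) (fst c)" by (rule chart_inj_on[OF ch[OF c]])
    have "homeomorphic_map (top_of_set (fst c)) (top_of_set ?W) (snd c)"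
      using ch[OF c] top fcS by (simp add: is_chart_def subtopology_subtopology inf_absorb2)
    then have contc: "continuous_on (fst c) (snd c)"
      using homeomorphic_imp_continuous_map by fastforce
    have opd: "openin (top_of_set (model M)) (coord_dom c d (\<lambda>p. p))" if "d \<in> atlas N" for d
      using openin_coord_dom[OF ch[OF c] _ cm, where d=d] is_chart_submanifold[OF N that] by (simp add: is_chart_def)
    have dex: "\<exists>d\<in>atlas N. p \<in> fst d" if "p \<in> fst c" for p
      using that fcS sub D'(3) by auto
    have smp: "smooth_on ?W ?p"
    proof (rule smooth_onI_local)
      fix x assume x: "x \<in> ?W"
      then have px: "?p x \<in> fst c" "snd c (?p x) = x" by (auto simp: inv_into_into f_inv_into_f)
      obtain d where d: "d \<in> atlas N" "?p x \<in> fst d" using dex[OF px(1)] by auto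
      obtain U where U: "open U" "coord_dom c d (\<lambda>p. p) = model M \<inter> U" using opd[OF d(1)] by (auto simp: openin_open)
      have xd: "x \<in> coord_dom c d (\<lambda>p. p)" using px d(2) by (force simp: coord_dom_def)
      have "smooth_on (coord_dom c d (\<lambda>p. p)) (inv_into (fst d) (snd d) \<circ> coord_rep c d (\<lambda>p. p))"
        by (rule smooth_on_compose[OF D'(8)[OF d(1)] sr[OF c d(1)]])
          (use inj in \<open>auto simp: coord_dom_def coord_rep_def\<close>)
      then have "smooth_on (coord_dom c d (\<lambda>p. p)) ?p"
        by (rule smooth_on_cong) (use inj D'(6)[OF d(1)] in \<open>auto simp: coord_dom_def coord_rep_def\<close>)
      then have "smooth_on (U \<inter> ?W) ?p"
        by (rule smooth_on_subset) (use U openin_imp_subset[OF cS(2)] in auto)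
      then show "\<exists>U. open U \<and> x \<in> U \<and> smooth_on (U \<inter> ?W) ?p" using U xd by auto
    qed
    have "smooth_on (fst c) (snd c)"
      unfolding smooth_on_iff_Cinf
    proof
      fix p assume p: "p \<in> fst c"
      define x where "x = snd c p"
      have px: "?p x = p" "x \<in> ?W" using p inj by (auto simp: x_def)
      obtain d where d: "d \<in> atlas N" "p \<in> fst d" using dex[OF p] by auto
      have xd: "x \<in> coord_dom c d (\<lambda>p. p)" using p d(2) by (auto simp: coord_dom_def x_def)
      obtain U g L where g: "Cinf_on g U" "x \<in> U" "\<And>y. y \<in> U \<inter> ?W \<Longrightarrow> g y = ?p y"
        "(g has_derivative L) (at x)" "(?p has_derivative L) (at x within ?W)"
        using smooth_on_derivative[OF smp px(2)] by metis
      obtain L1 where L1: "(coord_rep c d (\<lambda>p. p) has_derivative L1) (at x within coord_dom c d (\<lambda>p. p))"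
        "inj_on L1 (model M)"
        using imm c d(1) xd unfolding smooth_immersion_def by blast
      obtain K where K: "(snd d has_derivative K) (at p within fst d)"
        using smooth_on_derivative[OF D'(7)[OF d(1)] d(2)] by metis
      have pd: "?p ` coord_dom c d (\<lambda>p. p) \<subseteq> fst d" using inj by (auto simp: coord_dom_def)
      have "(?p has_derivative L) (at x within coord_dom c d (\<lambda>p. p))"
        by (rule has_derivative_subset[OF g(5)]) (auto simp: coord_dom_def)
      then have "((\<lambda>y. snd d (?p y)) has_derivative (\<lambda>v. K (L v))) (at x within coord_dom c d (\<lambda>p. p))"
        by (rule has_derivative_in_compose) (use has_derivative_subset[OF K pd] px(1) in simp)
      then have "(coord_rep c d (\<lambda>p. p) has_derivative (\<lambda>v. K (L v))) (at x within coord_dom c d (\<lambda>p. p))"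
        by (simp add: coord_rep_def o_def)
      \<comment> \<open>\<open>L1\<close> is the injective differential given by the immersion,
        \<open>K\<close> that of the chart \<open>d\<close>. They are compared along the model,
        where injectivity passes to \<open>L\<close>.\<close>
      then have "L1 v = K (L v)" if "v \<in> model M" for v
        using has_derivative_within_subspace_unique[OF L1(1) _ opd[OF d(1)] E xd that] by blast
      then have injL: "inj_on L (model M)" using L1(2) by (metis inj_onI inj_onD)
      have xE: "x \<in> model M" using px(2) openin_imp_subset[OF cS(2)] by auto
      obtain Z Wh h where h: "open Z" "x \<in> Z" "Cinf_on h Wh" "g x \<in> Wh"
        "\<And>y. y \<in> Z \<inter> model M \<Longrightarrow> h (g y) = y"
        using immersion_local_left_inverse[OF E g(1,2) xE g(4) injL] by metis
      \<comment> \<open>Here the subspace topology enters: points of the chart that are near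
        \<open>p\<close> in the ambient space have coordinates near \<open>x\<close>, where
        \<open>h\<close> inverts \<open>g\<close>. For a merely immersed set such points could have
        remote coordinates.\<close>
      have "openin (top_of_set (fst c)) (fst c \<inter> snd c -` (Z \<inter> U))"
        by (rule continuous_openin_preimage_gen[OF contc]) (use h(1) Cinf_onD(1)[OF g(1)] in auto)
      then obtain O' where O': "open O'" "fst c \<inter> snd c -` (Z \<inter> U) = fst c \<inter> O'"
        by (auto simp: openin_open)
      show "\<exists>U g. Cinf_on g U \<and> p \<in> U \<and> (\<forall>y\<in>U \<inter> fst c. g y = snd c y)"
      proof (intro exI conjI ballI)
        show "Cinf_on h (Wh \<inter> O')" by (rule Cinf_on_subset[OF h(3)]) (use Cinf_onD(1)[OF h(3)] O'(1) in auto)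
        have "g x = p" using g(2,3) px by auto
        moreover have "p \<in> fst c \<inter> snd c -` (Z \<inter> U)" using p h(2) g(2) by (simp add: x_def)
        ultimately show "p \<in> Wh \<inter> O'" using h(4) unfolding O'(2) by simp
        fix q assume q: "q \<in> (Wh \<inter> O') \<inter> fst c"
        then have "snd c q \<in> Z \<inter> U" using O'(2) by blast
        moreover have "snd c q \<in> model M" using q openin_imp_subset[OF cS(2)] by auto
        moreover have "?p (snd c q) = q" using q inj by auto
        ultimately show "h q = snd c q" using h(5)[of "snd c q"] g(3)[of "snd c q"] q by auto
      qed
    qed
    then show ?thesis using cS inj smp by blast
  qed
  then show ?thesis unfolding submanifold_of_euclidean_def using top E cov by blast
qed

section \<open>Maps out of and into quotients\<close>

text \<open>Near any point the projection has a smooth section in coordinates, and the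
  representation of \<open>f\<close> is that of \<open>f \<circ> \<pi>\<close> composed with this
  section.\<close>

lemma smooth_map_from_quotient:
  assumes G: "smooth_manifold G" and M: "smooth_manifold M"
    and \<pi>: "smooth_submersion G M \<pi>" and onto: "\<pi> ` carrier_of G = carrier_of M"
    and f\<pi>: "smooth_map G T (f \<circ> \<pi>)" and cf: "continuous_map (mtop M) (mtop T) f"
  shows "smooth_map M T f"
  unfolding smooth_map_def
proof (intro conjI cf ballI)
  fix c d assume c: "c \<in> atlas M" and d: "d \<in> atlas T"
  have EG: "subspace (model G)" and covG: "(\<Union>c\<in>atlas G. fst c) = carrier_of G"
    and chG: "\<And>c. c \<in> atlas G \<Longrightarrow> is_chart (mtop G) (model G) c" using G by (auto simp: smooth_manifold_def)
  have EM: "subspace (model M)" and chM: "is_chart (mtop M) (model M) c" using M c by (auto simp: smooth_manifold_def)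
  have sm\<pi>: "smooth_map G M \<pi>" and c\<pi>: "continuous_map (mtop G) (mtop M) \<pi>"
    using \<pi> by (auto simp: smooth_submersion_def smooth_map_def)
  have injc: "inj_on (snd c) (fst c)" by (rule chart_inj_on[OF chM])
  have sub: "fst c \<subseteq> carrier_of M" using chM by (simp add: is_chart_def openin_subset)
  show "smooth_on (coord_dom c d f) (coord_rep c d f)"
  proof (rule smooth_onI_local)
    fix x assume x: "x \<in> coord_dom c d f"
    then obtain m where m: "m \<in> fst c" "f m \<in> fst d" "x = snd c m" by (auto simp: coord_dom_def)
    have "m \<in> \<pi> ` carrier_of G" unfolding onto using sub m(1) by (rule subsetD)
    then obtain V where V: "V \<in> carrier_of G" "\<pi> V = m" by (metis imageE)
    obtain e where e: "e \<in> atlas G" "V \<in> fst e" using V(1) unfolding covG[symmetric] by auto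
    have inje: "inj_on (snd e) (fst e)" by (rule chart_inj_on[OF chG[OF e(1)]])
    let ?W = "coord_dom e c \<pi>" and ?p = "coord_rep e c \<pi>"
    define y where "y = snd e V"
    have y: "y \<in> ?W" "?p y = x" using V e(2) m inje by (auto simp: y_def coord_dom_def coord_rep_def)
    have opW: "openin (top_of_set (model G)) ?W"
      using openin_coord_dom[OF chG[OF e(1)] _ c\<pi>, where d=c] chM by (simp add: is_chart_def)
    then obtain Z where Z: "open Z" "?W = model G \<inter> Z" by (auto simp: openin_open)
    have "smooth_on ?W ?p" using sm\<pi> e(1) c by (simp add: smooth_map_def)
    then obtain U g D where g: "Cinf_on g U" "y \<in> U" "\<And>z. z \<in> U \<inter> ?W \<Longrightarrow> g z = ?p z"
      "(g has_derivative D) (at y)" "(?p has_derivative D) (at y within ?W)"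
      using smooth_on_derivative[OF _ y(1)] by metis
    obtain D0 where D0: "(?p has_derivative D0) (at y within ?W)" "D0 ` model G = model M"
      using \<pi> e(1) c y(1) unfolding smooth_submersion_def by blast
    \<comment> \<open>\<open>D\<close> comes from the extension \<open>g\<close>, \<open>D0\<close>
      from the submersion hypothesis; agreement on \<open>model G\<close> lets \<open>D\<close>
      cover \<open>model M\<close>.\<close>
    have "D v = D0 v" if "v \<in> model G" for v
      by (rule has_derivative_within_subspace_unique[OF g(5) D0(1) opW EG y(1) that])
    then have surj: "model M \<subseteq> D ` model G" using D0(2) by (metis image_cong subset_refl)
    \<comment> \<open>Inside \<open>Z\<close> the points of \<open>model G\<close> lie in the
      coordinate domain, so there \<open>g\<close> sends them into \<open>model M\<close>, as the
      section theorem asks.\<close>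
    have g': "Cinf_on g (U \<inter> Z)" by (rule Cinf_on_subset[OF g(1)]) (use Cinf_onD(1)[OF g(1)] Z(1) in auto)
    have pW: "?p z \<in> model M" if "z \<in> ?W" for z
    proof -
      have "?p z \<in> snd c ` fst c" using that inje by (auto simp: coord_dom_def coord_rep_def)
      then show ?thesis using chM openin_imp_subset by (fastforce simp: is_chart_def)
    qed
    have "g z \<in> model M" if "z \<in> U \<inter> Z \<inter> model G" for z
      using g(3)[of z] pW[of z] that Z(2) by auto
    moreover have "y \<in> U \<inter> Z" "y \<in> model G" using y(1) g(2) Z(2) by auto
    ultimately obtain Ws s where s: "Cinf_on s Ws" "g y \<in> Ws" "s (g y) = y"
      "\<And>w. w \<in> Ws \<inter> model M \<Longrightarrow> s w \<in> U \<inter> Z \<inter> model G \<and> g (s w) = w"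
      using submersion_local_section[OF EG EM g' _ _ g(4) surj] by metis
    have gy: "g y = x" using g(2,3) y by auto
    have cd: "coord_dom c d f \<subseteq> model M"
      using chM openin_imp_subset by (fastforce simp: is_chart_def coord_dom_def)
    have key: "s w \<in> coord_dom e d (f \<circ> \<pi>) \<and> coord_rep e d (f \<circ> \<pi>) (s w) = coord_rep c d f w"
      if w: "w \<in> Ws \<inter> coord_dom c d f" for w
    proof -
      have sw: "s w \<in> ?W" "?p (s w) = w"
        using s(4)[of w] g(3)[of "s w"] w cd Z(2) by auto
      then obtain q where q: "q \<in> fst e" "\<pi> q \<in> fst c" "s w = snd e q" by (auto simp: coord_dom_def)
      have "snd c (\<pi> q) = w" using sw(2) q inje by (auto simp: coord_rep_def)
      moreover obtain n where "n \<in> fst c" "f n \<in> fst d" "w = snd c n" using w by (auto simp: coord_dom_def)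
      ultimately have "\<pi> q = n" using injc q(2) by (meson inj_onD)
      then show ?thesis using q \<open>n \<in> fst c\<close> \<open>f n \<in> fst d\<close> \<open>w = snd c n\<close> inje injc
        by (auto simp: coord_dom_def coord_rep_def)
    qed
    have "smooth_on (coord_dom e d (f \<circ> \<pi>)) (coord_rep e d (f \<circ> \<pi>))"
      using f\<pi> e(1) d by (simp add: smooth_map_def)
    then have "smooth_on (Ws \<inter> coord_dom c d f) (coord_rep e d (f \<circ> \<pi>) \<circ> s)"
      by (rule smooth_on_compose[OF _ Cinf_imp_smooth_on[OF s(1)]]) (use key in auto)
    then have "smooth_on (Ws \<inter> coord_dom c d f) (coord_rep c d f)"
      by (rule smooth_on_cong) (use key in auto)
    then show "\<exists>U. open U \<and> x \<in> U \<and> smooth_on (U \<inter> coord_dom c d f) (coord_rep c d f)"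
      using Cinf_onD(1)[OF s(1)] s(2) gy by blast
  qed
qed

text \<open>Gives smoothness into the quotient: in coordinates \<open>\<psi>\<close> is the
  representation of \<open>\<pi>\<close> after that of \<open>\<sigma>\<close>, once the
  neighbourhood is so small that \<open>\<sigma>\<close> stays in one chart of
  \<open>G\<close>.\<close>

lemma smooth_map_local_lift:
  assumes T: "submanifold_of_euclidean S' T" and G: "submanifold_of_euclidean S G"
    and \<pi>: "smooth_map G M \<pi>" and c\<psi>: "continuous_map (mtop T) (mtop M) \<psi>"
    and lift: "\<And>q. q \<in> S' \<Longrightarrow> \<exists>U \<sigma>. open U \<and> q \<in> U \<and> smooth_on (U \<inter> S') \<sigma> \<and> \<sigma> ` (U \<inter> S') \<subseteq> S \<and>
      (\<forall>r\<in>U \<inter> S'. \<psi> r = \<pi> (\<sigma> r))"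
  shows "smooth_map T M \<psi>"
  unfolding smooth_map_def
proof (intro conjI c\<psi> ballI)
  note DT = submanifold_of_euclideanD[OF T] and DG = submanifold_of_euclideanD[OF G]
  fix d c assume d: "d \<in> atlas T" and c: "c \<in> atlas M"
  let ?p = "inv_into (fst d) (snd d)" and ?C = "coord_dom d c \<psi>"
  show "smooth_on ?C (coord_rep d c \<psi>)"
  proof (rule smooth_onI_local)
    fix x assume x: "x \<in> ?C"
    have pC: "?p w \<in> fst d" "\<psi> (?p w) \<in> fst c" if "w \<in> ?C" for w
      using that DT(6)[OF d] by (auto simp: coord_dom_def)
    obtain U \<sigma> where U: "open U" "?p x \<in> U" "smooth_on (U \<inter> S') \<sigma>" "\<sigma> ` (U \<inter> S') \<subseteq> S"
      "\<And>r. r \<in> U \<inter> S' \<Longrightarrow> \<psi> r = \<pi> (\<sigma> r)"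
      using lift[of "?p x"] pC(1)[OF x] DT(9)[OF d] by blast
    have smp: "smooth_on ?C ?p" by (rule smooth_on_subset[OF DT(8)[OF d]]) (auto simp: coord_dom_def)
    have "openin (top_of_set ?C) (?C \<inter> ?p -` U)"
      by (rule continuous_openin_preimage_gen[OF smooth_on_continuous[OF smp] U(1)])
    then obtain U1 where U1: "open U1" "?C \<inter> ?p -` U = ?C \<inter> U1" by (auto simp: openin_open)
    have s1: "smooth_on (?C \<inter> U1) (\<sigma> \<circ> ?p)"
      by (rule smooth_on_compose[OF U(3) smooth_on_subset[OF smp]]) (use U1(2) pC(1) DT(9)[OF d] in blast)+
    have \<sigma>S: "(\<sigma> \<circ> ?p) w \<in> S" "\<psi> (?p w) = \<pi> (\<sigma> (?p w))" if "w \<in> ?C \<inter> U1" for w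
      using U(4,5) U1(2) pC(1)[of w] DT(9)[OF d] that by fastforce+
    have xU: "x \<in> ?C \<inter> U1" using x U(2) U1(2) by auto
    obtain e where e: "e \<in> atlas G" "(\<sigma> \<circ> ?p) x \<in> fst e" using \<sigma>S(1)[OF xU] DG(3) by auto
    obtain Z where Z: "open Z" "fst e = S \<inter> Z" using DG(4)[OF e(1)] by (auto simp: openin_open)
    have "openin (top_of_set (?C \<inter> U1)) ((?C \<inter> U1) \<inter> (\<sigma> \<circ> ?p) -` Z)"
      by (rule continuous_openin_preimage_gen[OF smooth_on_continuous[OF s1] Z(1)])
    then obtain U2 where U2: "open U2" "(?C \<inter> U1) \<inter> (\<sigma> \<circ> ?p) -` Z = (?C \<inter> U1) \<inter> U2"
      by (auto simp: openin_open)
    have xU2: "x \<in> U2" using xU e(2) Z(2) U2(2) by blast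
    let ?N = "(U1 \<inter> U2) \<inter> ?C"
    have \<sigma>e: "(\<sigma> \<circ> ?p) w \<in> fst e" if "w \<in> ?N" for w using that \<sigma>S(1)[of w] U2(2) Z(2) by blast
    have inje: "inj_on (snd e) (fst e)" by (rule DG(6)[OF e(1)])
    have h: "smooth_on ?N (snd e \<circ> (\<sigma> \<circ> ?p))"
      by (rule smooth_on_compose[OF DG(7)[OF e(1)] smooth_on_subset[OF s1]]) (use \<sigma>e in auto)
    have key: "(snd e \<circ> (\<sigma> \<circ> ?p)) w \<in> coord_dom e c \<pi> \<and>
        coord_rep e c \<pi> ((snd e \<circ> (\<sigma> \<circ> ?p)) w) = coord_rep d c \<psi> w" if "w \<in> ?N" for w
      using \<sigma>e[OF that] \<sigma>S(2)[of w] pC(2)[of w] that inje by (auto simp: coord_dom_def coord_rep_def)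
    have "smooth_on (coord_dom e c \<pi>) (coord_rep e c \<pi>)"
      using \<pi> e(1) c by (simp add: smooth_map_def)
    then have "smooth_on ?N (coord_rep e c \<pi> \<circ> (snd e \<circ> (\<sigma> \<circ> ?p)))"
      by (rule smooth_on_compose[OF _ h]) (use key in auto)
    then have "smooth_on ?N (coord_rep d c \<psi>)" by (rule smooth_on_cong) (use key in auto)
    then show "\<exists>U. open U \<and> x \<in> U \<and> smooth_on (U \<inter> ?C) (coord_rep d c \<psi>)"
      using U1(1) U2(1) xU xU2 by (intro exI[of _ "U1 \<inter> U2"]) auto
  qed
qed

text \<open>Differentiating \<open>F (\<sigma> r) = r\<close> in charts gives a right inverse of the
  differential of \<open>F\<close>. As \<open>\<sigma> (F p) = p\<close>, this concerns the
  differential at \<open>p\<close> itself and not at another point of the fibre.\<close>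

lemma smooth_submersion_local_sections:
  assumes G: "submanifold_of_euclidean S G" and T: "submanifold_of_euclidean S' T"
    and F: "smooth_on S F" "F ` S \<subseteq> S'"
    and sec: "\<And>p. p \<in> S \<Longrightarrow> \<exists>U \<sigma>. open U \<and> F p \<in> U \<and> smooth_on (U \<inter> S') \<sigma> \<and> \<sigma> ` (U \<inter> S') \<subseteq> S \<and>
      \<sigma> (F p) = p \<and> (\<forall>r\<in>U \<inter> S'. F (\<sigma> r) = r)"
  shows "smooth_submersion G T F"
proof -
  note DT = submanifold_of_euclideanD[OF T] and DG = submanifold_of_euclideanD[OF G]
  have sm: "smooth_map G T F" by (rule smooth_map_submanifold[OF G T F])
  show ?thesis unfolding smooth_submersion_def
  proof (intro conjI ballI sm)
    fix c d x assume c: "c \<in> atlas G" and d: "d \<in> atlas T" and x: "x \<in> coord_dom c d F"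
    let ?W = "coord_dom c d F" and ?f = "coord_rep c d F" and ?q = "inv_into (fst d) (snd d)"
    have injc: "inj_on (snd c) (fst c)" and injd: "inj_on (snd d) (fst d)" using DG(6)[OF c] DT(6)[OF d] .
    have opW: "openin (top_of_set (model G)) ?W"
    proof (rule openin_coord_dom[OF is_chart_submanifold[OF G c]])
      show "openin (mtop T) (fst d)" using is_chart_submanifold[OF T d] by (simp add: is_chart_def)
      show "continuous_map (mtop G) (mtop T) F" using sm by (simp add: smooth_map_def)
    qed
    have "smooth_on ?W ?f" using sm c d by (simp add: smooth_map_def)
    then obtain D where D: "(?f has_derivative D) (at x within ?W)" using smooth_on_derivative[OF _ x] by metis
    have fE: "?f ` ?W \<subseteq> model T"
      using injc openin_imp_subset[OF DT(5)[OF d]] by (auto simp: coord_dom_def coord_rep_def)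
    have into: "D ` model G \<subseteq> model T"
      using has_derivative_within_subspace_range[OF D opW DG(2) x _ DT(2) fE] by auto
    obtain p where p: "p \<in> fst c" "F p \<in> fst d" "x = snd c p" using x by (auto simp: coord_dom_def)
    then obtain U \<sigma> where U: "open U" "F p \<in> U" "smooth_on (U \<inter> S') \<sigma>" "\<sigma> ` (U \<inter> S') \<subseteq> S"
      "\<sigma> (F p) = p" "\<And>r. r \<in> U \<inter> S' \<Longrightarrow> F (\<sigma> r) = r"
      using sec[of p] DG(9)[OF c] by blast
    obtain Z where Z: "open Z" "fst c = S \<inter> Z" using DG(4)[OF c] by (auto simp: openin_open)
    have "openin (top_of_set (U \<inter> S')) ((U \<inter> S') \<inter> \<sigma> -` Z)"
      by (rule continuous_openin_preimage_gen[OF smooth_on_continuous[OF U(3)] Z(1)])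
    then have "openin (top_of_set S') ((U \<inter> S') \<inter> \<sigma> -` Z)"
      by (rule openin_trans) (use U(1) in \<open>auto simp: openin_open\<close>)
    then obtain Z' where Z': "open Z'" "(U \<inter> S') \<inter> \<sigma> -` Z = S' \<inter> Z'" by (auto simp: openin_open)
    let ?N = "snd d ` (fst d \<inter> Z')"
    have opN: "openin (top_of_set (model T)) ?N"
    proof -
      have "openin (top_of_set (snd d ` fst d)) (snd d ` fst d \<inter> ?q -` Z')"
        by (rule continuous_openin_preimage_gen[OF smooth_on_continuous[OF DT(8)[OF d]] Z'(1)])
      moreover have "snd d ` fst d \<inter> ?q -` Z' = ?N" using injd by auto
      ultimately show ?thesis using openin_trans[OF _ DT(5)[OF d]] by simp
    qed
    have dZ: "r \<in> U \<inter> S' \<and> \<sigma> r \<in> fst c" if "r \<in> fst d \<inter> Z'" for r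
      using that DT(9)[OF d] Z'(2) Z(2) U(4) by blast
    have pZ: "F p \<in> fst d \<inter> Z'" using p U(2,5) Z(2) Z'(2) DT(9)[OF d] by blast
    let ?h = "snd c \<circ> (\<sigma> \<circ> ?q)"
    have "smooth_on ?N (\<sigma> \<circ> ?q)"
      by (rule smooth_on_compose[OF U(3) smooth_on_subset[OF DT(8)[OF d]]]) (use dZ injd in auto)
    then have "smooth_on ?N ?h" by (rule smooth_on_compose[OF DG(7)[OF c]]) (use dZ injd in auto)
    moreover have z: "snd d (F p) \<in> ?N" using pZ by auto
    ultimately obtain K where K: "(?h has_derivative K) (at (snd d (F p)) within ?N)"
      by (rule smooth_on_derivative)
    have hz: "?h (snd d (F p)) = x" using p injd U(5) by simp
    have hN: "?h ` ?N \<subseteq> ?W"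
      using dZ injd U(6) by (auto simp: coord_dom_def intro!: imageI)
    have Kr: "K w \<in> model G" if "w \<in> model T" for w
      by (rule has_derivative_within_subspace_range[OF K opN DT(2) z that DG(2)])
        (use hN openin_imp_subset[OF opW] in auto)
    have "D (K w) = w" if "w \<in> model T" for w
    proof (rule has_derivative_left_inverse[OF K _ hN _ opN DT(2) z that])
      show "(?f has_derivative D) (at (?h (snd d (F p))) within ?W)" using D hz by simp
      show "?f (?h y) = y" if "y \<in> ?N" for y
        using that dZ injd injc U(6) by (auto simp: coord_rep_def)
    qed
    then have "model T \<subseteq> D ` model G" using Kr by (metis imageI subsetI)
    then show "\<exists>D. (?f has_derivative D) (at x within ?W) \<and> D ` model G = model T" using D into by blast
  qed
qed

section \<open>Transport of a smooth structure along a homeomorphism\<close>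

definition pullback_chart :: "'b set \<Rightarrow> ('b \<Rightarrow> 'a) \<Rightarrow> ('a, 'e) chart \<Rightarrow> ('b, 'e) chart" where
  "pullback_chart X \<phi> d = ({m \<in> X. \<phi> m \<in> fst d}, snd d \<circ> \<phi>)"

text \<open>Used with \<open>\<phi>\<close> the homeomorphism \<open>phi1 k\<close> from the
  topological quotient, which thereby gets an atlas without slices for the group action.\<close>

definition pullback_manifold :: "'b topology \<Rightarrow> ('b \<Rightarrow> 'a) \<Rightarrow> ('a, 'e) manifold \<Rightarrow> ('b, 'e) manifold" where
  "pullback_manifold X \<phi> T =
     \<lparr>mtop = X, model = model T, atlas = pullback_chart (topspace X) \<phi> ` atlas T\<rparr>"

lemma homeomorphic_map_subtopology_openin_preimage:
  assumes \<phi>: "homeomorphic_map X Y \<phi>" and U: "openin Y U"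
  shows "homeomorphic_map (subtopology X {m \<in> topspace X. \<phi> m \<in> U}) (subtopology Y U) \<phi>"
proof (rule homeomorphic_map_subtopologies[OF \<phi>])
  show "\<phi> ` (topspace X \<inter> {m \<in> topspace X. \<phi> m \<in> U}) = topspace Y \<inter> U"
    unfolding homeomorphic_imp_surjective_map[OF \<phi>, symmetric] by auto
qed

text \<open>The set of coordinates is unaffected by the pullback, and only the inverse chart passes
  through \<open>\<phi>\<close>; hence transition maps coincide with those of the original
  atlas.\<close>

lemma pullback_chart_facts:
  assumes \<phi>: "bij_betw \<phi> X Y" and inj: "inj_on (snd d) (fst d)" and sub: "fst d \<subseteq> Y"
  shows "snd (pullback_chart X \<phi> d) ` fst (pullback_chart X \<phi> d) = snd d ` fst d"
    and "x \<in> snd d ` fst d \<Longrightarrow>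
      inv_into (fst (pullback_chart X \<phi> d)) (snd (pullback_chart X \<phi> d)) x = inv_into X \<phi> (inv_into (fst d) (snd d) x)"
proof -
  have im: "\<phi> ` {m \<in> X. \<phi> m \<in> fst d} = fst d" using \<phi> sub by (auto simp: bij_betw_def)
  then show 1: "snd (pullback_chart X \<phi> d) ` fst (pullback_chart X \<phi> d) = snd d ` fst d"
    by (simp only: pullback_chart_def fst_conv snd_conv image_comp[symmetric])
  have inj': "inj_on (snd d \<circ> \<phi>) {m \<in> X. \<phi> m \<in> fst d}"
    by (intro comp_inj_on) (use \<phi> im inj in \<open>auto simp: bij_betw_def inj_on_def\<close>)
  assume "x \<in> snd d ` fst d"
  then obtain p where p: "p \<in> fst d" "x = snd d p" by auto
  then obtain m where m: "m \<in> X" "p = \<phi> m" using im by blast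
  have "inv_into {m \<in> X. \<phi> m \<in> fst d} (snd d \<circ> \<phi>) ((snd d \<circ> \<phi>) m) = m"
    by (rule inv_into_f_f[OF inj']) (use m p in auto)
  moreover have "inv_into X \<phi> (\<phi> m) = m" using \<phi> m by (simp add: bij_betw_def)
  ultimately show "inv_into (fst (pullback_chart X \<phi> d)) (snd (pullback_chart X \<phi> d)) x =
      inv_into X \<phi> (inv_into (fst d) (snd d) x)"
    using m p inj by (simp add: pullback_chart_def)
qed

lemma smooth_manifold_pullback:
  assumes T: "smooth_manifold T" and \<phi>: "homeomorphic_map X (mtop T) \<phi>"
  shows "smooth_manifold (pullback_manifold X \<phi> T)"
proof -
  let ?M = "pullback_manifold X \<phi> T"
  have ch: "is_chart (mtop T) (model T) d" if "d \<in> atlas T" for d using T that by (simp add: smooth_manifold_def)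
  have cov: "(\<Union>c\<in>atlas T. fst c) = carrier_of T" using T by (simp add: smooth_manifold_def)
  have bij: "bij_betw \<phi> (topspace X) (carrier_of T)"
    using \<phi> by (simp add: bij_betw_def homeomorphic_imp_injective_map homeomorphic_imp_surjective_map)
  have hs: "X homeomorphic_space mtop T" using \<phi> homeomorphic_map_imp_homeomorphic_space by blast
  have H: "Hausdorff_space X" "second_countable X"
    using T homeomorphic_Hausdorff_space[OF hs] homeomorphic_space_second_countability[OF hs]
    by (auto simp: smooth_manifold_def)
  have sub: "fst d \<subseteq> carrier_of T" if "d \<in> atlas T" for d using ch[OF that] by (simp add: is_chart_def openin_subset)
  note inj = chart_inj_on[OF ch]
  have charts: "is_chart X (model T) (pullback_chart (topspace X) \<phi> d)" if d: "d \<in> atlas T" for d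
  proof -
    have opd: "openin (mtop T) (fst d)" using ch[OF d] by (simp add: is_chart_def)
    have "homeomorphic_map (subtopology X {m \<in> topspace X. \<phi> m \<in> fst d}) (top_of_set (snd d ` fst d)) (snd d \<circ> \<phi>)"
      by (rule homeomorphic_map_compose[OF homeomorphic_map_subtopology_openin_preimage[OF \<phi> opd]])
        (use ch[OF d] in \<open>simp add: is_chart_def\<close>)
    moreover have "openin X {m \<in> topspace X. \<phi> m \<in> fst d}"
      by (rule openin_continuous_map_preimage[OF homeomorphic_imp_continuous_map[OF \<phi>] opd])
    ultimately show ?thesis
      using ch[OF d] pullback_chart_facts(1)[OF bij inj[OF d] sub[OF d]]
      by (simp add: is_chart_def) (simp add: pullback_chart_def)
  qed
  have trans: "smooth_on (coord_dom (pullback_chart (topspace X) \<phi> c) (pullback_chart (topspace X) \<phi> d) (\<lambda>p. p))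
      (coord_rep (pullback_chart (topspace X) \<phi> c) (pullback_chart (topspace X) \<phi> d) (\<lambda>p. p))"
    if c: "c \<in> atlas T" and d: "d \<in> atlas T" for c d
  proof -
    have dom: "coord_dom (pullback_chart (topspace X) \<phi> c) (pullback_chart (topspace X) \<phi> d) (\<lambda>p. p) =
        coord_dom c d (\<lambda>p. p)" (is "?A = ?B")
    proof
      show "?A \<subseteq> ?B" by (auto simp: coord_dom_def pullback_chart_def)
      show "?B \<subseteq> ?A"
      proof
        fix x assume "x \<in> ?B"
        then obtain p where p: "p \<in> fst c" "p \<in> fst d" "x = snd c p" by (auto simp: coord_dom_def)
        moreover then obtain m where "m \<in> topspace X" "p = \<phi> m"
          using sub[OF c] bij by (auto simp: bij_betw_def)
        ultimately show "x \<in> ?A" by (auto simp: coord_dom_def pullback_chart_def)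
      qed
    qed
    have "smooth_on ?B (coord_rep c d (\<lambda>p. p))" using T c d by (simp add: smooth_manifold_def)
    then show ?thesis unfolding dom
    proof (rule smooth_on_cong)
      fix x assume "x \<in> ?B"
      then have x: "x \<in> snd c ` fst c" by (auto simp: coord_dom_def)
      have "inv_into (fst c) (snd c) x \<in> carrier_of T" using inv_into_into[OF x] sub[OF c] by (rule subsetD[rotated])
      then have "\<phi> (inv_into (topspace X) \<phi> (inv_into (fst c) (snd c) x)) = inv_into (fst c) (snd c) x"
        using bij by (auto simp: bij_betw_def intro!: f_inv_into_f)
      then show "coord_rep c d (\<lambda>p. p) x =
          coord_rep (pullback_chart (topspace X) \<phi> c) (pullback_chart (topspace X) \<phi> d) (\<lambda>p. p) x"
        using pullback_chart_facts(2)[OF bij inj[OF c] sub[OF c] x]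
        by (simp add: coord_rep_def) (simp add: pullback_chart_def)
    qed
  qed
  have "\<phi> m \<in> (\<Union>c\<in>atlas T. fst c)" if "m \<in> topspace X" for m
    using that bij unfolding cov by (auto simp: bij_betw_def)
  then have "(\<Union>c\<in>atlas ?M. fst c) = topspace X"
    by (auto simp: pullback_manifold_def pullback_chart_def)
  then show ?thesis
    unfolding smooth_manifold_def using H T charts trans
    by (auto simp: pullback_manifold_def smooth_manifold_def)
qed

lemma smooth_submersion_pullback:
  assumes F: "smooth_submersion G T (\<phi> \<circ> \<pi>)" and \<phi>: "homeomorphic_map X (mtop T) \<phi>"
    and G: "smooth_manifold G" and c\<pi>: "continuous_map (mtop G) X \<pi>"
  shows "smooth_submersion G (pullback_manifold X \<phi> T) \<pi>"
proof -
  have "coord_dom c (pullback_chart (topspace X) \<phi> d) \<pi> = coord_dom c d (\<phi> \<circ> \<pi>)"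
    if "c \<in> atlas G" "d \<in> atlas T" for c d
  proof -
    have "fst c \<subseteq> carrier_of G" using G that(1) by (simp add: smooth_manifold_def is_chart_def openin_subset)
    then have "\<pi> ` fst c \<subseteq> topspace X" using c\<pi> by (auto simp: continuous_map_def)
    then show ?thesis by (auto simp: coord_dom_def pullback_chart_def)
  qed
  moreover have "coord_rep c (pullback_chart (topspace X) \<phi> d) \<pi> = coord_rep c d (\<phi> \<circ> \<pi>)"
    if "c \<in> atlas G" "d \<in> atlas T" for c d
    by (auto simp: coord_rep_def pullback_chart_def)
  ultimately show ?thesis
    using F c\<pi> by (simp add: smooth_submersion_def smooth_map_def pullback_manifold_def)
qed

section \<open>Cosets of the block-diagonal subgroup\<close>

text \<open>\<open>pos\<close> is strictly increasing, hence injective, and its values lie below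
  \<open>CARD('n)\<close>. Sums over \<open>'n\<close> thus become sums over an initial segment of
  \<open>nat\<close>, which can be cut at \<open>k\<close>.\<close>

lemma bij_betw_pos: "bij_betw pos (UNIV :: 'n::{finite, linorder} set) {..<CARD('n)}"
proof -
  have less: "pos i < pos j" if "i < j" for i j :: 'n
    unfolding pos_def by (rule psubset_card_mono) (use that in auto)
  then have inj: "inj (pos :: 'n \<Rightarrow> nat)"
    by (metis injI less_irrefl linorder_neqE)
  have "pos i < CARD('n)" for i :: 'n
    unfolding pos_def by (rule psubset_card_mono) auto
  then have "range (pos :: 'n \<Rightarrow> nat) = {..<CARD('n)}"
    by (intro card_subset_eq) (auto simp: card_image[OF inj])
  then show ?thesis using inj by (simp add: bij_betw_def)
qed

lemma pos_less: "pos (i :: 'n::{finite, linorder}) < CARD('n)"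
  using bij_betw_pos[where 'n='n] by (auto simp: bij_betw_def)

lemma pos_inject: "pos i = pos j \<longleftrightarrow> i = j" for i j :: "'n::{finite, linorder}"
  using bij_betw_pos[where 'n='n] by (auto simp: bij_betw_def inj_on_def)

lemma ex_pos:
  assumes "a < CARD('n)"
  obtains i where "pos (i :: 'n::{finite, linorder}) = a"
  using bij_betw_pos[where 'n='n] assms by (metis bij_betw_def imageE lessThan_iff)

lemma sum_pos: "(\<Sum>l\<in>UNIV. f (pos (l :: 'n::{finite, linorder}))) = (\<Sum>a<CARD('n). f a)"
  by (rule sum.reindex_bij_betw[OF bij_betw_pos])

lemma sum_lessThan_split:
  fixes g :: "nat \<Rightarrow> 'a::comm_monoid_add"
  assumes "k \<le> n"
  shows "(\<Sum>a<n. g a) = (\<Sum>a<k. g a) + (\<Sum>a<n - k. g (a + k))"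
proof -
  have "(\<Sum>a<n. g a) = sum g {0..<k} + sum g {k..<n}"
    using sum.atLeastLessThan_concat[of 0 k n g] assms by (simp add: lessThan_atLeast0)
  also have "sum g {k..<n} = (\<Sum>a\<in>{0..<n - k}. g (a + k))"
    using sum.shift_bounds_nat_ivl[of g 0 k "n - k"] assms by simp
  finally show ?thesis by (simp add: lessThan_atLeast0)
qed

lemma card_pos_less:
  assumes "k \<le> CARD('n)"
  shows "card {i :: 'n::{finite, linorder}. pos i < k} = k"
proof -
  have "a \<in> pos ` {i :: 'n. pos i < k}" if "a < k" for a
    using ex_pos[of a, where 'n='n] assms that by (metis imageI mem_Collect_eq order_less_le_trans)
  then have "pos ` {i :: 'n. pos i < k} = {..<k}" by auto
  moreover have "inj_on pos {i :: 'n. pos i < k}" by (simp add: inj_on_def pos_inject)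
  ultimately show ?thesis by (metis card_image card_lessThan)
qed

lemma transpose_sig_matrix: "transpose (sig_matrix k) = sig_matrix k"
  by (auto simp: transpose_def sig_matrix_def vec_eq_iff)

lemma matrix_mult_sig_matrix:
  "((A :: real^'n::{finite, linorder}^'m) ** sig_matrix k) $ i $ j = A $ i $ j * (if pos j < k then 1 else - 1)"
proof -
  have "(A ** sig_matrix k) $ i $ j = (\<Sum>l\<in>UNIV. if l = j then A $ i $ l * (if pos j < k then 1 else - 1) else 0)"
    unfolding matrix_matrix_mult_def sig_matrix_def vec_lambda_beta by (rule sum.cong) auto
  then show ?thesis by simp
qed

lemma sig_matrix_mult:
  "(sig_matrix k ** (A :: real^'m^'n::{finite, linorder})) $ i $ j = (if pos i < k then 1 else - 1) * A $ i $ j"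
proof -
  have "(sig_matrix k ** A) $ i $ j = (\<Sum>l\<in>UNIV. if l = i then (if pos i < k then 1 else - 1) * A $ l $ j else 0)"
    unfolding matrix_matrix_mult_def sig_matrix_def vec_lambda_beta by (rule sum.cong) auto
  then show ?thesis by simp
qed

lemma sig_matrix_square: "sig_matrix k ** sig_matrix k = mat 1"
  by (auto simp: vec_eq_iff matrix_mult_sig_matrix mat_def) (auto simp: sig_matrix_def)

lemma trace_sig_matrix:
  assumes "k \<le> CARD('n)"
  shows "trace (sig_matrix k :: 'n::{finite, linorder} rmat) = 2 * real k - real CARD('n)"
proof -
  have "trace (sig_matrix k :: 'n rmat) = (\<Sum>a<CARD('n). if a < k then 1 else - 1)"
    by (simp add: trace_def sig_matrix_def sum_pos[of "\<lambda>a. if a < k then 1 else - 1 :: real"])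
  also have "\<dots> = real k - real (CARD('n) - k)"
    by (subst sum_lessThan_split[OF assms]) simp
  finally show ?thesis using assms by (simp add: of_nat_diff)
qed

lemma block_diag_gram:
  fixes Q1 Q2 :: "nat \<Rightarrow> nat \<Rightarrow> real" and i j :: "'n::{finite, linorder}"
  assumes "k \<le> CARD('n)"
  shows "(transpose (block_diag k Q1 Q2) ** block_diag k Q1 Q2) $ i $ j =
    (if pos i < k \<and> pos j < k then \<Sum>l<k. Q1 l (pos i) * Q1 l (pos j)
     else if k \<le> pos i \<and> k \<le> pos j then \<Sum>l<CARD('n) - k. Q2 l (pos i - k) * Q2 l (pos j - k)
     else 0)"
proof -
  \<comment> \<open>The matrix entry as a function of two positions, so that the sum over
    \<open>'n\<close> can be reindexed and cut at \<open>k\<close>; at most one half survives for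
    each pair of columns.\<close>
  define b where "b a c = (if a < k \<and> c < k then Q1 a c else if k \<le> a \<and> k \<le> c then Q2 (a - k) (c - k) else 0)" for a c
  have "(transpose (block_diag k Q1 Q2) ** block_diag k Q1 Q2) $ i $ j = (\<Sum>l\<in>UNIV. b (pos (l::'n)) (pos i) * b (pos l) (pos j))"
    by (simp add: matrix_matrix_mult_def transpose_def block_diag_def b_def)
  also have "\<dots> = (\<Sum>a<k. b a (pos i) * b a (pos j)) + (\<Sum>a<CARD('n) - k. b (a + k) (pos i) * b (a + k) (pos j))"
    unfolding sum_pos[of "\<lambda>a. b a (pos i) * b a (pos j)"] by (rule sum_lessThan_split[OF assms])
  finally show ?thesis by (auto simp: b_def)
qed

lemma orthogonal_matrix_block_diag:
  assumes "k \<le> CARD('n)"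
  shows "orthogonal_matrix (block_diag k Q1 Q2 :: 'n::{finite, linorder} rmat) \<longleftrightarrow>
    orth_block k Q1 \<and> orth_block (CARD('n) - k) Q2"
proof -
  have "orthogonal_matrix (block_diag k Q1 Q2 :: 'n rmat) \<longleftrightarrow>
    (\<forall>i j :: 'n. (transpose (block_diag k Q1 Q2) ** block_diag k Q1 Q2) $ i $ j = (if i = j then 1 else 0))"
    by (simp add: orthogonal_matrix vec_eq_iff mat_def)
  also have "\<dots> \<longleftrightarrow> orth_block k Q1 \<and> orth_block (CARD('n) - k) Q2"
    unfolding block_diag_gram[OF assms]
  proof (intro iffI conjI)
    assume *: "\<forall>i j :: 'n. (if pos i < k \<and> pos j < k then \<Sum>l<k. Q1 l (pos i) * Q1 l (pos j)
     else if k \<le> pos i \<and> k \<le> pos j then \<Sum>l<CARD('n) - k. Q2 l (pos i - k) * Q2 l (pos j - k)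
     else 0) = (if i = j then 1 else 0)"
    show "orth_block k Q1" unfolding orth_block_def
    proof (intro allI impI)
      fix a c assume ac: "a < k" "c < k"
      then obtain i j :: 'n where "pos i = a" "pos j = c" using assms by (metis ex_pos order_less_le_trans)
      then show "(\<Sum>l<k. Q1 l a * Q1 l c) = (if a = c then 1 else 0)"
        using *[rule_format, of i j] ac pos_inject[of i j] by auto
    qed
    show "orth_block (CARD('n) - k) Q2" unfolding orth_block_def
    proof (intro allI impI)
      fix a c assume ac: "a < CARD('n) - k" "c < CARD('n) - k"
      then have "a + k < CARD('n)" "c + k < CARD('n)" by auto
      then obtain i j :: 'n where "pos i = a + k" "pos j = c + k" by (metis ex_pos)
      then show "(\<Sum>l<CARD('n) - k. Q2 l a * Q2 l c) = (if a = c then 1 else 0)"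
        using *[rule_format, of i j] pos_inject[of i j] by auto
    qed
  next
    assume orth: "orth_block k Q1 \<and> orth_block (CARD('n) - k) Q2"
    show "\<forall>i j :: 'n. (if pos i < k \<and> pos j < k then \<Sum>l<k. Q1 l (pos i) * Q1 l (pos j)
     else if k \<le> pos i \<and> k \<le> pos j then \<Sum>l<CARD('n) - k. Q2 l (pos i - k) * Q2 l (pos j - k)
     else 0) = (if i = j then 1 else 0)"
    proof (intro allI)
      fix i j :: 'n
      have "pos i - k < CARD('n) - k" if "k \<le> pos i" for i :: 'n using that pos_less[of i] by linarith
      then show "(if pos i < k \<and> pos j < k then \<Sum>l<k. Q1 l (pos i) * Q1 l (pos j)
     else if k \<le> pos i \<and> k \<le> pos j then \<Sum>l<CARD('n) - k. Q2 l (pos i - k) * Q2 l (pos j - k)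
     else 0) = (if i = j then 1 else 0)"
        using orth pos_inject[of i j] unfolding orth_block_def by auto
    qed
  qed
  finally show ?thesis .
qed

lemma block_diag_commutes: "block_diag k Q1 Q2 ** sig_matrix k = sig_matrix k ** block_diag k Q1 Q2"
  by (simp add: vec_eq_iff matrix_mult_sig_matrix sig_matrix_mult) (simp add: block_diag_def)

text \<open>Comparing the two products entry by entry, an entry is multiplied by the sign of its
  column on one side and of its row on the other, so it vanishes when these signs differ.\<close>

lemma commuting_imp_block_diag:
  fixes B :: "'n::{finite, linorder} rmat"
  assumes "B ** sig_matrix k = sig_matrix k ** B"
  obtains Q1 Q2 where "B = block_diag k Q1 Q2"
proof -
  have zero: "B $ i $ j = 0" if "(pos i < k) \<noteq> (pos j < k)" for i j
  proof -
    have "(B ** sig_matrix k) $ i $ j = (sig_matrix k ** B) $ i $ j" using assms by simp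
    then show ?thesis using that by (auto simp: matrix_mult_sig_matrix sig_matrix_mult split: if_splits)
  qed
  define r where "r = inv (pos :: 'n \<Rightarrow> nat)"
  have r: "r (pos i) = i" for i unfolding r_def by (rule inv_f_f) (simp add: inj_def pos_inject)
  \<comment> \<open>The second block counts from \<open>0\<close>, hence the shift by
    \<open>k\<close>; \<open>r\<close> is arbitrary beyond the range of \<open>pos\<close>, where no
    entry is read.\<close>
  have "B = block_diag k (\<lambda>a b. B $ r a $ r b) (\<lambda>a b. B $ r (a + k) $ r (b + k))"
    using zero by (auto simp: vec_eq_iff block_diag_def r)
  then show ?thesis by (rule that)
qed

section \<open>Conjugates of the signature matrix and their fibres\<close>

lemma orth_group_simps:
  assumes "V \<in> orth_group"
  shows "transpose V ** V = mat 1" "V ** transpose V = mat 1"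
    "transpose V ** (V ** A) = A" "V ** (transpose V ** C) = C"
  using assms by (auto simp: orth_group_def orthogonal_matrix_def matrix_mul_assoc)

lemma orth_group_mult: "V \<in> orth_group \<Longrightarrow> W \<in> orth_group \<Longrightarrow> V ** W \<in> orth_group"
  by (simp add: orth_group_def orthogonal_matrix_mul)

lemma orth_group_transpose: "V \<in> orth_group \<Longrightarrow> transpose V \<in> orth_group"
  by (simp add: orth_group_def)

lemma sig_matrix_orth_group: "sig_matrix k \<in> orth_group"
  by (simp add: orth_group_def orthogonal_matrix transpose_sig_matrix sig_matrix_square)

definition conj_sig :: "nat \<Rightarrow> 'n::{finite, linorder} rmat \<Rightarrow> 'n rmat" where
  "conj_sig k V = V ** sig_matrix k ** transpose V"

lemma coset_eq_fibre:
  fixes V :: "'n::{finite, linorder} rmat"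
  assumes k: "k \<le> CARD('n)" and V: "V \<in> orth_group"
  shows "coset k V = {W \<in> orth_group. conj_sig k W = conj_sig k V}"
proof (intro set_eqI iffI)
  fix W assume "W \<in> coset k V"
  then obtain Q1 Q2 where W: "W = V ** block_diag k Q1 Q2" and "orth_block k Q1" "orth_block (CARD('n) - k) Q2"
    by (auto simp: coset_def)
  then have B: "block_diag k Q1 Q2 \<in> (orth_group :: 'n rmat set)"
    by (simp add: orth_group_def orthogonal_matrix_block_diag[OF k])
  let ?B = "block_diag k Q1 Q2 :: 'n rmat"
  have "conj_sig k W = V ** (sig_matrix k ** ?B) ** (transpose ?B ** transpose V)"
    unfolding block_diag_commutes[symmetric] by (simp add: conj_sig_def W matrix_transpose_mul matrix_mul_assoc)
  also have "\<dots> = V ** sig_matrix k ** (?B ** (transpose ?B ** transpose V))"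
    by (simp only: matrix_mul_assoc)
  also have "\<dots> = conj_sig k V" by (simp add: orth_group_simps(4)[OF B] conj_sig_def)
  finally show "W \<in> {W \<in> orth_group. conj_sig k W = conj_sig k V}" using orth_group_mult[OF V B] W by simp
next
  fix W assume "W \<in> {W \<in> orth_group. conj_sig k W = conj_sig k V}"
  then have W: "W \<in> orth_group" "conj_sig k W = conj_sig k V" by auto
  \<comment> \<open>\<open>B\<close> is the only candidate with \<open>W = V ** B\<close>; equality
    of the conjugates says that it commutes with \<open>sig_matrix k\<close>.\<close>
  define B where "B = transpose V ** W"
  have B: "B \<in> orth_group" unfolding B_def by (intro orth_group_mult orth_group_transpose V W)
  have "B ** sig_matrix k = transpose V ** conj_sig k W ** W"
    using orth_group_simps(1)[OF W(1)] by (simp add: B_def conj_sig_def flip: matrix_mul_assoc)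
  also have "\<dots> = sig_matrix k ** B"
    unfolding W(2) using orth_group_simps(3)[OF V] by (simp add: B_def conj_sig_def flip: matrix_mul_assoc)
  finally obtain Q1 Q2 where Q: "B = block_diag k Q1 Q2" by (rule commuting_imp_block_diag)
  then have "orth_block k Q1 \<and> orth_block (CARD('n) - k) Q2"
    using B orthogonal_matrix_block_diag[OF k] by (simp add: orth_group_def)
  moreover have "W = V ** B" unfolding B_def by (simp add: orth_group_simps(4)[OF V])
  ultimately show "W \<in> coset k V" unfolding coset_def Q by blast
qed

text \<open>\<open>conj_sig k\<close> is constant on the coset, so \<open>the_elem\<close> in
  \<open>phi1\<close> is applied to a singleton.\<close>

lemma phi1_coset:
  fixes V :: "'n::{finite, linorder} rmat"
  assumes k: "k \<le> CARD('n)" and V: "V \<in> orth_group"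
  shows "phi1 k (coset k V) = conj_sig k V"
proof -
  have "conj_sig k ` coset k V = {conj_sig k V}" using V by (auto simp: coset_eq_fibre[OF k V])
  then show ?thesis by (simp add: phi1_def conj_sig_def)
qed

lemma inj_on_phi1:
  assumes k: "k \<le> CARD('n)"
  shows "inj_on (phi1 k) (coset k ` (orth_group :: 'n::{finite, linorder} rmat set))"
proof (rule inj_onI, elim imageE)
  fix C D and V W :: "'n rmat"
  assume *: "phi1 k C = phi1 k D" "C = coset k V" "V \<in> orth_group" "D = coset k W" "W \<in> orth_group"
  then have "conj_sig k V = conj_sig k W" by (simp add: phi1_coset[OF k])
  then show "C = D" using * by (simp add: coset_eq_fibre[OF k])
qed

text \<open>Taken over all columns, the eigenvalue equations read
  \<open>Q ** V = V ** sig_matrix k\<close>; multiplication by the transpose of \<open>V\<close>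
  solves for \<open>Q\<close>.\<close>

lemma eigenvector_matrix_iff:
  "eigenvector_matrix k Q V \<longleftrightarrow> V \<in> orth_group \<and> conj_sig k V = Q"
proof -
  have "(\<forall>j. Q *v column j V = (if pos j < k then 1 else - 1) *\<^sub>R column j V) \<longleftrightarrow> Q ** V = V ** sig_matrix k"
  proof -
    have "(Q *v column j V) $ i = (Q ** V) $ i $ j" for i j
      by (simp add: matrix_vector_mult_def column_def matrix_matrix_mult_def)
    moreover have "((if pos j < k then 1 else - 1) *\<^sub>R column j V) $ i = (V ** sig_matrix k) $ i $ j" for i j
      by (simp add: matrix_mult_sig_matrix column_def)
    ultimately show ?thesis by (auto simp: vec_eq_iff)
  qed
  moreover have "Q ** V = V ** sig_matrix k \<longleftrightarrow> conj_sig k V = Q" if V: "V \<in> orth_group"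
  proof
    assume "Q ** V = V ** sig_matrix k"
    then show "conj_sig k V = Q" using orth_group_simps(2)[OF V]
      by (metis conj_sig_def matrix_mul_assoc matrix_mul_rid)
  next
    assume "conj_sig k V = Q"
    then show "Q ** V = V ** sig_matrix k" using orth_group_simps(1)[OF V]
      by (metis conj_sig_def matrix_mul_assoc matrix_mul_rid)
  qed
  ultimately show ?thesis by (auto simp: eigenvector_matrix_def)
qed

lemma trace_conj_sig:
  fixes V :: "'n::{finite, linorder} rmat"
  assumes "V \<in> orth_group"
  shows "trace (conj_sig k V) = trace (sig_matrix k :: 'n rmat)"
  unfolding conj_sig_def
  by (subst trace_mul_sym) (simp add: orth_group_simps[OF assms])

lemma conj_sig_in_target_set:
  fixes V :: "'n::{finite, linorder} rmat"
  assumes k: "k \<le> CARD('n)" and V: "V \<in> orth_group"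
  shows "conj_sig k V \<in> target_set k"
proof -
  have "conj_sig k V \<in> orth_group" unfolding conj_sig_def
    by (intro orth_group_mult orth_group_transpose V sig_matrix_orth_group)
  moreover have "transpose (conj_sig k V) = conj_sig k V"
    by (simp add: conj_sig_def matrix_transpose_mul transpose_sig_matrix matrix_mul_assoc)
  ultimately show ?thesis by (simp add: target_set_def trace_conj_sig[OF V] trace_sig_matrix[OF k])
qed

text \<open>As \<open>Q ** Q = mat 1\<close>, each \<open>x\<close> is the sum of
  \<open>(x + Q x) / 2\<close> and \<open>(x - Q x) / 2\<close>, which lie in the eigenspaces for 1
  and -1. Symmetry makes these spaces orthogonal, so orthonormal bases of both combine. Here
  \<open>k\<close> is an outcome, the dimension of the first eigenspace.\<close>

lemma symmetric_orthogonal_diagonalization: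
  fixes Q :: "'n::{finite, linorder} rmat"
  assumes Q: "Q \<in> orth_group" and sym: "transpose Q = Q"
  obtains k V where "k \<le> CARD('n)" "V \<in> orth_group" "conj_sig k V = Q"
proof -
  have QQ: "Q *v (Q *v x) = x" for x
    using orth_group_simps(1)[OF Q] by (simp add: sym matrix_vector_mul_assoc)
  define E where "E = (\<lambda>s::real. {x. Q *v x = s *\<^sub>R x})"
  have E: "subspace (E s)" for s
    unfolding E_def subspace_def
    by (auto simp: matrix_vector_right_distrib scaleR_add_right matrix_vector_mult_scaleR)
  obtain B1 where B1: "B1 \<subseteq> E 1" "pairwise orthogonal B1" "\<And>x. x \<in> B1 \<Longrightarrow> norm x = 1" "independent B1" "span B1 = E 1"
    using orthonormal_basis_subspace[OF E[of 1]] by metis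
  obtain B2 where B2: "B2 \<subseteq> E (- 1)" "pairwise orthogonal B2" "\<And>x. x \<in> B2 \<Longrightarrow> norm x = 1" "independent B2" "span B2 = E (- 1)"
    using orthonormal_basis_subspace[OF E[of "- 1"]] by metis
  have perp: "orthogonal x y" if "x \<in> B1" "y \<in> B2" for x y
  proof -
    have "x \<bullet> y = (Q *v x) \<bullet> y" using that(1) B1(1) by (auto simp: E_def)
    also have "\<dots> = x \<bullet> (Q *v y)" by (metis dot_lmul_matrix sym transpose_matrix_vector)
    also have "\<dots> = - (x \<bullet> y)" using that(2) B2(1) by (auto simp: E_def)
    finally show ?thesis by (simp add: orthogonal_def)
  qed
  have ne0: "0 \<notin> B1 \<union> B2" using B1(3) B2(3) by force
  have orth: "pairwise orthogonal (B1 \<union> B2)"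
    using B1(2) B2(2) perp perp[THEN orthogonal_commute[THEN iffD1]] unfolding pairwise_def by blast
  have indep: "independent (B1 \<union> B2)" by (rule pairwise_orthogonal_independent[OF orth ne0])
  have fin: "finite B1" "finite B2" using B1(4) B2(4) independent_imp_finite by auto
  have disj: "B1 \<inter> B2 = {}"
  proof (rule equals0I)
    fix x assume "x \<in> B1 \<inter> B2"
    then have "x = 0" "x \<in> B1" using perp[of x x] by (simp_all add: orthogonal_self)
    then show False using ne0 by simp
  qed
  have "x \<in> span (B1 \<union> B2)" for x
  proof -
    have "(1/2) *\<^sub>R (x + Q *v x) \<in> E 1" "(1/2) *\<^sub>R (x - Q *v x) \<in> E (- 1)"
      by (auto simp: E_def matrix_vector_mult_scaleR matrix_vector_right_distrib
          matrix_vector_mult_diff_distrib QQ algebra_simps)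
    then have "(1/2) *\<^sub>R (x + Q *v x) + (1/2) *\<^sub>R (x - Q *v x) \<in> span (B1 \<union> B2)"
      using B1(5) B2(5) span_mono[of B1 "B1 \<union> B2"] span_mono[of B2 "B1 \<union> B2"]
      by (intro span_add) auto
    moreover have "(1/2) *\<^sub>R (x + Q *v x) + (1/2) *\<^sub>R (x - Q *v x) = x"
      by (simp add: algebra_simps flip: scaleR_add_left)
    ultimately show ?thesis by simp
  qed
  then have "span (B1 \<union> B2) = UNIV" by auto
  then have "card (B1 \<union> B2) = CARD('n)" using dim_eq_card[OF _ indep, of UNIV] by simp
  then have card: "card B1 + card B2 = CARD('n)" using fin disj by (simp add: card_Un_disjoint)
  define k where "k = card B1"
  have k: "k \<le> CARD('n)" using card k_def by simp
  have c1: "card {i::'n. pos i < k} = card B1" using card_pos_less[OF k] by (simp add: k_def)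
  have "card (UNIV - {i::'n. pos i < k}) = CARD('n) - k" using card_pos_less[OF k] by (subst card_Diff_subset) auto
  then have c2: "card (UNIV - {i::'n. pos i < k}) = card B2" using card k_def by simp
  obtain f1 where f1: "bij_betw f1 {i::'n. pos i < k} B1" using finite_same_card_bij[OF _ fin(1) c1] by auto
  obtain f2 where f2: "bij_betw f2 (UNIV - {i::'n. pos i < k}) B2" using finite_same_card_bij[OF _ fin(2) c2] by auto
  define b where "b j = (if pos j < k then f1 j else f2 j)" for j
  have b1: "b j \<in> B1" if "pos j < k" for j using that f1 by (auto simp: b_def bij_betw_def)
  have b2: "b j \<in> B2" if "\<not> pos j < k" for j using that f2 by (auto simp: b_def bij_betw_def)
  have binj: "b i \<noteq> b j" if "i \<noteq> j" for i j
  proof (cases "pos i < k"; cases "pos j < k")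
    assume "pos i < k" "pos j < k"
    then show ?thesis using that f1 by (auto simp: b_def bij_betw_def inj_on_def)
  next
    assume "\<not> pos i < k" "\<not> pos j < k"
    then show ?thesis using that f2 by (auto simp: b_def bij_betw_def inj_on_def)
  qed (use b1 b2 disj in \<open>metis disjoint_iff\<close>)+
  define V where "V = (\<chi> i j. b j $ i)"
  have col: "column j V = b j" for j by (simp add: V_def column_def vec_eq_iff)
  have bB: "b j \<in> B1 \<union> B2" for j using b1 b2 by blast
  have V: "V \<in> orth_group"
    unfolding orth_group_def orthogonal_matrix_orthonormal_columns mem_Collect_eq col
    using bB B1(3) B2(3) orth binj by (auto simp: pairwise_def)
  have "Q *v b j = (if pos j < k then 1 else - 1) *\<^sub>R b j" for j
    using b1[of j] b2[of j] B1(1) B2(1) by (auto simp: E_def)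
  then have "eigenvector_matrix k Q V" using V by (simp add: eigenvector_matrix_def col)
  then have "conj_sig k V = Q" by (simp add: eigenvector_matrix_iff)
  with k V show ?thesis by (rule that)
qed

lemma target_set_eq:
  assumes k: "k \<le> CARD('n)"
  shows "target_set k = conj_sig k ` (orth_group :: 'n::{finite, linorder} rmat set)"
proof
  show "conj_sig k ` (orth_group :: 'n rmat set) \<subseteq> target_set k" using conj_sig_in_target_set[OF k] by auto
  show "target_set k \<subseteq> conj_sig k ` (orth_group :: 'n rmat set)"
  proof
    fix Q :: "'n rmat" assume "Q \<in> target_set k"
    then have Q: "Q \<in> orth_group" "transpose Q = Q" and tr: "trace Q = 2 * real k - real CARD('n)"
      by (auto simp: target_set_def)
    obtain m V where V: "m \<le> CARD('n)" "V \<in> orth_group" "conj_sig m V = Q"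
      using symmetric_orthogonal_diagonalization[OF Q] .
    have "trace Q = 2 * real m - real CARD('n)"
      using trace_conj_sig[OF V(2), of m] V(3) trace_sig_matrix[OF V(1)] by simp
    then have "m = k" using tr by simp
    then show "Q \<in> conj_sig k ` orth_group" using V by blast
  qed
qed

section \<open>Smooth operations on matrices\<close>

lemma matrix_mult_scaleR_left: "(c *\<^sub>R A) ** B = c *\<^sub>R (A ** B :: real^'p^'m)"
  by (simp add: matrix_matrix_mult_def vec_eq_iff sum_distrib_left mult.assoc)

lemma matrix_mult_scaleR_right: "A ** (c *\<^sub>R B) = c *\<^sub>R (A ** B :: real^'p^'m)"
  by (simp add: matrix_matrix_mult_def vec_eq_iff sum_distrib_left mult.left_commute)

lemma matrix_mult_minus_left: "(- A) ** B = - (A ** B :: real^'p^'m)"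
  using matrix_mult_scaleR_left[of "- 1" A B] by simp

lemma matrix_mult_minus_right: "A ** (- B) = - (A ** B :: real^'p^'m)"
  using matrix_mult_scaleR_right[of A "- 1" B] by simp

lemma matrix_add_rdistrib: "(A + B) ** C = A ** C + (B ** C :: real^'p^'m)"
  by (simp add: matrix_matrix_mult_def vec_eq_iff sum.distrib distrib_right)

lemma matrix_diff_ldistrib: "A ** (B - C) = A ** B - (A ** C :: real^'p^'m)"
  using matrix_add_ldistrib[of A B "- C"] by (simp add: matrix_mult_minus_right)

lemma matrix_diff_rdistrib: "(A - B) ** C = A ** C - (B ** C :: real^'p^'m)"
  using matrix_add_rdistrib[of A "- B" C] by (simp add: matrix_mult_minus_left)

lemmas matrix_ring_simps = matrix_add_ldistrib matrix_add_rdistrib matrix_diff_ldistrib matrix_diff_rdistrib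
  matrix_mult_scaleR_left matrix_mult_scaleR_right matrix_mult_minus_left matrix_mult_minus_right

lemma transpose_linear_simps:
  "transpose (A + B) = transpose A + transpose (B :: real^'n^'m)"
  "transpose (A - B) = transpose A - transpose (B :: real^'n^'m)"
  "transpose (- A) = - transpose (A :: real^'n^'m)"
  "transpose (c *\<^sub>R A) = c *\<^sub>R transpose (A :: real^'n^'m)"
  by (simp_all add: transpose_def vec_eq_iff)

lemma linear_transpose: "linear (transpose :: real^'n^'m \<Rightarrow> real^'m^'n)"
  by (rule linearI) (simp_all add: transpose_linear_simps)

lemma bounded_bilinear_matrix_mult:
  "bounded_bilinear ((**) :: real^'n^'m \<Rightarrow> real^'p^'n \<Rightarrow> real^'p^'m)"
  unfolding bilinear_conv_bounded_bilinear[symmetric] bilinear_def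
  by (auto intro!: linearI simp: matrix_ring_simps)

lemma Cinf_on_matrix_mult:
  fixes f :: "'a::euclidean_space \<Rightarrow> real^'n^'m" and g :: "'a \<Rightarrow> real^'p^'n"
  shows "Cinf_on f U \<Longrightarrow> Cinf_on g U \<Longrightarrow> Cinf_on (\<lambda>x. f x ** g x) U"
  by (rule Cinf_on_bilinear[OF bounded_bilinear_matrix_mult])

lemma Cinf_on_transpose:
  fixes f :: "'a::euclidean_space \<Rightarrow> real^'n^'m"
  shows "Cinf_on f U \<Longrightarrow> Cinf_on (\<lambda>x. transpose (f x)) U"
  by (rule Cinf_on_compose_linear[OF linear_transpose])

section \<open>Smoothness of matrix inversion\<close>

lemma open_invertible: "open {A :: real^'n^'n. invertible A}"
proof -
  have "continuous_on UNIV (det :: real^'n^'n \<Rightarrow> real)"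
    unfolding det_def by (intro continuous_intros)
  then have "open (det -` (- {0}) :: (real^'n^'n) set)" by (intro open_vimage) auto
  then show ?thesis by (simp add: invertible_det_nz vimage_def)
qed

lemma matrix_inv_mult:
  assumes "invertible (A :: real^'n^'n)"
  shows "A ** matrix_inv A = mat 1" "matrix_inv A ** A = mat 1"
  using assms someI_ex[of "\<lambda>A'. A ** A' = mat 1 \<and> A' ** A = mat 1"]
  unfolding invertible_def matrix_inv_def by auto

lemma matrix_inv_unique:
  assumes "A ** B = mat 1"
  shows "invertible (A :: real^'n^'n)" "matrix_inv A = B"
proof -
  show i: "invertible A" using assms matrix_left_right_inverse unfolding invertible_def by blast
  have "matrix_inv A = matrix_inv A ** (A ** B)" by (simp add: assms)
  also have "\<dots> = B" by (simp only: matrix_mul_assoc matrix_inv_mult[OF i] matrix_mul_lid)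
  finally show "matrix_inv A = B" .
qed

lemma transpose_matrix_inv:
  assumes "invertible (A :: real^'n^'n)"
  shows "invertible (transpose A)" "matrix_inv (transpose A) = transpose (matrix_inv A)"
proof -
  have "transpose A ** transpose (matrix_inv A) = mat 1"
    by (simp add: matrix_inv_mult[OF assms] flip: matrix_transpose_mul)
  then show "invertible (transpose A)" "matrix_inv (transpose A) = transpose (matrix_inv A)"
    by (rule matrix_inv_unique)+
qed

text \<open>The inverse is the solution \<open>B\<close> of the linear equation
  \<open>A ** B = mat 1\<close>, whose coefficients depend linearly on \<open>A\<close>, so the
  result on linear equations applies and no cofactor formula is differentiated.\<close>

lemma Cinf_on_matrix_inv: "Cinf_on (matrix_inv :: real^'n^'n \<Rightarrow> _) {A. invertible A}"
proof -
  have "Ck_on m (matrix_inv :: real^'n^'n \<Rightarrow> _) {A. invertible A}" for m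
  proof (rule Ck_on_linear_solve[where A="(**)" and u="\<lambda>A. mat 1"])
    show "open {A :: real^'n^'n. invertible A}" by (rule open_invertible)
    show "linear ((**) A)" for A :: "real^'n^'n" by (rule linearI) (simp_all add: matrix_ring_simps)
    show "inj ((**) A :: real^'n^'n \<Rightarrow> _)" if "A \<in> {A. invertible A}" for A :: "real^'n^'n"
    proof (rule injI)
      fix B C :: "real^'n^'n" assume "A ** B = A ** C"
      then have "matrix_inv A ** A ** B = matrix_inv A ** A ** C" by (simp flip: matrix_mul_assoc)
      then show "B = C" using that by (simp add: matrix_inv_mult)
    qed
    show "Ck_on m (\<lambda>A :: real^'n^'n. A ** W) {A. invertible A}" for W :: "real^'n^'n"
      by (intro Cinf_onD(2) Cinf_on_matrix_mult Cinf_on_ident Cinf_on_const open_invertible)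
  qed (auto simp: matrix_inv_mult intro: Ck_on_const open_invertible)
  then show ?thesis by (simp add: Cinf_on_def open_invertible)
qed

lemma Cinf_on_matrix_inv_compose:
  fixes f :: "'a::euclidean_space \<Rightarrow> real^'n^'n"
  assumes "Cinf_on f U"
  shows "Cinf_on (\<lambda>x. matrix_inv (f x)) (U \<inter> {x. invertible (f x)})"
  using Cinf_on_compose[OF Cinf_on_matrix_inv assms] by (simp add: vimage_def)

lemma open_invertible_preimage:
  fixes f :: "'a::euclidean_space \<Rightarrow> real^'n^'n"
  assumes "Cinf_on f U"
  shows "open (U \<inter> {x. invertible (f x)})"
  using Cinf_onD(1)[OF Cinf_on_matrix_inv_compose[OF assms]] .

lemma smooth_on_conj_sig: "smooth_on W (conj_sig k)"
proof -
  have "Cinf_on (conj_sig k) UNIV" unfolding conj_sig_def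
    by (intro Cinf_on_matrix_mult Cinf_on_transpose Cinf_on_ident Cinf_on_const open_UNIV)
  then show ?thesis by (rule Cinf_imp_smooth_on) simp
qed

section \<open>Local sections\<close>

text \<open>Squaring has derivative \<open>2 h\<close> at the identity, so half the square has
  derivative \<open>h\<close> and the inverse function theorem applies; the argument is halved
  before the local inverse is taken. The last property is the local uniqueness of the root, valid
  for roots in \<open>N\<close>.\<close>

lemma local_matrix_square_root:
  obtains N V :: "(real^'n^'n) set" and r where "open N" "mat 1 \<in> N" "mat 1 \<in> V" "Cinf_on r V"
    "r (mat 1) = mat 1" "\<And>X. X \<in> V \<Longrightarrow> r X \<in> N \<and> r X ** r X = X" "\<And>A. A \<in> N \<Longrightarrow> r (A ** A) = A"
proof -
  define f where "f A = (1/2) *\<^sub>R (A ** A)" for A :: "real^'n^'n"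
  have f: "Cinf_on f UNIV" unfolding f_def
    by (intro Cinf_on_compose_linear[OF linear_scale_self] Cinf_on_matrix_mult Cinf_on_ident open_UNIV)
  have "(f has_derivative (\<lambda>h. (1/2) *\<^sub>R (mat 1 ** h + h ** mat 1))) (at (mat 1))"
    unfolding f_def by (intro has_derivative_scaleR_right bounded_bilinear.FDERIV[OF bounded_bilinear_matrix_mult] has_derivative_ident)
  moreover have "(1/2) *\<^sub>R (mat 1 ** h + h ** mat 1) = h" for h :: "real^'n^'n"
    by (simp flip: scaleR_2)
  ultimately have f': "(f has_derivative (\<lambda>h. h)) (at (mat 1))" by simp
  obtain N V r where r: "open N" "mat 1 \<in> N" "f (mat 1) \<in> V" "homeomorphism N V f r" "Cinf_on r V"
    using smooth_inverse_function[OF f UNIV_I f'] by metis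
  let ?h = "\<lambda>X :: real^'n^'n. (1/2) *\<^sub>R X"
  have sm: "Cinf_on (\<lambda>X. r (?h X)) (?h -` V)"
    using Cinf_on_compose[OF r(5) Cinf_on_linear[OF open_UNIV linear_scale_self]] by simp
  show ?thesis
  proof (rule that[OF r(1,2) _ sm])
    show "mat 1 \<in> ?h -` V" using r(3) by (simp add: f_def)
    show *: "r (?h (A ** A)) = A" if "A \<in> N" for A using homeomorphism_apply1[OF r(4) that] by (simp add: f_def)
    show "r (?h (mat 1)) = mat 1" using *[OF r(2)] by simp
    show "r (?h X) \<in> N \<and> r (?h X) ** r (?h X) = X" if "X \<in> ?h -` V" for X
    proof -
      have "f (r (?h X)) = ?h X" using homeomorphism_apply2[OF r(4)] that by simp
      moreover have "r (?h X) \<in> N" using homeomorphism_image2[OF r(4)] that by auto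
      ultimately show ?thesis by (simp add: f_def)
    qed
  qed
qed

text \<open>For symmetric involutions \<open>Q\<close>, \<open>Q\<^sub>0\<close> the matrix \<open>A = (1 + Q Q\<^sub>0) / 2\<close> satisfies
  \<open>Q A = A Q\<^sub>0\<close>.  The orthogonal polar factor \<open>A R\<^sup>-\<^sup>1\<close>, where \<open>R\<close> is the square root of
  \<open>A\<^sup>T A\<close> near \<open>1\<close>, inherits this relation: local uniqueness of the root makes \<open>R\<close>
  symmetric and forces it to commute with \<open>Q\<^sub>0\<close>.\<close>

lemma conj_sig_local_section:
  fixes V0 :: "'n::{finite, linorder} rmat"
  assumes k: "k \<le> CARD('n)" and V0: "V0 \<in> orth_group"
  obtains U \<sigma> where "open U" "conj_sig k V0 \<in> U" "smooth_on (U \<inter> target_set k) \<sigma>"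
    "\<sigma> ` (U \<inter> target_set k) \<subseteq> orth_group" "\<sigma> (conj_sig k V0) = V0"
    "\<And>Q. Q \<in> U \<inter> target_set k \<Longrightarrow> conj_sig k (\<sigma> Q) = Q"
proof -
  define Q0 where "Q0 = conj_sig k V0"
  have involution: "transpose Q = Q" "Q ** Q = mat 1" "Q ** (Q ** A) = A" if "Q \<in> target_set k" for Q A :: "'n rmat"
    using that orth_group_simps(1,3)[of Q] by (auto simp: target_set_def)
  have Q0: "Q0 \<in> target_set k" unfolding Q0_def by (rule conj_sig_in_target_set[OF k V0])
  obtain N V :: "('n rmat) set" and r where r: "open N" "mat 1 \<in> N" "mat 1 \<in> V" "Cinf_on r V"
    "r (mat 1) = mat 1" "\<And>X. X \<in> V \<Longrightarrow> r X \<in> N \<and> r X ** r X = X" "\<And>A. A \<in> N \<Longrightarrow> r (A ** A) = A"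
    by (rule local_matrix_square_root) blast
  define a where "a Q = (1/2) *\<^sub>R (mat 1 + Q ** Q0)" for Q
  define b where "b Q = transpose (a Q) ** a Q" for Q
  define R where "R Q = r (b Q)" for Q
  have a: "Cinf_on a UNIV" unfolding a_def
    by (intro Cinf_on_compose_linear[OF linear_scale_self] Cinf_on_add Cinf_on_matrix_mult
        Cinf_on_const Cinf_on_ident open_UNIV)
  then have b: "Cinf_on b UNIV" unfolding b_def by (intro Cinf_on_matrix_mult Cinf_on_transpose)
  have R: "Cinf_on R (b -` V)" unfolding R_def using Cinf_on_compose[OF r(4) b] by simp
  \<comment> \<open>Besides existence and invertibility of the root, the last two conditions keep
    its transpose and its conjugate by \<open>Q0\<close> inside \<open>N\<close>, where roots are
    unique. All of them hold at \<open>Q0\<close>, where \<open>R\<close> is the identity.\<close>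
  define U where "U = (b -` V \<inter> {Q. invertible (R Q)}) \<inter>
     ((b -` V \<inter> (\<lambda>Q. transpose (R Q)) -` N) \<inter> (b -` V \<inter> (\<lambda>Q. Q0 ** R Q ** Q0) -` N))"
  define \<sigma> where "\<sigma> Q = a Q ** matrix_inv (R Q) ** V0" for Q
  have opb: "open (b -` V)" by (rule Cinf_onD(1)[OF R])
  have opN: "open (b -` V \<inter> f -` N)" if "Cinf_on f (b -` V)" for f :: "'n rmat \<Rightarrow> 'n rmat"
    by (rule continuous_open_preimage[OF Cinf_on_continuous[OF that] opb r(1)])
  have U: "open U" unfolding U_def
    by (intro open_Int[OF open_invertible_preimage[OF R]] open_Int opN Cinf_on_matrix_mult
        Cinf_on_transpose Cinf_on_const R opb)
  have aQ0: "a Q0 = mat 1" unfolding a_def involution(2)[OF Q0] by (simp flip: scaleR_2)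
  have RQ0: "b Q0 = mat 1" "R Q0 = mat 1" by (simp_all add: R_def b_def aQ0 r(5))
  have one: "invertible (mat 1 :: 'n rmat)" "matrix_inv (mat 1 :: 'n rmat) = mat 1"
    by (rule matrix_inv_unique[of "mat 1" "mat 1"], simp)+
  have "Q0 \<in> U" using r(2,3) one by (simp add: U_def RQ0 involution(2)[OF Q0])
  moreover have "smooth_on (U \<inter> target_set k) \<sigma>"
  proof (rule Cinf_imp_smooth_on)
    show "Cinf_on \<sigma> (b -` V \<inter> {Q. invertible (R Q)})" unfolding \<sigma>_def
      by (intro Cinf_on_matrix_mult Cinf_on_matrix_inv_compose[OF R] Cinf_on_const
          Cinf_on_subset[OF a] open_invertible_preimage[OF R]) auto
  qed (auto simp: U_def)
  moreover have main: "\<sigma> Q \<in> orth_group \<and> conj_sig k (\<sigma> Q) = Q" if "Q \<in> U \<inter> target_set k" for Q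
  proof -
    from that have Q: "Q \<in> target_set k" and inv: "invertible (R Q)" and bV: "b Q \<in> V"
      and RtN: "transpose (R Q) \<in> N" and RcN: "Q0 ** R Q ** Q0 \<in> N" by (auto simp: U_def)
    have RR: "R Q ** R Q = b Q" unfolding R_def using r(6)[OF bV] by simp
    \<comment> \<open>Both sides equal \<open>(Q + Q0) / 2\<close>.\<close>
    have Qa: "Q ** a Q = a Q ** Q0"
      by (simp add: a_def matrix_ring_simps involution[OF Q] involution[OF Q0] add.commute flip: matrix_mul_assoc)
    have ta: "transpose (a Q) = (1/2) *\<^sub>R (mat 1 + Q0 ** Q)"
      by (simp add: a_def transpose_linear_simps matrix_transpose_mul involution(1)[OF Q] involution(1)[OF Q0])
    have tb: "transpose (b Q) = b Q" by (simp add: b_def matrix_transpose_mul)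
    \<comment> \<open>\<open>b Q\<close> is \<open>(2 + Q Q0 + Q0 Q) / 4\<close>, and conjugation by
      \<open>Q0\<close> merely exchanges the last two products.\<close>
    have cb: "Q0 ** b Q ** Q0 = b Q"
      unfolding b_def ta unfolding a_def
      by (simp add: matrix_ring_simps involution[OF Q] involution[OF Q0] add_ac flip: matrix_mul_assoc)
    have "transpose (R Q) ** transpose (R Q) = b Q" using RR tb by (metis matrix_transpose_mul)
    then have tR: "transpose (R Q) = R Q" using r(7)[OF RtN] by (simp add: R_def)
    have "(Q0 ** R Q ** Q0) ** (Q0 ** R Q ** Q0) = Q0 ** (R Q ** R Q) ** Q0"
      by (simp add: involution[OF Q0] flip: matrix_mul_assoc)
    then have "Q0 ** R Q ** Q0 = R Q" using r(7)[OF RcN] cb RR by (simp add: R_def)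
    then have cR: "R Q ** Q0 = Q0 ** R Q" using involution[OF Q0] by (metis matrix_mul_assoc)
    define I where "I = matrix_inv (R Q)"
    have I: "R Q ** I = mat 1" "I ** R Q = mat 1" using matrix_inv_mult[OF inv] by (auto simp: I_def)
    have tI: "transpose I = I" unfolding I_def using transpose_matrix_inv(2)[OF inv] tR by simp
    have cI: "I ** Q0 = Q0 ** I"
    proof -
      have "I ** Q0 = I ** (Q0 ** R Q) ** I" using I(1) by (simp flip: matrix_mul_assoc)
      also have "\<dots> = Q0 ** I" using I(2) by (simp add: cR[symmetric] matrix_mul_assoc)
      finally show ?thesis .
    qed
    define u where "u = a Q ** I"
    have "transpose u ** u = I ** b Q ** I" by (simp add: u_def b_def matrix_transpose_mul tI matrix_mul_assoc)
    also have "\<dots> = (I ** R Q) ** (R Q ** I)" by (simp add: RR[symmetric] matrix_mul_assoc)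
    finally have u: "u \<in> orth_group" by (simp add: I orth_group_def orthogonal_matrix)
    have "u ** Q0 = Q ** u" by (simp add: u_def cI matrix_mul_assoc Qa) (simp add: cI flip: matrix_mul_assoc)
    then have uQ: "u ** Q0 ** transpose u = Q" using orth_group_simps(2)[OF u] by (simp flip: matrix_mul_assoc)
    have "\<sigma> Q = u ** V0" by (simp add: \<sigma>_def u_def I_def)
    then show ?thesis
      using orth_group_mult[OF u V0] uQ by (simp add: Q0_def conj_sig_def matrix_transpose_mul matrix_mul_assoc)
  qed
  moreover have "\<sigma> Q0 = V0" by (simp add: \<sigma>_def aQ0 RQ0 one)
  ultimately show ?thesis using that[OF U, of \<sigma>] unfolding Q0_def by blast
qed

section \<open>Cayley charts\<close>

lemma submanifold_of_euclideanI:
  fixes D :: "'i \<Rightarrow> 'a::euclidean_space set" and \<psi> :: "'i \<Rightarrow> 'a \<Rightarrow> 'e::euclidean_space"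
  assumes E: "subspace E" and cov: "(\<Union>i\<in>I. D i) = S"
    and op: "\<And>i. i \<in> I \<Longrightarrow> openin (top_of_set S) (D i)"
    and \<psi>: "\<And>i. i \<in> I \<Longrightarrow> smooth_on (D i) (\<psi> i)" "\<And>i. i \<in> I \<Longrightarrow> \<psi> i ` D i = E"
    and \<theta>: "\<And>i. i \<in> I \<Longrightarrow> smooth_on E (\<theta> i)" "\<And>i p. i \<in> I \<Longrightarrow> p \<in> D i \<Longrightarrow> \<theta> i (\<psi> i p) = p"
  shows "submanifold_of_euclidean S \<lparr>mtop = top_of_set S, model = E, atlas = (\<lambda>i. (D i, \<psi> i)) ` I\<rparr>"
proof -
  have "inj_on (\<psi> i) (D i)" if "i \<in> I" for i using \<theta>(2)[OF that] by (rule inj_on_inverseI)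
  moreover have "smooth_on E (inv_into (D i) (\<psi> i))" if i: "i \<in> I" for i
  proof (rule smooth_on_cong[OF \<theta>(1)[OF i]])
    fix x assume "x \<in> E"
    then obtain p where "p \<in> D i" "x = \<psi> i p" using \<psi>(2)[OF i] by blast
    then show "\<theta> i x = inv_into (D i) (\<psi> i) x"
      using \<theta>(2)[OF i] inv_into_f_f[OF \<open>i \<in> I \<Longrightarrow> inj_on (\<psi> i) (D i)\<close>[OF i]] by simp
  qed
  ultimately show ?thesis
    unfolding submanifold_of_euclidean_def using E cov op \<psi> by auto
qed

text \<open>This is \<open>(U - 1) (U + 1)^-1\<close> rewritten so that \<open>U\<close> occurs only
  once; \<open>inv_cayley\<close> is \<open>(1 + X) (1 - X)^-1\<close> in the same form. Each is
  inverted by solving for its single matrix inverse.\<close>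

definition cayley :: "real^'n^'n \<Rightarrow> real^'n^'n" where
  "cayley U = mat 1 - 2 *\<^sub>R matrix_inv (U + mat 1)"

definition inv_cayley :: "real^'n^'n \<Rightarrow> real^'n^'n" where
  "inv_cayley X = 2 *\<^sub>R matrix_inv (mat 1 - X) - mat 1"

lemma invertible_scaleR2:
  assumes "invertible (A :: real^'n^'n)"
  shows "invertible (2 *\<^sub>R A)" "matrix_inv (2 *\<^sub>R A) = (1/2) *\<^sub>R matrix_inv A"
proof -
  have "(2 *\<^sub>R A) ** ((1/2) *\<^sub>R matrix_inv A) = mat 1"
    by (simp add: matrix_ring_simps matrix_inv_mult[OF assms])
  then show "invertible (2 *\<^sub>R A)" "matrix_inv (2 *\<^sub>R A) = (1/2) *\<^sub>R matrix_inv A"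
    by (rule matrix_inv_unique)+
qed

lemma invertible_matrix_inv:
  assumes "invertible (A :: real^'n^'n)"
  shows "invertible (matrix_inv A)" "matrix_inv (matrix_inv A) = A"
  using matrix_inv_unique[OF matrix_inv_mult(2)[OF assms]] .

lemma inv_cayley_cayley: "invertible (U + mat 1) \<Longrightarrow> inv_cayley (cayley U) = U"
  by (simp add: cayley_def inv_cayley_def invertible_scaleR2 invertible_matrix_inv)

lemma cayley_inv_cayley:
  assumes "invertible (mat 1 - X)"
  shows "invertible (inv_cayley X + mat 1)" "cayley (inv_cayley X) = X"
  using assms by (simp_all add: cayley_def inv_cayley_def invertible_scaleR2 invertible_matrix_inv)

text \<open>If \<open>X v = v\<close> and \<open>X\<close> is skew, then
  \<open>v \<bullet> v = - (v \<bullet> v)\<close>, so the kernel is trivial.\<close>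

lemma invertible_one_minus_skew:
  fixes X :: "real^'n^'n"
  assumes "transpose X = - X"
  shows "invertible (mat 1 - X)"
proof -
  have "v = 0" if "(mat 1 - X) *v v = 0" for v
  proof -
    have v: "X *v v = v" using that by (simp add: matrix_vector_mult_diff_rdistrib)
    have "v \<bullet> v = (transpose X *v v) \<bullet> v" using v by (metis dot_lmul_matrix transpose_matrix_vector)
    also have "transpose X *v v = - v"
      using matrix_vector_mult_diff_rdistrib[of 0 X v] v by (simp only: assms) simp
    finally show ?thesis by simp
  qed
  then show ?thesis using matrix_left_invertible_ker[of "mat 1 - X"] invertible_left_inverse by blast
qed

text \<open>With \<open>W\<close> the inverse of \<open>U + 1\<close>, orthogonality gives
  \<open>W^T = W U = 1 - W\<close>, so transposing \<open>1 - 2 W\<close> changes its sign.\<close>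

lemma cayley_skew:
  fixes U :: "real^'n^'n"
  assumes U: "U \<in> orth_group" and inv: "invertible (U + mat 1)"
  shows "transpose (cayley U) = - cayley U"
proof -
  let ?W = "matrix_inv (U + mat 1)"
  have "(transpose U + mat 1) ** (?W ** U) = transpose U ** ((U + mat 1) ** ?W) ** U"
    using orth_group_simps(1)[OF U]
    by (simp only: matrix_ring_simps matrix_mul_assoc matrix_mul_lid matrix_mul_rid) (simp add: add.commute)
  also have "\<dots> = mat 1" by (simp add: matrix_inv_mult[OF inv] orth_group_simps(1)[OF U])
  finally have "matrix_inv (transpose U + mat 1) = ?W ** U" by (rule matrix_inv_unique(2))
  then have tW: "transpose ?W = ?W ** U"
    using transpose_matrix_inv(2)[OF inv] by (simp add: transpose_linear_simps)
  have "?W ** (U + mat 1) = mat 1" by (rule matrix_inv_mult(2)[OF inv])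
  then have "?W ** U = mat 1 - ?W" by (simp add: matrix_ring_simps eq_diff_eq)
  then show ?thesis
    by (simp add: cayley_def transpose_linear_simps tW scaleR_diff_right) (simp add: scaleR_2)
qed

text \<open>With \<open>Y\<close> the inverse of \<open>1 - X\<close>, inserting
  \<open>(1 - X) + (1 + X) = 2\<close> between \<open>Y^T\<close> and \<open>Y\<close> yields
  \<open>Y^T + Y = 2 Y^T Y\<close>. The quadratic and linear terms of
  \<open>(2 Y - 1)^T (2 Y - 1)\<close> then cancel.\<close>

lemma inv_cayley_orthogonal:
  fixes X :: "real^'n^'n"
  assumes X: "transpose X = - X"
  shows "inv_cayley X \<in> orth_group"
proof -
  let ?Y = "matrix_inv (mat 1 - X)"
  have inv: "invertible (mat 1 - X)" by (rule invertible_one_minus_skew[OF X])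
  have tY: "transpose ?Y ** (mat 1 + X) = mat 1"
    using matrix_inv_mult(2)[OF transpose_matrix_inv(1)[OF inv]] transpose_matrix_inv(2)[OF inv]
    by (simp add: transpose_linear_simps X)
  have "transpose ?Y + ?Y = transpose ?Y ** ((mat 1 - X) + (mat 1 + X)) ** ?Y"
    using matrix_inv_mult(1)[OF inv] tY
    by (simp only: matrix_add_ldistrib matrix_add_rdistrib flip: matrix_mul_assoc)
      (simp add: matrix_mul_assoc)
  also have "(mat 1 - X) + (mat 1 + X) = 2 *\<^sub>R mat 1" by (simp add: scaleR_2)
  finally have *: "transpose ?Y + ?Y = 2 *\<^sub>R (transpose ?Y ** ?Y)"
    by (simp add: matrix_ring_simps)
  have "transpose (inv_cayley X) ** inv_cayley X =
      2 *\<^sub>R (2 *\<^sub>R (transpose ?Y ** ?Y)) - 2 *\<^sub>R (transpose ?Y + ?Y) + mat 1"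
    by (simp add: inv_cayley_def transpose_linear_simps matrix_ring_simps algebra_simps)
  then show ?thesis by (simp add: * orth_group_def orthogonal_matrix)
qed

lemma Cinf_on_cayley: "Cinf_on cayley {U :: real^'n^'n. invertible (U + mat 1)}"
proof -
  have "Cinf_on (\<lambda>U. U + mat 1 :: real^'n^'n) UNIV"
    by (intro Cinf_on_add Cinf_on_ident Cinf_on_const open_UNIV)
  from Cinf_on_matrix_inv_compose[OF this] show ?thesis unfolding cayley_def
    by (intro Cinf_on_diff Cinf_on_compose_linear[OF linear_scale_self] Cinf_on_const)
      (auto dest: Cinf_onD(1))
qed

lemma smooth_on_inv_cayley:
  assumes "\<And>X. X \<in> W \<Longrightarrow> transpose X = - (X :: real^'n^'n)"
  shows "smooth_on W inv_cayley"
proof (rule Cinf_imp_smooth_on)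
  have "Cinf_on (\<lambda>X. mat 1 - X :: real^'n^'n) UNIV"
    by (intro Cinf_on_diff Cinf_on_ident Cinf_on_const open_UNIV)
  from Cinf_on_matrix_inv_compose[OF this]
  show "Cinf_on inv_cayley {X :: real^'n^'n. invertible (mat 1 - X)}" unfolding inv_cayley_def
    by (intro Cinf_on_diff Cinf_on_compose_linear[OF linear_scale_self] Cinf_on_const)
      (auto dest: Cinf_onD(1))
  show "W \<subseteq> {X. invertible (mat 1 - X)}" using invertible_one_minus_skew assms by auto
qed

text \<open>\<open>L i\<close> is a linear translation that moves the centre of a chart to the
  identity, whose Cayley transform is 0. Each chart has all of \<open>E\<close> as its image,
  because \<open>1 - X\<close> is invertible for every skew \<open>X\<close>. Common frame for both
  sets of matrices.\<close>

lemma submanifold_of_cayley_charts: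
  fixes L L' :: "'i \<Rightarrow> real^'n^'n \<Rightarrow> real^'n^'n"
  assumes E: "subspace E" "\<And>X. X \<in> E \<Longrightarrow> transpose X = - X"
    and L: "\<And>i. i \<in> I \<Longrightarrow> linear (L i)" "\<And>i. i \<in> I \<Longrightarrow> linear (L' i)"
    and inv: "\<And>i A. i \<in> I \<Longrightarrow> L' i (L i A) = A" "\<And>i A. i \<in> I \<Longrightarrow> L i (L' i A) = A"
    and into: "\<And>i p. i \<in> I \<Longrightarrow> p \<in> S \<Longrightarrow> invertible (L i p + mat 1) \<Longrightarrow> cayley (L i p) \<in> E"
    and onto: "\<And>i X. i \<in> I \<Longrightarrow> X \<in> E \<Longrightarrow> L' i (inv_cayley X) \<in> S"
    and cov: "\<And>p. p \<in> S \<Longrightarrow> \<exists>i\<in>I. L i p = mat 1"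
  obtains M :: "(real^'n^'n, real^'n^'n) manifold" where "submanifold_of_euclidean S M"
proof -
  define D where "D i = {p \<in> S. invertible (L i p + mat 1)}" for i
  have sm: "Cinf_on (\<lambda>p. cayley (L i p)) {p. invertible (L i p + mat 1)}" if "i \<in> I" for i
    using Cinf_on_compose[OF Cinf_on_cayley Cinf_on_linear[OF open_UNIV L(1)[OF that]]]
    by (simp add: vimage_def)
  have "submanifold_of_euclidean S
      \<lparr>mtop = top_of_set S, model = E, atlas = (\<lambda>i. (D i, \<lambda>p. cayley (L i p))) ` I\<rparr>"
  proof (rule submanifold_of_euclideanI[where \<theta>="\<lambda>i X. L' i (inv_cayley X)"])
    show "subspace E" by (rule E)
    \<comment> \<open>A centre is moved to \<open>mat 1\<close>, and \<open>mat 1 + mat 1\<close> is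
      invertible, so every centre lies in the domain of its own chart.\<close>
    have "invertible (mat 1 + mat 1 :: real^'n^'n)"
      using invertible_scaleR2(1)[OF matrix_inv_unique(1)[of "mat 1 :: real^'n^'n" "mat 1"]]
      by (simp add: scaleR_2)
    then show "(\<Union>i\<in>I. D i) = S" using cov by (fastforce simp: D_def)
    fix i assume i: "i \<in> I"
    show "openin (top_of_set S) (D i)"
      using Cinf_onD(1)[OF sm[OF i]] by (auto simp: D_def openin_open)
    show "smooth_on (D i) (\<lambda>p. cayley (L i p))"
      by (rule Cinf_imp_smooth_on[OF sm[OF i]]) (auto simp: D_def)
    show "smooth_on E (\<lambda>X. L' i (inv_cayley X))"
    proof -
      have "smooth_on UNIV (L' i)" by (rule Cinf_imp_smooth_on[OF Cinf_on_linear[OF open_UNIV L(2)[OF i]]]) simp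
      moreover have "smooth_on E inv_cayley" by (rule smooth_on_inv_cayley[OF E(2)])
      ultimately show ?thesis using smooth_on_compose[of UNIV "L' i" E inv_cayley] by (simp add: o_def)
    qed
    show "L' i (inv_cayley (cayley (L i p))) = p" if "p \<in> D i" for p
      using that by (simp add: D_def inv_cayley_cayley inv(1)[OF i])
    show "(\<lambda>p. cayley (L i p)) ` D i = E"
    proof
      show "(\<lambda>p. cayley (L i p)) ` D i \<subseteq> E" using into[OF i] by (auto simp: D_def)
      show "E \<subseteq> (\<lambda>p. cayley (L i p)) ` D i"
      proof
        fix X assume X: "X \<in> E"
        note c = cayley_inv_cayley[OF invertible_one_minus_skew[OF E(2)[OF X]]]
        show "X \<in> (\<lambda>p. cayley (L i p)) ` D i"
          by (rule image_eqI[where x="L' i (inv_cayley X)"]) (use c onto[OF i X] in \<open>auto simp: D_def inv(2)[OF i]\<close>)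
      qed
    qed
  qed
  then show ?thesis by (rule that)
qed

section \<open>Charts of the orthogonal group and of the target set\<close>

lemma linear_matrix_mult_both: "linear (\<lambda>A :: real^'n^'n. B ** A ** C)"
  by (rule linearI) (simp_all add: matrix_ring_simps)

text \<open>The chart at \<open>V\<close> is the transform of \<open>V^T A\<close>, with the skew
  matrices as model. The factor \<open>mat 1\<close> brings the maps into the shape of
  \<open>linear_matrix_mult_both\<close>.\<close>

lemma orth_group_manifold:
  obtains G :: "('n::finite rmat, 'n rmat) manifold" where "submanifold_of_euclidean orth_group G"
proof (rule submanifold_of_cayley_charts[where I="orth_group :: 'n rmat set" and E="{X. transpose X = - X}"
      and L="\<lambda>V A. transpose V ** A ** mat 1" and L'="\<lambda>V A. V ** A ** mat 1" and S="orth_group :: 'n rmat set"])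
  show "subspace {X :: 'n rmat. transpose X = - X}"
    unfolding subspace_def by (simp add: transpose_linear_simps) (simp add: transpose_def vec_eq_iff)
  fix V :: "'n rmat" assume V: "V \<in> orth_group"
  show "transpose V ** (V ** A ** mat 1) ** mat 1 = A" "V ** (transpose V ** A ** mat 1) ** mat 1 = A" for A
    by (simp_all add: orth_group_simps[OF V])
  show "\<exists>W\<in>orth_group. transpose W ** V ** mat 1 = mat 1" using V orth_group_simps(1)[OF V] by auto
  show "cayley (transpose V ** p ** mat 1) \<in> {X. transpose X = - X}"
    if "p \<in> orth_group" "invertible (transpose V ** p ** mat 1 + mat 1)" for p
    using cayley_skew[OF orth_group_mult[OF orth_group_transpose[OF V] that(1)]] that(2) by simp
  show "V ** inv_cayley X ** mat 1 \<in> orth_group" if "X \<in> {X. transpose X = - X}" for X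
    using orth_group_mult[OF V inv_cayley_orthogonal] that by simp
qed (rule that linear_matrix_mult_both | simp)+

text \<open>Near \<open>V J V^T\<close> a matrix \<open>Q\<close> is translated to
  \<open>U = V^T Q V J\<close>, and \<open>Q\<close> is symmetric iff \<open>J U J = U^T\<close>. On
  the Cayley side this becomes the extra linear condition \<open>J X J = - X\<close>.\<close>

lemma target_set_manifold:
  assumes k: "k \<le> CARD('n)"
  obtains T :: "('n::{finite, linorder} rmat, 'n rmat) manifold" where "submanifold_of_euclidean (target_set k) T"
proof -
  let ?J = "sig_matrix k :: 'n rmat"
  have J: "transpose ?J = ?J" "?J ** ?J = mat 1" by (rule transpose_sig_matrix sig_matrix_square)+
  have JJ: "?J ** (?J ** A) = A" for A :: "'n rmat" by (simp add: matrix_mul_assoc J)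
  \<comment> \<open>The skew matrices with both diagonal blocks zero, a space of dimension
    \<open>k (n - k)\<close>; it is trivial for \<open>k = n\<close>.\<close>
  let ?E = "{X :: 'n rmat. transpose X = - X \<and> ?J ** X ** ?J = - X}"
  show ?thesis
  proof (rule submanifold_of_cayley_charts[where I="orth_group :: 'n rmat set" and E="?E"
      and L="\<lambda>V A. transpose V ** A ** (V ** ?J)" and L'="\<lambda>V A. V ** A ** (?J ** transpose V)" and S="target_set k :: 'n rmat set"])
    show "subspace ?E"
      unfolding subspace_def
      by (simp add: transpose_linear_simps matrix_ring_simps) (simp add: transpose_def vec_eq_iff)
    show "\<exists>V\<in>orth_group. transpose V ** Q ** (V ** ?J) = mat 1" if Q: "Q \<in> target_set k" for Q
    proof -
      obtain V where V: "V \<in> orth_group" "Q = conj_sig k V" using Q target_set_eq[OF k] by auto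
      have "transpose V ** Q ** (V ** ?J) = mat 1"
        by (simp add: V(2) conj_sig_def orth_group_simps[OF V(1)] J flip: matrix_mul_assoc)
      then show ?thesis using V(1) by blast
    qed
    fix V :: "'n rmat" assume V: "V \<in> orth_group"
    show "transpose V ** (V ** A ** (?J ** transpose V)) ** (V ** ?J) = A"
      "V ** (transpose V ** A ** (V ** ?J)) ** (?J ** transpose V) = A" for A
      by (simp_all add: orth_group_simps[OF V] J JJ flip: matrix_mul_assoc)
    show "cayley (transpose V ** Q ** (V ** ?J)) \<in> ?E"
      if Q: "Q \<in> target_set k" and inv: "invertible (transpose V ** Q ** (V ** ?J) + mat 1)" for Q
    proof -
      define U where "U = transpose V ** Q ** (V ** ?J)"
      have Qo: "Q \<in> orth_group" "transpose Q = Q" using Q by (auto simp: target_set_def)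
      have U: "U \<in> orth_group" unfolding U_def
        by (intro orth_group_mult orth_group_transpose V Qo sig_matrix_orth_group)
      have sk: "transpose (cayley U) = - cayley U" using cayley_skew[OF U] inv by (simp add: U_def)
      have "?J ** U ** ?J = transpose U"
        by (simp add: U_def matrix_transpose_mul Qo J JJ flip: matrix_mul_assoc)
      then have JUJ: "?J ** (U + mat 1) ** ?J = transpose (U + mat 1)"
        by (simp add: matrix_ring_simps transpose_linear_simps J)
      let ?W = "matrix_inv (U + mat 1)"
      have W: "(U + mat 1) ** (?W ** A) = A" for A using inv by (simp add: matrix_mul_assoc matrix_inv_mult U_def)
      have "(?J ** (U + mat 1) ** ?J) ** (?J ** ?W ** ?J) = mat 1"
        by (simp add: J JJ W flip: matrix_mul_assoc)
      then have "?J ** ?W ** ?J = matrix_inv (transpose (U + mat 1))"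
        unfolding JUJ by (rule matrix_inv_unique(2)[symmetric])
      also have "\<dots> = transpose ?W" using inv by (simp add: transpose_matrix_inv U_def)
      finally have "?J ** cayley U ** ?J = transpose (cayley U)"
        by (simp add: cayley_def matrix_ring_simps transpose_linear_simps J)
      then show ?thesis using sk by (simp add: U_def)
    qed
    show "V ** inv_cayley X ** (?J ** transpose V) \<in> target_set k" if "X \<in> ?E" for X
    proof -
      have X: "transpose X = - X" "?J ** X ** ?J = - X" using that by auto
      define U where "U = inv_cayley X"
      have U: "U \<in> orth_group" unfolding U_def by (rule inv_cayley_orthogonal[OF X(1)])
      let ?Y = "matrix_inv (mat 1 - X)"
      have inv: "invertible (mat 1 - X)" by (rule invertible_one_minus_skew[OF X(1)])
      have Y: "(mat 1 - X) ** (?Y ** A) = A" "?Y ** (mat 1 - X) = mat 1" for A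
        by (simp_all add: matrix_mul_assoc matrix_inv_mult[OF inv])
      have JXJ: "?J ** (mat 1 - X) ** ?J = transpose (mat 1 - X)"
        by (simp add: matrix_ring_simps transpose_linear_simps J X)
      have "(?J ** (mat 1 - X) ** ?J) ** (?J ** ?Y ** ?J) = mat 1"
        by (simp add: J JJ Y flip: matrix_mul_assoc)
      then have "?J ** ?Y ** ?J = matrix_inv (transpose (mat 1 - X))"
        unfolding JXJ by (rule matrix_inv_unique(2)[symmetric])
      then have JYJ: "?J ** ?Y ** ?J = transpose ?Y" using inv by (simp add: transpose_matrix_inv)
      have JUJ: "?J ** U ** ?J = transpose U"
        by (simp add: U_def inv_cayley_def matrix_ring_simps transpose_linear_simps J JYJ)
      have YJ: "?Y ** ?J = ?J ** transpose ?Y" by (simp add: JYJ[symmetric] JJ flip: matrix_mul_assoc)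
      have UY: "U = (mat 1 + X) ** ?Y"
      proof -
        have "(mat 1 + X) ** ?Y = (2 *\<^sub>R mat 1 - (mat 1 - X)) ** ?Y" by (simp add: scaleR_2)
        also have "\<dots> = U" using Y(1)[of "mat 1"] by (simp add: matrix_diff_rdistrib[of "2 *\<^sub>R mat 1"] matrix_mult_scaleR_left U_def inv_cayley_def)
        finally show ?thesis ..
      qed
      have tY: "transpose ?Y ** (mat 1 + X) = mat 1"
        using matrix_inv_mult(2)[OF transpose_matrix_inv(1)[OF inv]] transpose_matrix_inv(2)[OF inv]
        by (simp add: transpose_linear_simps X)
      \<comment> \<open>\<open>U J = (1 + X) J Y^T\<close>, and cyclicity of the trace brings
        \<open>Y^T\<close> and \<open>1 + X\<close> together, whose product is 1. So the trace is
        that of \<open>J\<close>, whatever \<open>X\<close> is.\<close>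
      have "trace (U ** ?J) = trace ((mat 1 + X) ** (?J ** transpose ?Y))"
        by (simp add: UY YJ flip: matrix_mul_assoc)
      also have "\<dots> = trace ?J" by (subst trace_mul_sym) (simp add: tY flip: matrix_mul_assoc)
      finally have trU: "trace (U ** ?J) = 2 * real k - real CARD('n)" by (simp add: trace_sig_matrix[OF k])
      define Q where "Q = V ** U ** (?J ** transpose V)"
      have "Q \<in> orth_group" unfolding Q_def
        by (intro orth_group_mult orth_group_transpose V U sig_matrix_orth_group)
      moreover have "transpose Q = Q"
        by (simp add: Q_def matrix_transpose_mul JUJ[symmetric] J JJ flip: matrix_mul_assoc)
      moreover have "trace Q = trace (U ** ?J)"
      proof -
        have "trace Q = trace (V ** (U ** ?J ** transpose V))" by (simp add: Q_def matrix_mul_assoc)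
        also have "\<dots> = trace (U ** ?J)" by (subst trace_mul_sym) (simp add: orth_group_simps[OF V] flip: matrix_mul_assoc)
        finally show ?thesis .
      qed
      ultimately show ?thesis using trU by (simp add: target_set_def Q_def U_def)
    qed
  qed (rule that linear_matrix_mult_both | simp)+
qed

section \<open>The diffeomorphism\<close>

lemma compact_orth_group: "compact (orth_group :: 'n::finite rmat set)"
proof -
  have "norm V \<le> real CARD('n)" if "V \<in> orth_group" for V :: "'n rmat"
  proof -
    have "norm (V $ i) = 1" for i
      using that by (simp add: orth_group_def orthogonal_matrix_orthonormal_rows row_def vec_nth_inverse)
    moreover have "norm V \<le> (\<Sum>i\<in>UNIV. norm (V $ i))"
      by (subst norm_vec_def) (rule L2_set_le_sum, simp)
    ultimately show ?thesis by simp
  qed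
  then have "bounded (orth_group :: 'n rmat set)" by (auto simp: bounded_iff)
  moreover have "closed (orth_group :: 'n rmat set)"
  proof -
    have "Cinf_on (\<lambda>V :: 'n rmat. transpose V ** V) UNIV"
      by (intro Cinf_on_matrix_mult Cinf_on_transpose Cinf_on_ident open_UNIV)
    then have "closed ((\<lambda>V :: 'n rmat. transpose V ** V) -` {mat 1})"
      using Cinf_on_continuous by (intro closed_vimage) auto
    then show ?thesis by (simp add: orth_group_def orthogonal_matrix vimage_def)
  qed
  ultimately show ?thesis by (simp add: compact_eq_bounded_closed)
qed

text \<open>A continuous map of a compact space onto a Hausdorff space is a quotient map. So
  \<open>conj_sig k\<close> and the projection are two quotient maps of \<open>orth_group\<close>
  with the same fibres, and the bijection between their images is a homeomorphism.\<close>

lemma homeomorphic_map_phi1: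
  assumes k: "k \<le> CARD('n)"
  shows "homeomorphic_map (quotient_topology (top_of_set (orth_group :: 'n::{finite, linorder} rmat set)) (coset k))
    (top_of_set (target_set k)) (phi1 k)"
proof -
  let ?G = "top_of_set (orth_group :: 'n rmat set)" and ?T = "top_of_set (target_set k :: 'n rmat set)"
  let ?X = "quotient_topology ?G (coset k)"
  have "continuous_map ?G ?T (conj_sig k)"
    using smooth_on_continuous[OF smooth_on_conj_sig] by (simp add: target_set_eq[OF k] image_subset_iff_funcset[symmetric])
  then have "quotient_map ?G ?T (conj_sig k)"
    by (rule T1_Spaces.continuous_imp_quotient_map)
      (simp_all add: compact_space_subtopology compact_orth_group Hausdorff_space_subtopology target_set_eq[OF k])
  then have q: "quotient_map ?G ?T (phi1 k \<circ> coset k)"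
    by (rule quotient_map_eq) (simp add: phi1_coset[OF k])
  have \<pi>: "quotient_map ?G ?X (coset k)" by (rule quotient_map_quotient_topology)
  have "quotient_map ?X ?T (phi1 k)"
    by (rule quotient_map_from_composition[OF quotient_imp_continuous_map[OF \<pi>]
          continuous_compose_quotient_map[OF \<pi> quotient_imp_continuous_map[OF q]] q])
  moreover have "inj_on (phi1 k) (topspace ?X)"
    using inj_on_phi1[OF k] by (simp add: topspace_quotient_topology)
  ultimately show ?thesis
    by (auto simp: homeomorphic_eq_everything_map injective_quotient_map)
qed

text \<open>In the structure pulled back along \<open>phi1 k\<close> the projection is represented
  by \<open>conj_sig k\<close>, whose local sections through every orthogonal matrix make it a
  submersion.\<close>

lemma homogeneous_space_exists:
  fixes G T :: "('n::{finite, linorder} rmat, 'n rmat) manifold"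
  assumes k: "k \<le> CARD('n)" and G: "submanifold_of_euclidean orth_group G"
    and T: "submanifold_of_euclidean (target_set k) T"
  obtains M :: "('n rmat set, 'n rmat) manifold" where "homogeneous_space_structure k G M"
proof
  let ?X = "quotient_topology (mtop G) (coset k)"
  have hom: "homeomorphic_map ?X (mtop T) (phi1 k)"
    using homeomorphic_map_phi1[OF k] submanifold_of_euclideanD(1)[OF G] submanifold_of_euclideanD(1)[OF T] by simp
  have "smooth_submersion G T (phi1 k \<circ> coset k)"
  proof (rule smooth_submersion_local_sections[OF G T])
    show "smooth_on orth_group (phi1 k \<circ> (coset k :: 'n rmat \<Rightarrow> _))"
      by (rule smooth_on_cong[OF smooth_on_conj_sig]) (simp add: phi1_coset[OF k])
    show "(phi1 k \<circ> coset k) ` orth_group \<subseteq> (target_set k :: 'n rmat set)"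
      by (auto simp: phi1_coset[OF k] conj_sig_in_target_set[OF k])
    fix V :: "'n rmat" assume V: "V \<in> orth_group"
    obtain U \<sigma> where U: "open U" "conj_sig k V \<in> U" "smooth_on (U \<inter> target_set k) \<sigma>"
      "\<sigma> ` (U \<inter> target_set k) \<subseteq> orth_group" "\<sigma> (conj_sig k V) = V"
      "\<And>Q. Q \<in> U \<inter> target_set k \<Longrightarrow> conj_sig k (\<sigma> Q) = Q"
      using conj_sig_local_section[OF k V] by metis
    moreover have "(phi1 k \<circ> coset k) (\<sigma> Q) = Q" if "Q \<in> U \<inter> target_set k" for Q
      using U(4,6) that phi1_coset[OF k, of "\<sigma> Q"] by auto
    ultimately show "\<exists>U \<sigma>. open U \<and> (phi1 k \<circ> coset k) V \<in> U \<and> smooth_on (U \<inter> target_set k) \<sigma> \<and>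
      \<sigma> ` (U \<inter> target_set k) \<subseteq> orth_group \<and> \<sigma> ((phi1 k \<circ> coset k) V) = V \<and>
      (\<forall>Q\<in>U \<inter> target_set k. (phi1 k \<circ> coset k) (\<sigma> Q) = Q)"
      using phi1_coset[OF k V] by (intro exI[of _ U] exI[of _ \<sigma>]) auto
  qed
  then show "homogeneous_space_structure k G (pullback_manifold ?X (phi1 k) T)"
    unfolding homogeneous_space_structure_def
    using smooth_manifold_pullback[OF smooth_manifold_submanifold[OF T] hom]
      smooth_submersion_pullback[OF _ hom smooth_manifold_submanifold[OF G]
        quotient_imp_continuous_map[OF quotient_map_quotient_topology]]
    by (simp add: pullback_manifold_def)
qed

lemma diffeomorphism_phi1:
  fixes G :: "('n::{finite, linorder} rmat, 'e::euclidean_space) manifold"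
    and T :: "('n rmat, 'f::euclidean_space) manifold"
    and M :: "('n rmat set, 'g::euclidean_space) manifold"
  assumes k: "k \<le> CARD('n)" and G: "submanifold_of_euclidean orth_group G"
    and T: "submanifold_of_euclidean (target_set k) T" and M: "homogeneous_space_structure k G M"
  shows "diffeomorphism M T (phi1 k)"
proof -
  note DG = submanifold_of_euclideanD(1)[OF G] and DT = submanifold_of_euclideanD(1)[OF T]
  have sM: "smooth_manifold M" and top: "mtop M = quotient_topology (top_of_set orth_group) (coset k)"
    and sub: "smooth_submersion G M (coset k)"
    using M DG by (auto simp: homogeneous_space_structure_def)
  have car: "carrier_of M = coset k ` orth_group" by (simp add: top topspace_quotient_topology)
  have hom: "homeomorphic_map (mtop M) (mtop T) (phi1 k)"
    unfolding top DT by (rule homeomorphic_map_phi1[OF k])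
  let ?\<psi> = "inv_into (carrier_of M) (phi1 k)"
  have bij: "bij_betw (phi1 k) (carrier_of M) (carrier_of T)"
    using hom by (simp add: bij_betw_def homeomorphic_imp_injective_map homeomorphic_imp_surjective_map)
  have c\<psi>: "continuous_map (mtop T) (mtop M) ?\<psi>"
  proof -
    obtain g where g: "homeomorphic_maps (mtop M) (mtop T) (phi1 k) g" using hom homeomorphic_map_maps by blast
    \<comment> \<open>\<open>diffeomorphism\<close> speaks of \<open>inv_into\<close>, so continuity
      of the topological inverse \<open>g\<close> is transferred to it on the carrier.\<close>
    have eq: "g y = ?\<psi> y" if "y \<in> carrier_of T" for y
    proof -
      have "g y \<in> carrier_of M" "phi1 k (g y) = y"
        using g that by (auto simp: homeomorphic_maps_def continuous_map_def)
      then show ?thesis using bij by (metis bij_betw_def inv_into_f_f)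
    qed
    have "continuous_map (mtop T) (mtop M) g" using g by (simp add: homeomorphic_maps_def)
    then show ?thesis by (rule continuous_map_eq) (rule eq)
  qed
  have \<psi>: "?\<psi> (conj_sig k V) = coset k V" if "V \<in> orth_group" for V
  proof -
    have "?\<psi> (phi1 k (coset k V)) = coset k V"
      by (rule inv_into_f_f) (use bij that car in \<open>auto simp: bij_betw_def\<close>)
    then show ?thesis by (simp add: phi1_coset[OF k that])
  qed
  have "smooth_map M T (phi1 k)"
  proof (rule smooth_map_from_quotient[OF smooth_manifold_submanifold[OF G] sM sub])
    show "coset k ` carrier_of G = carrier_of M" by (simp add: car DG)
    show "smooth_map G T (phi1 k \<circ> coset k)"
      by (rule smooth_map_submanifold[OF G T smooth_on_cong[OF smooth_on_conj_sig]])
        (auto simp: phi1_coset[OF k] conj_sig_in_target_set[OF k])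
  qed (rule homeomorphic_imp_continuous_map[OF hom])
  moreover have "smooth_map T M ?\<psi>"
  proof (rule smooth_map_local_lift[OF T G _ c\<psi>])
    show "smooth_map G M (coset k)" using sub by (simp add: smooth_submersion_def)
    fix Q :: "'n rmat" assume "Q \<in> target_set k"
    then obtain V where V: "V \<in> orth_group" "Q = conj_sig k V" using target_set_eq[OF k] by blast
    obtain U \<sigma> where U: "open U" "conj_sig k V \<in> U" "smooth_on (U \<inter> target_set k) \<sigma>"
      "\<sigma> ` (U \<inter> target_set k) \<subseteq> orth_group" "\<sigma> (conj_sig k V) = V"
      "\<And>Q. Q \<in> U \<inter> target_set k \<Longrightarrow> conj_sig k (\<sigma> Q) = Q"
      using conj_sig_local_section[OF k V(1)] by metis
    \<comment> \<open>\<open>R\<close> is the conjugate given by \<open>\<sigma> R\<close>, so the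
      inverse map sends it to the coset of \<open>\<sigma> R\<close>: the local section is the
      required lift.\<close>
    moreover have "?\<psi> R = coset k (\<sigma> R)" if "R \<in> U \<inter> target_set k" for R
      using \<psi>[of "\<sigma> R"] U(4,6) that by auto
    ultimately show "\<exists>U \<sigma>. open U \<and> Q \<in> U \<and> smooth_on (U \<inter> target_set k) \<sigma> \<and>
      \<sigma> ` (U \<inter> target_set k) \<subseteq> orth_group \<and> (\<forall>R\<in>U \<inter> target_set k. ?\<psi> R = coset k (\<sigma> R))"
      unfolding V(2) by blast
  qed
  ultimately show ?thesis using bij by (simp add: diffeomorphism_def)
qed

theorem proposition2p2:
  fixes k :: nat
  assumes "k \<in> {1..CARD('n::{finite, linorder})}"
  shows
    "(\<exists>(G :: ('n rmat, 'n rmat) manifold) (T :: ('n rmat, 'n rmat) manifold)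
        (M :: ('n rmat set, 'n rmat) manifold).
        embedded_submanifold orth_group G euclidean_manifold \<and>
        embedded_submanifold (target_set k) T G \<and>
        homogeneous_space_structure k G M) \<and>
     (\<forall>V \<in> (orth_group :: 'n rmat set).
        (\<forall>W \<in> coset k V. W ** sig_matrix k ** transpose W = V ** sig_matrix k ** transpose V) \<and>
        phi1 k (coset k V) = V ** sig_matrix k ** transpose V) \<and>
     (\<forall>(G :: ('n rmat, 'e::euclidean_space) manifold)
        (T :: ('n rmat, 'f::euclidean_space) manifold)
        (M :: ('n rmat set, 'g::euclidean_space) manifold).
        embedded_submanifold orth_group G euclidean_manifold \<longrightarrow>
        embedded_submanifold (target_set k) T G \<longrightarrow>
        homogeneous_space_structure k G M \<longrightarrow>
        diffeomorphism M T (phi1 k)) \<and>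
     (\<forall>Q \<in> (target_set k :: 'n rmat set).
        (\<exists>V. eigenvector_matrix k Q V) \<and>
        (\<forall>V. eigenvector_matrix k Q V \<longrightarrow>
           Q = V ** sig_matrix k ** transpose V \<and>
           inv_into (coset k ` orth_group) (phi1 k) Q = coset k V))"
proof (intro conjI ballI allI impI)
  have k: "k \<le> CARD('n)" using assms by simp
  obtain G :: "('n rmat, 'n rmat) manifold" where G: "submanifold_of_euclidean orth_group G"
    by (rule orth_group_manifold)
  obtain T :: "('n rmat, 'n rmat) manifold" where T: "submanifold_of_euclidean (target_set k) T"
    by (rule target_set_manifold[OF k])
  obtain M :: "('n rmat set, 'n rmat) manifold" where M: "homogeneous_space_structure k G M"
    by (rule homogeneous_space_exists[OF k G T])
  have "embedded_submanifold orth_group G euclidean_manifold"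
    by (rule embedded_submanifoldI[OF G euclidean_submanifold_of_euclidean]) simp
  moreover have "embedded_submanifold (target_set k) T G"
    by (rule embedded_submanifoldI[OF T G]) (auto simp: target_set_def)
  ultimately show "\<exists>(G :: ('n rmat, 'n rmat) manifold) (T :: ('n rmat, 'n rmat) manifold)
        (M :: ('n rmat set, 'n rmat) manifold).
        embedded_submanifold orth_group G euclidean_manifold \<and>
        embedded_submanifold (target_set k) T G \<and>
        homogeneous_space_structure k G M" using M by blast
next
  fix V W :: "'n rmat" assume "V \<in> orth_group" "W \<in> coset k V"
  then show "W ** sig_matrix k ** transpose W = V ** sig_matrix k ** transpose V"
    using assms by (simp add: coset_eq_fibre conj_sig_def)
next
  fix V :: "'n rmat" assume "V \<in> orth_group"
  then show "phi1 k (coset k V) = V ** sig_matrix k ** transpose V"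
    using assms by (simp add: phi1_coset conj_sig_def)
next
  fix G :: "('n rmat, 'e) manifold" and T :: "('n rmat, 'f) manifold" and M :: "('n rmat set, 'g) manifold"
  assume G: "embedded_submanifold orth_group G euclidean_manifold"
    and T: "embedded_submanifold (target_set k) T G" and M: "homogeneous_space_structure k G M"
  \<comment> \<open>\<open>T\<close> is embedded in \<open>G\<close> rather than directly in the
    matrix space, so \<open>G\<close> is first recognized as a submanifold of the matrix space and
    then serves as the ambient manifold for \<open>T\<close>.\<close>
  have G': "submanifold_of_euclidean orth_group G"
    by (rule embedded_submanifold_imp_submanifold_of_euclidean[OF G euclidean_submanifold_of_euclidean])
  show "diffeomorphism M T (phi1 k)"
    by (rule diffeomorphism_phi1[OF _ G' embedded_submanifold_imp_submanifold_of_euclidean[OF T G'] M])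
      (use assms in simp)
next
  fix Q :: "'n rmat" assume "Q \<in> target_set k"
  then show "\<exists>V. eigenvector_matrix k Q V"
    using assms target_set_eq[of k, where 'n='n] by (auto simp: eigenvector_matrix_iff)
next
  fix Q V :: "'n rmat" assume "eigenvector_matrix k Q V"
  then have V: "V \<in> orth_group" "Q = conj_sig k V" by (auto simp: eigenvector_matrix_iff)
  then show "Q = V ** sig_matrix k ** transpose V" by (simp add: conj_sig_def)
  have "inv_into (coset k ` orth_group) (phi1 k) (phi1 k (coset k V)) = coset k V"
    by (rule inv_into_f_f[OF inj_on_phi1]) (use assms V in auto)
  then show "inv_into (coset k ` orth_group) (phi1 k) Q = coset k V"
    using assms V by (simp add: phi1_coset)
qed

end
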